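(* Let $1<p<2$, let $q$ be the Hölder conjugate of $p$, and let $X=B_p^s(\mathbb R^d)$ with the wavelet norm $\|\cdot\|_X$ of the context, $R(f)=\frac1p\|f\|_X^p$ and $\widetilde R(f)=R(f)+\iota_+(f)$. Suppose that the forward operator satisfies (A1) and (A2), that $f^\dagger\in X$ satisfies $f^\dagger\ge 0$ a.e., and that the following hold: (B1) there exists $w\in Z$ such that $r^\dagger=A_\mu^*w$, where $r^\dagger=\nabla R(f^\dagger)$; (B2) $\sum_{\lambda=1}^\infty c_{\lambda,q,-s,d}\,\|A\psi_\lambda\|_\infty^q<\infty$, where $c_{\lambda,q,-s,d}=2^{|\lambda|d\left(q\left(-\frac sd+\frac12\right)-1\right)}$. Let $f^\delta_{\alpha,N}$ be the minimizer over $X$ of $f\mapsto \frac12\|A_{\mathbf u}f-\mathbf g_N^\delta\|_{V_N}^2+\alpha R(f)+\iota_+(f)$. Then, as $N\to\infty$ (with $\delta=\delta(N)>0$): - if $\delta N\to\infty$ and $\delta^2/N\to0$, then $\mathbb E\big[D_{\widetilde R}(f^\delta_{\alpha,N},f^\dagger)\big]\lesssim\left(\frac{\delta^2}{N}\right)^{1/3}$ for $\alpha\simeq\left(\frac{\delta^2}{N}\right)^{1/3}$; - if $\delta N$ is bounded, then $\mathbb E\big[D_{\widetilde R}(f^\delta_{\alpha,N},f^\dagger)\big]\lesssim N^{-1}$ for $\alpha\simeq N^{-1}$.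
   Context: Forward operator. $X$ is a separable Banach space, $U\subset\mathbb R^{d_U}$, $V$ is a Hilbert space, $Y=L^2(U;V)$, and $A:X\to Y$ is a bounded linear operator whose range lies in a Banach space $Z\subset Y$ with $Z\subset\mathcal C(U;V)$ continuously, and $A:X\to Z$ is continuous. $\|g\|_\infty=\sup_{u\in U}\|g(u)\|_V$. For $u\in U$, $A_uf=(Af)(u)$. (A1): there is $\kappa\le1$ with $\|A_uf\|_V\le\kappa\|f\|_X$ for all $u\in U$, $f\in X$. (A2): $u\mapsto(Af)(u)$ is measurable for every $f\in X$. Sampling. $V_N=\bigoplus_{n=1}^NV$ has inner product $\langle\mathbf v,\tilde{\mathbf v}\rangle_{V_N}=\frac1N\sum_{n=1}^N\langle v_n,\tilde v_n\rangle_V$. For $\mathbf u=(u_n)_{n=1}^N\in U^N$, $A_{\mathbf u}f=((Af)(u_n))_{n=1}^N\in V_N$. The points $u_n$ are i.i.d. with law a probability measure $\mu$ on $U$. $Y_\mu=L^2(U,\mu;V)$ and $A_\mu:X\to Y_\mu$ is given by $\langle A_\mu f,g\rangle_{Y_\mu}=\int_U\langle(Af)(u),g(u)\rangle_V\,\mu(du)$ for all $g\in Y_\mu$; $A_\mu^*:Y_\mu\to X^*$ is its adjoint (and $Z\subset \mathcal C(U;V)\subset Y_\mu$). Data. $\mathbf g_N^\delta=A_{\mathbf u}f^\dagger+\delta\epsilon_N$, where $\delta>0$ and $\epsilon_N=(\epsilon_N^n)_{n=1}^N$ has i.i.d. entries distributed as a zero-mean $V$-valued random variable $\epsilon$, independent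 of the $u_n$, with $\mathbb E[\|\epsilon\|_V^l]<\frac{l!}2\Sigma^{l-2}$ for all $l\ge2$ and some constant $\Sigma>0$. Besov norm. $\{\psi_\lambda\}_{\lambda\ge1}$ is an orthonormal wavelet basis of $L^2(\mathbb R^d)$, $|\lambda|$ denotes the scale of $\psi_\lambda$, and $X=B^s_p(\mathbb R^d)$ is equipped with the norm $\|f\|_X=\big(\sum_{\lambda}c_{\lambda,p,s,d}|\langle f,\psi_\lambda\rangle|^p\big)^{1/p}$, $c_{\lambda,p,s,d}=2^{|\lambda|d\left(p\left(\frac sd+\frac12\right)-1\right)}$; the wavelets are such that this is an equivalent norm on $B_p^s(\mathbb R^d)$. Constraint and Bregman distance. $\iota_+(f)=0$ if $f\ge0$ a.e. and $\iota_+(f)=\infty$ otherwise. For $f,\tilde f\in X$ with $f,\tilde f\ge0$ a.e., $D_{\widetilde R}(f,\tilde f)=\langle\nabla R(f)-\nabla R(\tilde f),f-\tilde f\rangle_{X^*\times X}$. $a\lesssim b$ means $a\le Cb$ with $C>0$ independent of $N$, $\delta$ and $\alpha$; $a\simeq b$ means $a$ equals $b$ up to multiplicative constants bounded above and below by positive constants independent of $N$ and $\delta$. The expectation is over $\mathbf u$ and $\epsilon_N$. *)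

theory Defs
  imports "HOL-Probability.Probability"
begin

section \<open>Real tempered distributions\<close>

text \<open>Iterated directional derivatives, the last direction of the list being applied first.\<close>

primrec iter_deriv :: "'a list \<Rightarrow> ('a::real_normed_vector \<Rightarrow> real) \<Rightarrow> 'a \<Rightarrow> real" where
  "iter_deriv [] f = f"
| "iter_deriv (b # bs) f = (\<lambda>x. frechet_derivative (iter_deriv bs f) (at x) b)"

definition schwartz :: "('a::euclidean_space \<Rightarrow> real) \<Rightarrow> bool" where
  "schwartz f \<longleftrightarrow> (\<forall>bs \<in> lists Basis.
      (\<forall>x. iter_deriv bs f differentiable at x) \<and>
      (\<forall>k::nat. bounded (range (\<lambda>x. (1 + norm x) ^ k * iter_deriv bs f x))))"

definition schwartz_seminorm :: "nat \<Rightarrow> ('a::euclidean_space \<Rightarrow> real) \<Rightarrow> real" where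
  "schwartz_seminorm k f =
     (SUP (bs, x) \<in> {bs \<in> lists Basis. length bs \<le> k} \<times> UNIV.
        (1 + norm x) ^ k * \<bar>iter_deriv bs f x\<bar>)"

text \<open>A tempered distribution is a continuous linear functional on the Schwartz space. Outside of
  the Schwartz space it is given the dummy value \<open>0\<close>, so that equality is equality of functionals.\<close>

definition tempered :: "(('a::euclidean_space \<Rightarrow> real) \<Rightarrow> real) \<Rightarrow> bool" where
  "tempered T \<longleftrightarrow>
     (\<forall>f g a b. schwartz f \<longrightarrow> schwartz g \<longrightarrow> T (\<lambda>x. a * f x + b * g x) = a * T f + b * T g) \<and>
     (\<exists>C m. \<forall>f. schwartz f \<longrightarrow> \<bar>T f\<bar> \<le> C * (\<Sum>k\<le>m. schwartz_seminorm k f)) \<and>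
     (\<forall>f. \<not> schwartz f \<longrightarrow> T f = 0)"

lemma schwartz_seminorm_nonneg:
  assumes "schwartz f"
  shows "0 \<le> schwartz_seminorm k f"
proof -
  let ?D = "{bs \<in> lists (Basis :: 'a set). length bs \<le> k}"
  define g where "g = (\<lambda>(bs, x). (1 + norm x) ^ k * \<bar>iter_deriv bs f x\<bar>)"
  have fin: "finite ?D"
    using finite_lists_length_le[OF finite_Basis, of k] by (simp add: lists_eq_set Collect_conj_eq)
  have "bdd_above (g ` ({bs} \<times> UNIV))" if "bs \<in> ?D" for bs
  proof -
    have "bounded (range (\<lambda>x. (1 + norm x) ^ k * iter_deriv bs f x))"
      using assms that unfolding schwartz_def by blast
    then obtain c where "\<And>x. \<bar>(1 + norm x) ^ k * iter_deriv bs f x\<bar> \<le> c"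
      unfolding bounded_iff by (metis rangeI real_norm_def)
    then show ?thesis by (intro bdd_aboveI[of _ c]) (auto simp: g_def abs_mult)
  qed
  then have "bdd_above (\<Union>bs\<in>?D. g ` ({bs} \<times> UNIV))"
    by (simp only: bdd_above_UN[OF fin]) simp
  moreover have "(\<Union>bs\<in>?D. g ` ({bs} \<times> UNIV)) = g ` (?D \<times> UNIV)" by blast
  ultimately have "bdd_above (g ` (?D \<times> UNIV))" by simp
  then have "g ([], 0) \<le> (SUP z \<in> ?D \<times> UNIV. g z)" by (intro cSUP_upper) auto
  moreover have "0 \<le> g ([], 0)" by (simp add: g_def)
  ultimately show ?thesis by (simp add: schwartz_seminorm_def g_def)
qed

lemma tempered_lincomb:
  assumes "tempered S" "tempered T"
  shows "tempered (\<lambda>f. a * S f + b * T f)"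
proof -
  obtain C m where S: "\<And>f. schwartz f \<Longrightarrow> \<bar>S f\<bar> \<le> C * (\<Sum>k\<le>m. schwartz_seminorm k f)"
    using assms(1) unfolding tempered_def by blast
  obtain D n where T: "\<And>f. schwartz f \<Longrightarrow> \<bar>T f\<bar> \<le> D * (\<Sum>k\<le>n. schwartz_seminorm k f)"
    using assms(2) unfolding tempered_def by blast
  have "\<bar>a * S f + b * T f\<bar> \<le>
      (\<bar>a\<bar> * \<bar>C\<bar> + \<bar>b\<bar> * \<bar>D\<bar>) * (\<Sum>k\<le>max m n. schwartz_seminorm k f)" if f: "schwartz f" for f
  proof -
    let ?s = "\<lambda>m. \<Sum>k\<le>m. schwartz_seminorm k f"
    have mono: "?s i \<le> ?s j" if "i \<le> j" for i j
      using that by (intro sum_mono2) (auto simp: schwartz_seminorm_nonneg[OF f])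
    have pos: "0 \<le> ?s i" for i by (intro sum_nonneg) (simp add: schwartz_seminorm_nonneg[OF f])
    have "\<bar>S f\<bar> \<le> \<bar>C\<bar> * ?s (max m n)"
      using S[OF f] mult_right_mono[OF abs_ge_self[of C] pos[of m]]
        mult_left_mono[OF mono[of m "max m n"], of "\<bar>C\<bar>"] by simp
    moreover have "\<bar>T f\<bar> \<le> \<bar>D\<bar> * ?s (max m n)"
      using T[OF f] mult_right_mono[OF abs_ge_self[of D] pos[of n]]
        mult_left_mono[OF mono[of n "max m n"], of "\<bar>D\<bar>"] by simp
    ultimately have "\<bar>a\<bar> * \<bar>S f\<bar> + \<bar>b\<bar> * \<bar>T f\<bar> \<le>
        \<bar>a\<bar> * (\<bar>C\<bar> * ?s (max m n)) + \<bar>b\<bar> * (\<bar>D\<bar> * ?s (max m n))"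
      by (intro add_mono mult_left_mono) auto
    moreover have "\<bar>a * S f + b * T f\<bar> \<le> \<bar>a\<bar> * \<bar>S f\<bar> + \<bar>b\<bar> * \<bar>T f\<bar>"
      by (metis abs_mult abs_triangle_ineq)
    ultimately show ?thesis by (simp add: algebra_simps)
  qed
  then have "\<exists>C m. \<forall>f. schwartz f \<longrightarrow> \<bar>a * S f + b * T f\<bar> \<le> C * (\<Sum>k\<le>m. schwartz_seminorm k f)"
    by blast
  then show ?thesis using assms unfolding tempered_def by (simp add: algebra_simps)
qed

lemma tempered_zero: "tempered (\<lambda>f. 0)"
  unfolding tempered_def by (auto intro!: exI[of _ "0::real"])

typedef (overloaded) 'a tempered_dist = "{T :: ('a::euclidean_space \<Rightarrow> real) \<Rightarrow> real. tempered T}"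
  morphisms dist_apply Abs_tempered_dist
  using tempered_zero by blast

setup_lifting type_definition_tempered_dist

instantiation tempered_dist :: (euclidean_space) real_vector
begin

lift_definition zero_tempered_dist :: "'a tempered_dist" is "\<lambda>f. 0"
  by (rule tempered_zero)

lift_definition plus_tempered_dist :: "'a tempered_dist \<Rightarrow> 'a tempered_dist \<Rightarrow> 'a tempered_dist"
  is "\<lambda>S T f. S f + T f"
  using tempered_lincomb[of _ _ 1 1] by simp

lift_definition minus_tempered_dist :: "'a tempered_dist \<Rightarrow> 'a tempered_dist \<Rightarrow> 'a tempered_dist"
  is "\<lambda>S T f. S f - T f"
  using tempered_lincomb[of _ _ 1 "-1"] by simp

lift_definition uminus_tempered_dist :: "'a tempered_dist \<Rightarrow> 'a tempered_dist"
  is "\<lambda>T f. - T f"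
  using tempered_lincomb[of _ _ "-1" 0] by simp

lift_definition scaleR_tempered_dist :: "real \<Rightarrow> 'a tempered_dist \<Rightarrow> 'a tempered_dist"
  is "\<lambda>a T f. a * T f"
  using tempered_lincomb[of _ _ _ 0] by simp

instance
  by standard (transfer; simp add: algebra_simps)+

end

definition represents :: "'a::euclidean_space tempered_dist \<Rightarrow> ('a \<Rightarrow> real) \<Rightarrow> bool" where
  "represents T h \<longleftrightarrow> h \<in> borel_measurable lborel \<and>
     (\<forall>\<phi>. schwartz \<phi> \<longrightarrow> integrable lborel (\<lambda>x. h x * \<phi> x) \<and>
                      dist_apply T \<phi> = (\<integral>x. h x * \<phi> x \<partial>lborel))"

text \<open>The distribution given by a function; meaningful only if there is one.\<close>

definition dist_of :: "('a::euclidean_space \<Rightarrow> real) \<Rightarrow> 'a tempered_dist" where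
  "dist_of h = (THE T. represents T h)"

definition nonneg_ae :: "'a::euclidean_space tempered_dist \<Rightarrow> bool" where
  "nonneg_ae T \<longleftrightarrow> (\<exists>h. represents T h \<and> (AE x in lborel. 0 \<le> h x))"


section \<open>The Besov space with equal integrability and summability index\<close>

text \<open>The function \<open>\<Phi>\<close> is the inverse Fourier transform of the cut-off function
  \<open>\<phi>\<^sub>0\<close> of a dyadic resolution of unity: \<open>\<phi>\<^sub>0 = 1\<close> on the unit ball and \<open>\<phi>\<^sub>0 = 0\<close> outside of the
  ball of radius 2. The kernel \<open>lp_kernel \<Phi> j\<close> is then the inverse Fourier transform of
  \<open>\<phi>\<^sub>j = \<phi>\<^sub>0(2^{-j} \<cdot>) - \<phi>\<^sub>0(2^{1-j} \<cdot>)\<close>, \<open>j \<ge> 1\<close>.\<close>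

definition littlewood_paley :: "('a::euclidean_space \<Rightarrow> real) \<Rightarrow> bool" where
  "littlewood_paley \<Phi> \<longleftrightarrow> schwartz \<Phi> \<and>
     (\<forall>\<xi>. norm \<xi> \<le> 1 \<longrightarrow> (\<integral>x. complex_of_real (\<Phi> x) * cis (- (x \<bullet> \<xi>)) \<partial>lborel) = 1) \<and>
     (\<forall>\<xi>. 2 \<le> norm \<xi> \<longrightarrow> (\<integral>x. complex_of_real (\<Phi> x) * cis (- (x \<bullet> \<xi>)) \<partial>lborel) = 0)"

fun lp_kernel :: "('a::euclidean_space \<Rightarrow> real) \<Rightarrow> nat \<Rightarrow> 'a \<Rightarrow> real" where
  "lp_kernel \<Phi> 0 x = \<Phi> x"
| "lp_kernel \<Phi> (Suc j) x =
     2 ^ (Suc j * DIM('a)) * \<Phi> (2 ^ Suc j *\<^sub>R x) - 2 ^ (j * DIM('a)) * \<Phi> (2 ^ j *\<^sub>R x)"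

text \<open>The convolution of a tempered distribution with the \<open>j\<close>-th kernel.\<close>

definition lp_block :: "('a::euclidean_space \<Rightarrow> real) \<Rightarrow> nat \<Rightarrow> 'a tempered_dist \<Rightarrow> 'a \<Rightarrow> real" where
  "lp_block \<Phi> j T x = dist_apply T (\<lambda>y. lp_kernel \<Phi> j (x - y))"

definition besov_space ::
    "('a::euclidean_space \<Rightarrow> real) \<Rightarrow> real \<Rightarrow> real \<Rightarrow> 'a tempered_dist set" where
  "besov_space \<Phi> s p = {T.
     (\<forall>j. lp_block \<Phi> j T \<in> borel_measurable lborel \<and>
          integrable lborel (\<lambda>x. \<bar>lp_block \<Phi> j T x\<bar> powr p)) \<and>
     summable (\<lambda>j. 2 powr (real j * s * p) * (\<integral>x. \<bar>lp_block \<Phi> j T x\<bar> powr p \<partial>lborel))}"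

definition besov_norm ::
    "('a::euclidean_space \<Rightarrow> real) \<Rightarrow> real \<Rightarrow> real \<Rightarrow> 'a tempered_dist \<Rightarrow> real" where
  "besov_norm \<Phi> s p T =
     (\<Sum>j. 2 powr (real j * s * p) * (\<integral>x. \<bar>lp_block \<Phi> j T x\<bar> powr p \<partial>lborel)) powr (1 / p)"


section \<open>Wavelets\<close>

definition square_integrable :: "('a::euclidean_space \<Rightarrow> real) \<Rightarrow> bool" where
  "square_integrable h \<longleftrightarrow> h \<in> borel_measurable lborel \<and> integrable lborel (\<lambda>x. (h x)\<^sup>2)"

definition orthonormal_L2_basis :: "(nat \<Rightarrow> 'a::euclidean_space \<Rightarrow> real) \<Rightarrow> bool" where
  "orthonormal_L2_basis \<psi> \<longleftrightarrow>
     (\<forall>i. square_integrable (\<psi> i)) \<and>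
     (\<forall>i j. (\<integral>x. \<psi> i x * \<psi> j x \<partial>lborel) = (if i = j then 1 else 0)) \<and>
     (\<forall>h. square_integrable h \<longrightarrow> (\<forall>i. (\<integral>x. h x * \<psi> i x \<partial>lborel) = 0) \<longrightarrow> (AE x in lborel. h x = 0))"

text \<open>An inhomogeneous dyadic wavelet basis, enumerated by a single index \<open>i\<close>: the generator
  \<open>g 0\<close> is the father wavelet (used on the coarsest scale \<open>j\<^sub>0\<close> only), \<open>g 1, \<dots>, g m\<close> are the mother
  wavelets, \<open>k\<close> runs over the integer lattice, and \<open>level i\<close> is the scale of the \<open>i\<close>-th wavelet.\<close>

definition wavelet_basis :: "(nat \<Rightarrow> 'a::euclidean_space \<Rightarrow> real) \<Rightarrow> (nat \<Rightarrow> int) \<Rightarrow> bool" where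
  "wavelet_basis \<psi> level \<longleftrightarrow> orthonormal_L2_basis \<psi> \<and>
     (\<exists>(j\<^sub>0::int) (m::nat) (g :: nat \<Rightarrow> 'a \<Rightarrow> real) (\<iota> :: nat \<Rightarrow> int \<times> nat \<times> 'a).
        bij_betw \<iota> UNIV
          {(j, e, k). (j = j\<^sub>0 \<and> e = 0 \<or> j\<^sub>0 \<le> j \<and> 1 \<le> e \<and> e \<le> m) \<and> (\<forall>b\<in>Basis. k \<bullet> b \<in> \<int>)} \<and>
        (\<forall>i. case \<iota> i of (j, e, k) \<Rightarrow>
           level i = j \<and>
           \<psi> i = (\<lambda>x. 2 powr (real_of_int j * DIM('a) / 2) * g e ((2 powi j) *\<^sub>R x - k))))"

text \<open>For a general element \<open>f\<close> of the Besov space (which need not be a function), \<open>\<langle>f, \<psi>\<^sub>i\<rangle>\<close>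
  is the value at \<open>f\<close> of the continuous linear extension of \<open>h \<mapsto> \<integral> h \<psi>\<^sub>i\<close> from the square integrable
  functions in the space; it is unique because these functions are dense (for finite \<open>p\<close>).\<close>

definition wavelet_pairing ::
    "('a::euclidean_space \<Rightarrow> real) \<Rightarrow> real \<Rightarrow> real \<Rightarrow> (nat \<Rightarrow> 'a \<Rightarrow> real) \<Rightarrow>
     ('a tempered_dist \<Rightarrow> nat \<Rightarrow> real) \<Rightarrow> bool" where
  "wavelet_pairing \<Phi> s p \<psi> pair \<longleftrightarrow> (\<forall>i.
     (\<forall>f\<in>besov_space \<Phi> s p. \<forall>g\<in>besov_space \<Phi> s p. \<forall>a b.
        pair (a *\<^sub>R f + b *\<^sub>R g) i = a * pair f i + b * pair g i) \<and>
     (\<exists>K. \<forall>f\<in>besov_space \<Phi> s p. \<bar>pair f i\<bar> \<le> K * besov_norm \<Phi> s p f) \<and>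
     (\<forall>f\<in>besov_space \<Phi> s p. \<forall>h. square_integrable h \<longrightarrow> represents f h \<longrightarrow>
        pair f i = (\<integral>x. h x * \<psi> i x \<partial>lborel)))"

definition besov_weight :: "int \<Rightarrow> real \<Rightarrow> real \<Rightarrow> nat \<Rightarrow> real" where
  "besov_weight j p s d = 2 powr (real_of_int j * real d * (p * (s / real d + 1 / 2) - 1))"

definition wavelet_norm ::
    "(nat \<Rightarrow> int) \<Rightarrow> ('a::euclidean_space tempered_dist \<Rightarrow> nat \<Rightarrow> real) \<Rightarrow> real \<Rightarrow> real \<Rightarrow>
     'a tempered_dist \<Rightarrow> real" where
  "wavelet_norm level pair s p f =
     (\<Sum>i. besov_weight (level i) p s DIM('a) * \<bar>pair f i\<bar> powr p) powr (1 / p)"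

definition wavelet_norm_equivalent ::
    "('a::euclidean_space \<Rightarrow> real) \<Rightarrow> real \<Rightarrow> real \<Rightarrow> (nat \<Rightarrow> 'a \<Rightarrow> real) \<Rightarrow> (nat \<Rightarrow> int) \<Rightarrow>
     ('a tempered_dist \<Rightarrow> nat \<Rightarrow> real) \<Rightarrow> bool" where
  "wavelet_norm_equivalent \<Phi> s p \<psi> level pair \<longleftrightarrow>
     (\<forall>i. \<exists>T\<in>besov_space \<Phi> s p. represents T (\<psi> i)) \<and>
     (\<forall>f\<in>besov_space \<Phi> s p.
        summable (\<lambda>i. besov_weight (level i) p s DIM('a) * \<bar>pair f i\<bar> powr p)) \<and>
     (\<exists>c>0. \<exists>C>0. \<forall>f\<in>besov_space \<Phi> s p.
        c * besov_norm \<Phi> s p f \<le> wavelet_norm level pair s p f \<and>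
        wavelet_norm level pair s p f \<le> C * besov_norm \<Phi> s p f)"


section \<open>The forward operator\<close>

text \<open>A Banach space \<open>Z\<close> of square integrable functions that embeds continuously into \<open>C(U;V)\<close> is
  given by a Banach space type and the map \<open>emb\<close> that sends \<open>z\<close> to the corresponding function
  (whose values outside of \<open>U\<close> are irrelevant).\<close>

definition function_space_embedding ::
    "'u::euclidean_space set \<Rightarrow> ('z::banach \<Rightarrow> 'u \<Rightarrow> 'v::{real_inner,banach}) \<Rightarrow> bool" where
  "function_space_embedding U emb \<longleftrightarrow>
     (\<forall>y z a b. \<forall>u\<in>U. emb (a *\<^sub>R y + b *\<^sub>R z) u = a *\<^sub>R emb y u + b *\<^sub>R emb z u) \<and>
     (\<forall>z. (\<forall>u\<in>U. emb z u = 0) \<longrightarrow> z = 0) \<and>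
     (\<forall>z. continuous_on U (emb z)) \<and>
     (\<forall>z. set_integrable lebesgue U (\<lambda>u. (norm (emb z u))\<^sup>2)) \<and>
     (\<exists>C. \<forall>z. \<forall>u\<in>U. norm (emb z u) \<le> C * norm z)"

text \<open>Linearity of \<open>A\<close> on \<open>X\<close>, continuity into \<open>Z\<close>, and boundedness into \<open>L\<^sup>2(U;V)\<close>.\<close>

definition forward_operator ::
    "'x::real_vector set \<Rightarrow> ('x \<Rightarrow> real) \<Rightarrow> 'u::euclidean_space set \<Rightarrow>
     ('z::banach \<Rightarrow> 'u \<Rightarrow> 'v::{real_inner,banach}) \<Rightarrow> ('x \<Rightarrow> 'z) \<Rightarrow> bool" where
  "forward_operator X normX U emb A \<longleftrightarrow>
     (\<forall>f\<in>X. \<forall>g\<in>X. \<forall>a b. A (a *\<^sub>R f + b *\<^sub>R g) = a *\<^sub>R A f + b *\<^sub>R A g) \<and>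
     (\<exists>K. \<forall>f\<in>X. norm (A f) \<le> K * normX f) \<and>
     (\<exists>K. \<forall>f\<in>X. sqrt (LINT u:U|lebesgue. (norm (emb (A f) u))\<^sup>2) \<le> K * normX f)"

definition sup_norm_on :: "'u set \<Rightarrow> ('u \<Rightarrow> 'v::real_normed_vector) \<Rightarrow> real" where
  "sup_norm_on U g = (SUP u\<in>U. norm (g u))"

text \<open>For the operator \<open>K\<close> from \<open>X\<close> into \<open>L\<^sup>2(U,\<mu>;V)\<close> and \<open>w\<close> in that space: the functional
  \<open>K\<^sup>* w\<close>.\<close>

definition adjoint_on :: "'u measure \<Rightarrow> ('x \<Rightarrow> 'u \<Rightarrow> 'v::real_inner) \<Rightarrow> ('u \<Rightarrow> 'v) \<Rightarrow> 'x \<Rightarrow> real" where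
  "adjoint_on \<mu> K w f = (\<integral>u. K f u \<bullet> w u \<partial>\<mu>)"


section \<open>Sampling and noise\<close>

definition VN_inner :: "nat \<Rightarrow> (nat \<Rightarrow> 'v::real_inner) \<Rightarrow> (nat \<Rightarrow> 'v) \<Rightarrow> real" where
  "VN_inner N v w = (\<Sum>n<N. v n \<bullet> w n) / real N"

definition VN_norm :: "nat \<Rightarrow> (nat \<Rightarrow> 'v::real_inner) \<Rightarrow> real" where
  "VN_norm N v = sqrt (VN_inner N v v)"

definition iid_with_law :: "'w measure \<Rightarrow> 'b measure \<Rightarrow> (nat \<Rightarrow> 'w \<Rightarrow> 'b) \<Rightarrow> 'b measure \<Rightarrow> bool" where
  "iid_with_law M S Y law \<longleftrightarrow>
     prob_space.indep_vars M (\<lambda>_. S) Y UNIV \<and> (\<forall>n. distr M S (Y n) = law)"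

text \<open>Independence of the random sequence \<open>Y\<close> from the random sequence \<open>Y'\<close>.
  (The library constant \<open>indep_var\<close> requires both to have the same value type.)\<close>

definition indep_sequences ::
    "'w measure \<Rightarrow> 'b measure \<Rightarrow> (nat \<Rightarrow> 'w \<Rightarrow> 'b) \<Rightarrow> 'c measure \<Rightarrow> (nat \<Rightarrow> 'w \<Rightarrow> 'c) \<Rightarrow> bool" where
  "indep_sequences M S Y S' Y' \<longleftrightarrow> prob_space.indep_set M
     {(\<lambda>\<omega> n. Y n \<omega>) -` B \<inter> space M | B. B \<in> sets (Pi\<^sub>M UNIV (\<lambda>_. S))}
     {(\<lambda>\<omega> n. Y' n \<omega>) -` B \<inter> space M | B. B \<in> sets (Pi\<^sub>M UNIV (\<lambda>_. S'))}"

text \<open>The law of the noise. The mean is taken weakly, as the library's Bochner integral is restricted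
  to separable spaces; because the norm is integrable, this determines the mean.\<close>

definition noise_law :: "'v::real_inner measure \<Rightarrow> real \<Rightarrow> bool" where
  "noise_law \<nu> \<Sigma>\<^sub>0 \<longleftrightarrow> prob_space \<nu> \<and> sets \<nu> = sets borel \<and>
     (\<forall>v. (\<integral>x. x \<bullet> v \<partial>\<nu>) = 0) \<and>
     (\<forall>l\<ge>2. integrable \<nu> (\<lambda>x. norm x ^ l) \<and>
            (\<integral>x. norm x ^ l \<partial>\<nu>) < fact l / 2 * \<Sigma>\<^sub>0 ^ (l - 2))"


section \<open>Regularisation\<close>

definition iota_plus :: "'a::euclidean_space tempered_dist \<Rightarrow> ereal" where
  "iota_plus f = (if nonneg_ae f then 0 else \<infinity>)"

definition tikhonov ::
    "('a::euclidean_space tempered_dist \<Rightarrow> real) \<Rightarrow> nat \<Rightarrow> ('a tempered_dist \<Rightarrow> nat \<Rightarrow> 'v::real_inner) \<Rightarrow>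
     (nat \<Rightarrow> 'v) \<Rightarrow> real \<Rightarrow> 'a tempered_dist \<Rightarrow> ereal" where
  "tikhonov R N Au g \<alpha> f =
     ereal (1 / 2 * (VN_norm N (\<lambda>n. Au f n - g n))\<^sup>2 + \<alpha> * R f) + iota_plus f"

definition grad :: "('x::real_vector \<Rightarrow> real) \<Rightarrow> 'x \<Rightarrow> 'x \<Rightarrow> real" where
  "grad R f h = deriv (\<lambda>t::real. R (f + t *\<^sub>R h)) 0"

definition bregman :: "('x::real_vector \<Rightarrow> real) \<Rightarrow> 'x \<Rightarrow> 'x \<Rightarrow> real" where
  "bregman R f g = grad R f (f - g) - grad R g (f - g)"

end

theory Submission
  imports Defs
begin

text \<open>Testing the first order condition of the minimiser against the truth, inserting the source
  condition and completing the square leaves, with \<open>h\<close> the reconstruction error,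
  \<open>\<alpha> D \<le> \<alpha>\<^sup>2 \<parallel>w\<parallel>\<^sup>2 / 4 + \<langle>\<eta>, h\<rangle>\<close>, where the random functional \<open>\<eta>\<close> collects the noise and the sampling error
  of the source element. Expanding \<open>\<langle>\<eta>, h\<rangle>\<close> in wavelet coordinates, Young's inequality absorbs half of
  \<open>\<alpha> D\<close> coordinate by coordinate, with remainders \<open>c\<^sup>-\<^sup>q\<^sup>/\<^sup>p \<bar>\<eta>(\<psi>)/\<alpha>\<bar>\<^sup>q\<close> and \<open>(\<eta>(\<psi>)/\<alpha>)\<^sup>2 \<bar>f\<^sub>\<psi>\<bar>\<^sup>2\<^sup>-\<^sup>p / c\<close>. Each \<open>\<eta>(\<psi>)\<close>
  is a mean of independent centred variables of size \<open>\<parallel>A\<psi>\<parallel>\<^sub>\<infinity>\<close>, so its moments are those of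
  \<open>\<parallel>A\<psi>\<parallel>\<^sub>\<infinity> (\<delta> + \<alpha>) / \<surd>N\<close>, and the expected remainders are summable by (B2).\<close>

section \<open>Scalar inequalities\<close>

text \<open>The error h is built from the same sample as \<eta>, so the expectation of the pairing
  of \<eta> with h cannot be taken with h fixed. Young's inequality decouples the two: the
  remainders involve only \<eta> and the deterministic truth. The bound then holds for every
  outcome, so the minimiser may be any selection, and as the remainders are non-negative,
  expectation and coordinate sum can be exchanged. A second Young inequality, with exponents q/2 and
  p/(2-p), bounds the quadratic remainder by the series of (B2) plus the penalty series of the
  truth. The expected distance is thus at most a constant times \<alpha> + \<tau>^q + \<tau>^2 with
  \<tau> = (\<delta>/\<alpha> + 1)/sqrt N, where the square dominates for small \<tau> because q >
  2. Equating \<alpha> with (\<delta>/\<alpha>)^2/N gives the cube root of \<delta>^2/N, and 1/N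
  stays below it once \<delta> N is at least 1. For bounded \<delta> N, taking \<alpha> of order 1/N
  keeps \<delta>/\<alpha> bounded, and the sampling error 1/N governs.\<close>

definition spow :: "real \<Rightarrow> real \<Rightarrow> real" where
  "spow r x = sgn x * \<bar>x\<bar> powr r"

lemma spow_minus [simp]: "spow r (- x) = - spow r x"
  by (simp add: spow_def sgn_minus)

lemma abs_spow: "\<bar>spow r x\<bar> = \<bar>x\<bar> powr r"
  by (cases "x = 0") (auto simp: spow_def abs_mult sgn_real_def)

lemma spow_nonneg: "0 \<le> x \<Longrightarrow> spow r x = x powr r"
  by (cases "x = 0") (auto simp: spow_def)

lemma DERIV_abs_powr:
  fixes p :: real
  assumes "1 < p"
  shows "((\<lambda>x. \<bar>x\<bar> powr p) has_real_derivative p * spow (p - 1) x) (at x)"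
proof -
  consider "x > 0" | "x < 0" | "x = 0" by linarith
  then show ?thesis
  proof cases
    case 1
    have "((\<lambda>x. x powr p) has_real_derivative p * spow (p - 1) x) (at x)"
      using has_real_derivative_powr[OF 1, of p] 1 by (simp add: spow_def)
    moreover have "\<forall>\<^sub>F y in nhds x. \<bar>y\<bar> powr p = y powr p"
      using eventually_nhds_in_open[of "{0<..}" x] 1 by (auto elim: eventually_mono)
    ultimately show ?thesis
      by (subst DERIV_cong_ev[OF refl _ refl])
  next
    case 2
    have "((\<lambda>x. (- x) powr p) has_real_derivative p * spow (p - 1) x) (at x)"
      using 2 by (auto intro!: derivative_eq_intros simp: spow_def powr_diff field_simps)
    moreover have "\<forall>\<^sub>F y in nhds x. \<bar>y\<bar> powr p = (- y) powr p"
      using eventually_nhds_in_open[of "{..<0}" x] 2 by (auto elim: eventually_mono)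
    ultimately show ?thesis
      by (subst DERIV_cong_ev[OF refl _ refl])
  next
    case 3
    \<comment> \<open>At the origin the difference quotient has modulus
      \<open>\<bar>h\<bar> powr (p - 1)\<close>, which vanishes in the limit because
      \<open>1 < p\<close>.\<close>
    have "((\<lambda>h::real. \<bar>h\<bar> powr (p - 1)) \<longlongrightarrow> \<bar>0\<bar> powr (p - 1)) (at 0)"
      using assms by (intro tendsto_powr' tendsto_intros) auto
    then have "((\<lambda>h::real. \<bar>h\<bar> powr (p - 1)) \<longlongrightarrow> 0) (at 0)" by simp
    then have "((\<lambda>h. \<bar>\<bar>h\<bar> powr p / h\<bar>) \<longlongrightarrow> 0) (at 0)"
      by (rule Lim_transform_eventually)
        (auto simp: eventually_at_filter powr_diff abs_mult abs_divide)
    then have "((\<lambda>h. \<bar>h\<bar> powr p / h) \<longlongrightarrow> 0) (at 0)"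
      by (rule tendsto_rabs_zero_cancel)
    then show ?thesis using 3 by (simp add: DERIV_def spow_def)
  qed
qed

lemma abs_powr_Lipschitz:
  fixes p :: real
  assumes "1 < p" "\<bar>x\<bar> \<le> M" "\<bar>y\<bar> \<le> M"
  shows "\<bar>\<bar>x\<bar> powr p - \<bar>y\<bar> powr p\<bar> \<le> p * M powr (p - 1) * \<bar>x - y\<bar>"
proof -
  have "norm (\<bar>x\<bar> powr p - \<bar>y\<bar> powr p) \<le> p * M powr (p - 1) * norm (x - y)"
  proof (rule field_differentiable_bound[of "{-M..M}" "\<lambda>x. \<bar>x\<bar> powr p" "\<lambda>x. p * spow (p - 1) x"])
    show "((\<lambda>x. \<bar>x\<bar> powr p) has_real_derivative p * spow (p - 1) z) (at z within {- M..M})" for z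
      using DERIV_abs_powr[OF assms(1)] by (rule DERIV_subset) auto
    show "norm (p * spow (p - 1) z) \<le> p * M powr (p - 1)" if "z \<in> {- M..M}" for z
      using that assms(1) by (auto simp: abs_mult abs_spow intro!: powr_mono2)
  qed (use assms in auto)
  then show ?thesis by simp
qed

text \<open>The derivative \<open>(p - 1) * t powr (p - 2)\<close> decreases in \<open>t\<close>
  because \<open>p < 2\<close>, so on the whole interval it is at least its value at
  \<open>r\<close>.\<close>

lemma powr_diff_lower_bound:
  fixes p :: real
  assumes p: "1 < p" "p < 2" and "0 \<le> y" "y \<le> x" "x \<le> r"
  shows "(p - 1) * r powr (p - 2) * (x - y) \<le> x powr (p - 1) - y powr (p - 1)"
proof (cases "x = y")
  case False
  then have "y < x" using assms by simp
  define g where "g t = t powr (p - 1) - (p - 1) * r powr (p - 2) * t" for t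
  have "g y \<le> g x"
  \<comment> \<open>The left end may be 0, where the derivative is infinite; there only continuity
    is asked for.\<close>
  proof (rule DERIV_nonneg_imp_increasing_open[OF assms(4)])
    fix t assume t: "y < t" "t < x"
    have "p - 1 - 1 = p - 2" by simp
    then have "((\<lambda>t. t powr (p - 1)) has_real_derivative (p - 1) * t powr (p - 2)) (at t)"
      using has_real_derivative_powr[of t "p - 1"] t assms by simp
    from DERIV_diff[OF this DERIV_cmult_Id]
    have "(g has_real_derivative (p - 1) * t powr (p - 2) - (p - 1) * r powr (p - 2)) (at t)"
      unfolding g_def .
    moreover have "r powr (p - 2) \<le> t powr (p - 2)"
      using t assms by (intro powr_mono2') auto
    ultimately show "\<exists>D. (g has_real_derivative D) (at t) \<and> 0 \<le> D"
      using p by (intro exI conjI) (auto simp: mult_left_mono)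
  next
    show "continuous_on {y..x} g"
      unfolding g_def using assms by (intro continuous_intros continuous_on_powr') auto
  qed
  then show ?thesis by (simp add: g_def algebra_simps)
qed simp

lemma spow_strongly_monotone_aux:
  fixes p :: real
  assumes p: "1 < p" "p < 2" and "\<bar>a\<bar> \<le> r" "\<bar>b\<bar> \<le> r" "b \<le> a"
  shows "(p - 1) * r powr (p - 2) * (a - b) \<le> spow (p - 1) a - spow (p - 1) b"
proof -
  consider "0 \<le> b" | "a \<le> 0" | "b < 0" "0 < a" by linarith
  then show ?thesis
  proof cases
    case 1
    then show ?thesis using powr_diff_lower_bound[OF p, of b a r] assms by (simp add: spow_nonneg)
  next
    case 2
    then have "spow (p - 1) (- a) = (- a) powr (p - 1)" "spow (p - 1) (- b) = (- b) powr (p - 1)"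
      using assms by (simp_all add: spow_nonneg del: spow_minus)
    then show ?thesis using powr_diff_lower_bound[OF p, of "-a" "-b" r] assms 2 by simp
  next
    \<comment> \<open>Opposite signs: the interval is split at 0 and the bounds for the two halves
      are added.\<close>
    case 3
    then have "spow (p - 1) a = a powr (p - 1)" "spow (p - 1) (- b) = (- b) powr (p - 1)"
      by (simp_all add: spow_nonneg del: spow_minus)
    then show ?thesis
      using powr_diff_lower_bound[OF p, of 0 a r] powr_diff_lower_bound[OF p, of 0 "-b" r] assms 3 p
      by (simp add: algebra_simps)
  qed
qed

text \<open>For \<open>p < 2\<close> the modulus of monotonicity decays with the size of the
  arguments. The radius \<open>r\<close> is kept explicit so that each coordinate can later be
  treated at its own scale.\<close>

lemma spow_strongly_monotone:
  fixes p :: real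
  assumes p: "1 < p" "p < 2" and ab: "\<bar>a\<bar> \<le> r" "\<bar>b\<bar> \<le> r"
  shows "(p - 1) * r powr (p - 2) * (a - b)\<^sup>2 \<le> (spow (p - 1) a - spow (p - 1) b) * (a - b)"
proof (cases "b \<le> a")
  case True
  from mult_right_mono[OF spow_strongly_monotone_aux[OF p ab True], of "a - b"] True
  show ?thesis by (simp add: power2_eq_square mult.assoc)
next
  case False
  then have "a \<le> b" by simp
  from mult_right_mono[OF spow_strongly_monotone_aux[OF p ab(2,1) this], of "b - a"] this
  show ?thesis by (simp add: power2_eq_square algebra_simps)
qed

section \<open>Conjugate exponents and inequalities of Young type\<close>

lemma conjugate_exponent_gt_two:
  fixes p q :: real
  assumes "1 < p" "p < 2" "1 / p + 1 / q = 1"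
  shows "2 < q"
proof -
  have "1 / q = (p - 1) / p" using assms by (simp add: diff_divide_distrib)
  then have "1 / (1 / q) = p / (p - 1)" by simp
  then have "q = p / (p - 1)" by simp
  then show ?thesis using assms by (simp add: less_divide_eq)
qed

text \<open>Young's inequality for \<open>l * x\<close> and \<open>y / l\<close>; the scale
  \<open>l\<close> is fixed by \<open>l powr p = p * \<epsilon>\<close>.\<close>

lemma Young_epsilon:
  fixes p q \<epsilon> :: real
  assumes "1 < p" "1 < q" "1 / p + 1 / q = 1" "0 < \<epsilon>"
  obtains C where "0 < C" "\<And>x y. 0 \<le> x \<Longrightarrow> 0 \<le> y \<Longrightarrow> x * y \<le> \<epsilon> * x powr p + C * y powr q"
proof -
  define l where "l = (p * \<epsilon>) powr (1 / p)"
  have l: "0 < l" "l powr p = p * \<epsilon>" using assms by (auto simp: l_def powr_powr)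
  show thesis
  proof (rule that[of "l powr (- q) / q"])
    fix x y :: real assume xy: "0 \<le> x" "0 \<le> y"
    have "x * y = (l * x) * (y / l)" using l by simp
    also have "\<dots> \<le> (l * x) powr p / p + (y / l) powr q / q"
      using assms l xy by (intro Youngs_inequality) auto
    also have "\<dots> = \<epsilon> * x powr p + l powr (- q) / q * y powr q"
      using assms l xy by (simp add: powr_mult powr_divide powr_minus field_simps)
    finally show "x * y \<le> \<epsilon> * x powr p + l powr (- q) / q * y powr q" .
  qed (use l assms in auto)
qed

text \<open>The quadratic term in \<open>y\<close> is needed because the monotonicity gap is of order \<open>\<bar>a - b\<bar>\<^sup>p\<close> only where
  \<open>\<bar>b\<bar> \<le> \<bar>a - b\<bar>\<close>; elsewhere it is of order \<open>\<bar>a - b\<bar>\<^sup>2 \<bar>b\<bar>\<^sup>p\<^sup>-\<^sup>2\<close>.\<close>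

lemma spow_duality_bound:
  fixes p q :: real
  assumes p: "1 < p" "p < 2" and q: "1 / p + 1 / q = 1"
  obtains C where "0 < C"
    "\<And>a b y c. 0 < c \<Longrightarrow> \<bar>(a - b) * y\<bar> \<le>
       c / 2 * ((spow (p - 1) a - spow (p - 1) b) * (a - b)) +
       C * (c powr (- (q / p)) * \<bar>y\<bar> powr q + y\<^sup>2 * \<bar>b\<bar> powr (2 - p) / c)"
proof -
  have q1: "1 < q" using conjugate_exponent_gt_two[OF p q] by simp
  \<comment> \<open>Both \<open>\<bar>a\<bar>\<close> and \<open>\<bar>b\<bar>\<close> are at most
    \<open>\<bar>h\<bar> + \<bar>b\<bar>\<close>, hence within the radius \<open>3 * m\<close> used
    below; its power splits into this constant and \<open>m powr (p - 2)\<close>.\<close>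
  define \<kappa> where "\<kappa> = (p - 1) * 3 powr (p - 2)"
  have \<kappa>: "0 < \<kappa>" using p by (simp add: \<kappa>_def)
  obtain C where C: "0 < C" "\<And>x y. 0 \<le> x \<Longrightarrow> 0 \<le> y \<Longrightarrow> x * y \<le> \<kappa> / 2 * x powr p + C * y powr q"
    using Young_epsilon[OF p(1) q1 q half_gt_zero[OF \<kappa>]] by blast
  show thesis
  proof (rule that[of "C + 1 / (2 * \<kappa>)"])
    show "0 < C + 1 / (2 * \<kappa>)" using C \<kappa> by (simp add: add_pos_pos)
    fix a b y c :: real assume c: "0 < c"
    define h where "h = a - b"
    define m where "m = max \<bar>h\<bar> \<bar>b\<bar>"
    define \<theta> where "\<theta> = (spow (p - 1) a - spow (p - 1) b) * (a - b)"
    have "\<bar>h\<bar> \<le> m" "\<bar>b\<bar> \<le> m" by (simp_all add: m_def)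
    then have "\<bar>a\<bar> \<le> 3 * m" "\<bar>b\<bar> \<le> 3 * m" unfolding h_def by linarith+
    from spow_strongly_monotone[OF p this]
    have \<theta>: "\<kappa> * m powr (p - 2) * h\<^sup>2 \<le> \<theta>"
      by (simp add: \<theta>_def \<kappa>_def h_def powr_mult m_def mult.assoc)
    let ?A = "c powr (- (q / p)) * \<bar>y\<bar> powr q" and ?B = "y\<^sup>2 * \<bar>b\<bar> powr (2 - p) / c"
    have AB: "0 \<le> ?A" "0 \<le> ?B" using c by auto
    have "\<bar>h * y\<bar> \<le> c / 2 * \<theta> + (C * ?A + 1 / (2 * \<kappa>) * ?B)"
    proof (cases "\<bar>b\<bar> \<le> \<bar>h\<bar>")
      case True
      have "\<kappa> * \<bar>h\<bar> powr p \<le> \<theta>"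
      proof (cases "h = 0")
        case False
        then have "\<bar>h\<bar> powr (p - 2) * h\<^sup>2 = \<bar>h\<bar> powr p"
          by (simp add: powr_diff)
        then show ?thesis using \<theta> True by (simp add: m_def mult.assoc)
      qed (use \<theta> in simp)
      \<comment> \<open>The weight is distributed so that the \<open>p\<close>-th power of the first
        factor produces \<open>c\<close> and the \<open>q\<close>-th power of the second produces
        \<open>c powr (- (q / p))\<close>.\<close>
      have "\<bar>h * y\<bar> = (c powr (1 / p) * \<bar>h\<bar>) * (c powr (- (1 / p)) * \<bar>y\<bar>)"
        using c by (simp add: abs_mult powr_minus)
      also have "\<dots> \<le> \<kappa> / 2 * (c powr (1 / p) * \<bar>h\<bar>) powr p + C * (c powr (- (1 / p)) * \<bar>y\<bar>) powr q"
        by (rule C) auto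
      also have "\<dots> = c / 2 * (\<kappa> * \<bar>h\<bar> powr p) + C * ?A"
        using p c by (simp add: powr_mult powr_powr)
      also have "\<dots> \<le> c / 2 * \<theta> + C * ?A"
        using \<open>\<kappa> * \<bar>h\<bar> powr p \<le> \<theta>\<close> c by (intro add_right_mono mult_left_mono) auto
      finally have "\<bar>h * y\<bar> \<le> c / 2 * \<theta> + C * ?A" .
      moreover have "0 \<le> 1 / (2 * \<kappa>) * ?B" using AB(2) \<kappa> by (intro mult_nonneg_nonneg) auto
      ultimately show ?thesis by linarith
    next
      case False
      then have b: "0 < \<bar>b\<bar>" and m: "m = \<bar>b\<bar>" by (auto simp: m_def)
      \<comment> \<open>\<open>t\<close> is the curvature available here:
        \<open>t * h\<^sup>2\<close> is at most \<open>c * \<theta>\<close>. Completing the square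
        with this weight spends exactly half of it.\<close>
      define t where "t = c * \<kappa> * \<bar>b\<bar> powr (p - 2)"
      have t: "0 < t" using b c \<kappa> by (simp add: t_def)
      have "0 \<le> (t * \<bar>h\<bar> - \<bar>y\<bar>)\<^sup>2 / (2 * t)" using t by simp
      also have "(t * \<bar>h\<bar> - \<bar>y\<bar>)\<^sup>2 = t\<^sup>2 * h\<^sup>2 + y\<^sup>2 - 2 * t * \<bar>h * y\<bar>"
        by (simp add: power2_diff power_mult_distrib abs_mult)
      also have "\<dots> / (2 * t) = t / 2 * h\<^sup>2 + y\<^sup>2 / (2 * t) - \<bar>h * y\<bar>"
        using t by (simp add: add_divide_distrib diff_divide_distrib power2_eq_square)
      finally have "\<bar>h * y\<bar> \<le> t / 2 * h\<^sup>2 + y\<^sup>2 / (2 * t)" by simp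
      moreover have "t / 2 * h\<^sup>2 \<le> c / 2 * \<theta>"
        using mult_left_mono[OF \<theta>, of "c / 2"] c by (simp add: t_def m mult_ac)
      moreover have "y\<^sup>2 / (2 * t) = 1 / (2 * \<kappa>) * ?B"
      proof -
        have "\<bar>b\<bar> powr (2 - p) = 1 / \<bar>b\<bar> powr (p - 2)"
          using b by (simp flip: powr_minus_divide)
        then show ?thesis by (simp add: t_def)
      qed
      moreover have "0 \<le> C * ?A" using AB(1) C(1) by simp
      ultimately show ?thesis by linarith
    qed
    also have "\<dots> \<le> c / 2 * \<theta> + (C + 1 / (2 * \<kappa>)) * (?A + ?B)"
    proof -
      have "C * ?A \<le> (C + 1 / (2 * \<kappa>)) * ?A" "1 / (2 * \<kappa>) * ?B \<le> (C + 1 / (2 * \<kappa>)) * ?B"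
        using AB C(1) \<kappa> by (intro mult_right_mono; simp)+
      then show ?thesis unfolding distrib_left by linarith
    qed
    finally show "\<bar>(a - b) * y\<bar> \<le> c / 2 * ((spow (p - 1) a - spow (p - 1) b) * (a - b)) +
       (C + 1 / (2 * \<kappa>)) * (?A + ?B)" by (simp add: h_def \<theta>_def)
  qed
qed

text \<open>The left side equals \<open>X powr (2 / q) * Y powr ((2 - p) / p)\<close>, with
  \<open>X\<close> and \<open>Y\<close> the two terms on the right; these exponents add up to 1, so
  weighted Young applies. With \<open>g\<close> the sup norm of a wavelet image and \<open>b\<close>
  a coefficient of the truth, both terms on the right are summable, the first by (B2) and the second
  because the penalty of the truth is finite.\<close>

lemma weighted_product_bound:
  fixes p q :: real
  assumes p: "1 < p" "p < 2" and q: "1 / p + 1 / q = 1" and "0 < c" "0 \<le> g"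
  shows "g\<^sup>2 * \<bar>b\<bar> powr (2 - p) / c \<le> c powr (- (q / p)) * g powr q + c * \<bar>b\<bar> powr p"
proof (cases "g = 0 \<or> b = 0")
  case False
  have q0: "0 < q" using conjugate_exponent_gt_two[OF p q] by simp
  have q': "1 / q = 1 - 1 / p" using q by simp
  define X Y where "X = c powr (- (q / p)) * g powr q" and "Y = c * \<bar>b\<bar> powr p"
  have XY: "0 < X" "0 < Y" using False assms by (auto simp: X_def Y_def)
  have "X powr (2 / q) = c powr (- (2 / p)) * g powr 2"
    using q0 assms by (simp add: X_def powr_mult powr_powr)
  moreover have "Y powr ((2 - p) / p) = c powr (2 / p - 1) * \<bar>b\<bar> powr (2 - p)"
  proof -
    have "(2 - p) / p = 2 / p - 1" using p by (simp add: diff_divide_distrib)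
    moreover have "p * ((2 - p) / p) = 2 - p" using p by simp
    ultimately
    show ?thesis using assms by (simp add: Y_def powr_mult powr_powr del: times_divide_eq_right)
  qed
  moreover have "c powr (- (2 / p)) * c powr (2 / p - 1) = 1 / c"
    using assms(4) by (simp add: powr_diff powr_minus)
  ultimately have "X powr (2 / q) * Y powr ((2 - p) / p) = g\<^sup>2 * \<bar>b\<bar> powr (2 - p) / c"
    using False assms by (simp add: mult_ac)
  moreover have "X powr (2 / q) * Y powr ((2 - p) / p) \<le> 2 / q * X + (2 - p) / p * Y"
    using XY p q0 q' by (intro Youngs_inequality_0) (auto simp: diff_divide_distrib)
  moreover have "2 / q * X + (2 - p) / p * Y \<le> 1 * X + 1 * Y"
  proof (intro add_mono mult_right_mono)
    show "2 / q \<le> 1" using conjugate_exponent_gt_two[OF p q] by simp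
    show "(2 - p) / p \<le> 1" using p by simp
  qed (use XY in auto)
  ultimately show ?thesis by (simp add: X_def Y_def)
qed (use assms in auto)

text \<open>With m the exponent rounded up, \<open>\<bar>x\<bar> ^ m / fact m\<close> is a single
  term of the series of \<open>exp \<bar>x\<bar>\<close>. Hence two-sided exponential moments
  control moments of every real order.\<close>

lemma abs_powr_le_exp:
  fixes r x :: real
  assumes "0 \<le> r"
  shows "\<bar>x\<bar> powr r \<le> (1 + fact (nat \<lceil>r\<rceil>)) * (exp x + exp (- x))"
proof -
  define m where "m = nat \<lceil>r\<rceil>"
  have "\<bar>x\<bar> powr r \<le> 1 + \<bar>x\<bar> ^ m"
  proof (cases "\<bar>x\<bar> \<le> 1")
    case True
    then have "\<bar>x\<bar> powr r \<le> 1" using assms by (simp add: powr_le1)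
    then show ?thesis by (simp add: add_increasing2)
  next
    case False
    then have "\<bar>x\<bar> powr r \<le> \<bar>x\<bar> powr real m"
      using assms by (intro powr_mono) (auto simp: m_def)
    then show ?thesis using False by (simp add: powr_realpow)
  qed
  also have "\<bar>x\<bar> ^ m \<le> fact m * exp \<bar>x\<bar>"
  proof -
    have "(\<Sum>n\<in>{m}. \<bar>x\<bar> ^ n /\<^sub>R fact n) \<le> exp \<bar>x\<bar>"
      unfolding exp_def by (intro sum_le_suminf summable_exp_generic) auto
    then show ?thesis by (simp add: field_simps)
  qed
  also have "1 \<le> exp \<bar>x\<bar>" by simp
  finally have "\<bar>x\<bar> powr r \<le> (1 + fact m) * exp \<bar>x\<bar>" by (simp add: algebra_simps)
  also have "\<dots> \<le> (1 + fact m) * (exp x + exp (- x))"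
    by (intro mult_left_mono) (auto simp: abs_if)
  finally show ?thesis by (simp add: m_def)
qed

lemma abs_add_powr_le:
  fixes r :: real
  assumes "0 \<le> r"
  shows "\<bar>x + y\<bar> powr r \<le> 2 powr r * (\<bar>x\<bar> powr r + \<bar>y\<bar> powr r)"
proof -
  have "\<bar>x + y\<bar> powr r \<le> (2 * max \<bar>x\<bar> \<bar>y\<bar>) powr r" using assms by (intro powr_mono2) auto
  also have "\<dots> = 2 powr r * (max \<bar>x\<bar> \<bar>y\<bar>) powr r" by (simp add: powr_mult)
  also have "\<dots> \<le> 2 powr r * (\<bar>x\<bar> powr r + \<bar>y\<bar> powr r)"
    by (intro mult_left_mono) (auto simp: max_def)
  finally show ?thesis .
qed

section \<open>Moments of sums of independent variables\<close>

text \<open>Bernstein's argument: the zero mean removes the linear term of the exponential series,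
  and the factorials in the moment condition cancel those of the series. What remains is geometric
  with sum \<open>y\<^sup>2 / (2 * (1 - y))\<close>, at most \<open>y\<^sup>2\<close> for
  \<open>y \<le> 1 / 2\<close>.\<close>

lemma (in prob_space) exp_moment_bound:
  fixes Y :: "'a \<Rightarrow> real"
  assumes int: "integrable M Y" and mean: "(\<integral>x. Y x \<partial>M) = 0"
    and mom: "\<And>l. 2 \<le> l \<Longrightarrow> (\<integral>\<^sup>+x. ennreal (\<bar>Y x\<bar> ^ l) \<partial>M) \<le> ennreal (fact l / 2 * y ^ l)"
    and y: "0 \<le> y" "y \<le> 1 / 2"
  shows "(\<integral>\<^sup>+x. ennreal (exp (Y x)) \<partial>M) \<le> ennreal (exp (y\<^sup>2))"
proof -
  have [measurable]: "Y \<in> borel_measurable M" using int by auto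
  have split: "exp t = 1 + t + (\<Sum>l. t ^ (l + 2) / fact (l + 2))" for t :: real
  proof -
    have "(\<lambda>l. t ^ l / fact l) sums exp t"
      using exp_converges[of t] by (simp add: divide_inverse mult.commute)
    from sums_unique[OF sums_split_initial_segment[OF this, of 2]] show ?thesis
      by (simp add: eval_nat_numeral)
  qed
  have summ: "summable (\<lambda>l. t ^ (l + 2) / fact (l + 2))" for t :: real
  proof -
    have "summable (\<lambda>l. t ^ l / fact l)"
      using exp_converges[of t] by (simp add: divide_inverse mult.commute sums_iff)
    then show ?thesis by (rule summable_ignore_initial_segment)
  qed
  \<comment> \<open>By convexity the remainder \<open>r\<close> is non-negative, so its integral can
    be bounded before the exponential is known to be integrable; integrability of the latter then
    follows.\<close>
  define r where "r x = exp (Y x) - 1 - Y x" for x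
  have r_nonneg: "0 \<le> r x" for x using exp_ge_add_one_self[of "Y x"] unfolding r_def by linarith
  have r_le: "r x \<le> (\<Sum>l. \<bar>Y x\<bar> ^ (l + 2) / fact (l + 2))" for x
  proof -
    have "r x = (\<Sum>l. Y x ^ (l + 2) / fact (l + 2))" using split[of "Y x"] by (simp add: r_def)
    also have "\<dots> \<le> (\<Sum>l. \<bar>Y x\<bar> ^ (l + 2) / fact (l + 2))"
    proof (rule suminf_le[OF _ summ summ])
      show "Y x ^ (l + 2) / fact (l + 2) \<le> \<bar>Y x\<bar> ^ (l + 2) / fact (l + 2)" for l
        using abs_ge_self[of "Y x ^ (l + 2)"] by (intro divide_right_mono) (simp_all only: power_abs fact_ge_zero)
    qed
    finally show ?thesis .
  qed
  have geo: "(\<lambda>l. y ^ (l + 2) / 2) sums (y\<^sup>2 / 2 * (1 / (1 - y)))"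
    using sums_mult[OF geometric_sums[of y], of "y\<^sup>2 / 2"] y
    by (simp add: power2_eq_square mult_ac)
  have "(\<integral>\<^sup>+x. ennreal (r x) \<partial>M) \<le> (\<integral>\<^sup>+x. (\<Sum>l. ennreal (\<bar>Y x\<bar> ^ (l + 2) / fact (l + 2))) \<partial>M)"
    using r_le summ by (intro nn_integral_mono) (subst suminf_ennreal2, auto intro!: ennreal_leI simp del: power_Suc fact_Suc)
  also have "\<dots> = (\<Sum>l. \<integral>\<^sup>+x. ennreal (\<bar>Y x\<bar> ^ (l + 2) / fact (l + 2)) \<partial>M)"
    by (rule nn_integral_suminf) measurable
  also have "\<dots> \<le> (\<Sum>l. ennreal (y ^ (l + 2) / 2))"
  proof (rule suminf_le)
    fix l
    have "(\<integral>\<^sup>+x. ennreal (\<bar>Y x\<bar> ^ (l + 2) / fact (l + 2)) \<partial>M) =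
        ennreal (1 / fact (l + 2)) * (\<integral>\<^sup>+x. ennreal (\<bar>Y x\<bar> ^ (l + 2)) \<partial>M)"
      by (subst nn_integral_cmult[symmetric]) (auto simp: ennreal_mult[symmetric] simp del: fact_Suc power_Suc)
    also have "\<dots> \<le> ennreal (1 / fact (l + 2)) * ennreal (fact (l + 2) / 2 * y ^ (l + 2))"
      by (intro mult_left_mono mom) auto
    also have "\<dots> = ennreal (y ^ (l + 2) / 2)"
      using y by (subst ennreal_mult[symmetric]) (auto simp del: fact_Suc power_Suc)
    finally show "(\<integral>\<^sup>+x. ennreal (\<bar>Y x\<bar> ^ (l + 2) / fact (l + 2)) \<partial>M) \<le> ennreal (y ^ (l + 2) / 2)" .
  qed auto
  also have "\<dots> = ennreal (y\<^sup>2 / 2 * (1 / (1 - y)))"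
    using geo y by (subst suminf_ennreal2) (auto simp: sums_iff)
  also have "\<dots> \<le> ennreal (y\<^sup>2)"
    using y mult_left_mono[of "1 / (1 - y)" 2 "y\<^sup>2 / 2"] by (intro ennreal_leI) (auto simp: field_simps)
  finally have r_int: "(\<integral>\<^sup>+x. ennreal (r x) \<partial>M) \<le> ennreal (y\<^sup>2)" .
  have [measurable]: "r \<in> borel_measurable M" unfolding r_def by measurable
  have ir: "integrable M r"
    using r_int by (intro integrableI_nonneg) (auto simp: r_nonneg intro: le_less_trans)
  then have "(\<integral>x. r x \<partial>M) \<le> y\<^sup>2"
    using r_int r_nonneg by (simp add: nn_integral_eq_integral)
  moreover have "(\<integral>x. exp (Y x) \<partial>M) = (\<integral>x. 1 + Y x + r x \<partial>M)" by (simp add: r_def)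
  moreover have "(\<integral>x. 1 + Y x + r x \<partial>M) = 1 + (\<integral>x. r x \<partial>M)"
    using ir int mean by (simp add: prob_space)
  moreover have "1 + y\<^sup>2 \<le> exp (y\<^sup>2)" by (rule exp_ge_add_one_self)
  ultimately have "(\<integral>x. exp (Y x) \<partial>M) \<le> exp (y\<^sup>2)" by linarith
  moreover have "integrable M (\<lambda>x. exp (Y x))"
  proof -
    have "integrable M (\<lambda>x. 1 + Y x + r x)" using ir int by auto
    then show ?thesis by (simp add: r_def)
  qed
  ultimately show ?thesis by (simp add: nn_integral_eq_integral ennreal_leI)
qed

lemma (in prob_space) exp_moment_sum_bound:
  fixes Y :: "nat \<Rightarrow> 'a \<Rightarrow> real"
  assumes indep: "indep_vars (\<lambda>_. borel) Y UNIV"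
    and int: "\<And>n. integrable M (Y n)" and mean: "\<And>n. (\<integral>x. Y n x \<partial>M) = 0"
    and mom: "\<And>n l. 2 \<le> l \<Longrightarrow> (\<integral>\<^sup>+x. ennreal (\<bar>Y n x\<bar> ^ l) \<partial>M) \<le> ennreal (fact l / 2 * \<beta> ^ l)"
    and s: "0 \<le> \<beta>" "\<bar>s\<bar> * \<beta> \<le> 1 / 2"
  shows "(\<integral>\<^sup>+x. ennreal (exp (s * (\<Sum>n<N. Y n x))) \<partial>M) \<le> ennreal (exp (real N * (s * \<beta>)\<^sup>2))"
proof -
  have ind: "indep_vars (\<lambda>_. borel) (\<lambda>n x. exp (s * Y n x)) {..<N}"
    by (rule indep_vars_subset[OF indep_vars_compose2[OF indep, of "\<lambda>_ t. exp (s * t)" "\<lambda>_. borel"]]) auto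
  have ind': "indep_vars (\<lambda>_. borel) (\<lambda>n x. ennreal (exp (s * Y n x))) {..<N}"
    by (rule indep_vars_compose2[OF ind, of "\<lambda>_. ennreal"]) auto
  have one: "(\<integral>\<^sup>+x. ennreal (exp (s * Y n x)) \<partial>M) \<le> ennreal (exp ((s * \<beta>)\<^sup>2))" for n
  proof -
    have "(\<integral>\<^sup>+x. ennreal (exp (s * Y n x)) \<partial>M) \<le> ennreal (exp ((\<bar>s\<bar> * \<beta>)\<^sup>2))"
    proof (rule exp_moment_bound)
      fix l :: nat assume l: "2 \<le> l"
      have "(\<integral>\<^sup>+x. ennreal (\<bar>s * Y n x\<bar> ^ l) \<partial>M) = ennreal (\<bar>s\<bar> ^ l) * (\<integral>\<^sup>+x. ennreal (\<bar>Y n x\<bar> ^ l) \<partial>M)"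
        using int[of n] by (subst nn_integral_cmult[symmetric])
          (auto simp: abs_mult power_mult_distrib ennreal_mult)
      also have "\<dots> \<le> ennreal (\<bar>s\<bar> ^ l) * ennreal (fact l / 2 * \<beta> ^ l)"
        by (intro mult_left_mono mom l) auto
      also have "\<dots> = ennreal (fact l / 2 * (\<bar>s\<bar> * \<beta>) ^ l)"
        using s(1) by (simp add: ennreal_mult[symmetric] power_mult_distrib mult_ac)
      finally show "(\<integral>\<^sup>+x. ennreal (\<bar>s * Y n x\<bar> ^ l) \<partial>M) \<le> ennreal (fact l / 2 * (\<bar>s\<bar> * \<beta>) ^ l)" .
    qed (use int mean s in auto)
    then show ?thesis by (simp add: power_mult_distrib)
  qed
  have "(\<integral>\<^sup>+x. ennreal (exp (s * (\<Sum>n<N. Y n x))) \<partial>M) =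
      (\<integral>\<^sup>+x. (\<Prod>n<N. ennreal (exp (s * Y n x))) \<partial>M)"
    by (simp add: sum_distrib_left exp_sum prod_ennreal)
  also have "\<dots> = (\<Prod>n<N. \<integral>\<^sup>+x. ennreal (exp (s * Y n x)) \<partial>M)"
    using ind' by (intro indep_vars_nn_integral) auto
  also have "\<dots> \<le> (\<Prod>n<N. ennreal (exp ((s * \<beta>)\<^sup>2)))"
    by (induction N) (auto intro!: mult_mono one simp: lessThan_Suc)
  also have "\<dots> = ennreal (exp (real N * (s * \<beta>)\<^sup>2))"
    by (simp add: ennreal_power exp_of_nat_mult)
  finally show ?thesis .
qed

text \<open>The 4 comes from two exponential moments, each at most 2; \<open>2 powr r\<close> comes
  from the factor 2 in the inverse of the scale \<open>s\<close> chosen in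
  \<open>moment_sum_bound\<close>; the factorial is that of \<open>abs_powr_le_exp\<close>.\<close>

definition moment_constant :: "real \<Rightarrow> real" where
  "moment_constant r = 4 * 2 powr r * (1 + fact (nat \<lceil>r\<rceil>))"

lemma moment_constant_pos: "0 < moment_constant r"
  by (simp add: moment_constant_def add_pos_pos)

text \<open>Independence makes the exponential moment of the sum a product, which at the scale
  \<open>1 / (\<beta> * sqrt (real N))\<close> is bounded uniformly in \<open>N\<close>. Rescaling
  gives the size of a centred sum with square root cancellation.\<close>

lemma (in prob_space) moment_sum_bound:
  fixes Y :: "nat \<Rightarrow> 'a \<Rightarrow> real"
  assumes r: "0 \<le> r" and indep: "indep_vars (\<lambda>_. borel) Y UNIV"
    and int: "\<And>n. integrable M (Y n)" and mean: "\<And>n. (\<integral>x. Y n x \<partial>M) = 0"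
    and mom: "\<And>n l. 2 \<le> l \<Longrightarrow> (\<integral>\<^sup>+x. ennreal (\<bar>Y n x\<bar> ^ l) \<partial>M) \<le> ennreal (fact l / 2 * \<beta> ^ l)"
    and \<beta>: "0 < \<beta>" and N: "0 < N"
  shows "(\<integral>\<^sup>+x. ennreal (\<bar>\<Sum>n<N. Y n x\<bar> powr r) \<partial>M) \<le>
    ennreal (moment_constant r * (\<beta> * sqrt (real N)) powr r)"
proof -
  define K :: real where "K = 1 + fact (nat \<lceil>r\<rceil>)"
  have K: "0 < K" "\<And>x. \<bar>x\<bar> powr r \<le> K * (exp x + exp (- x))"
  using abs_powr_le_exp[OF r] by (simp_all add: K_def add_pos_pos)
  have [measurable]: "Y n \<in> borel_measurable M" for n using int by auto
  \<comment> \<open>This choice makes \<open>real N * (s * \<beta>)\<^sup>2\<close> equal to 1/4 and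
    also keeps \<open>s * \<beta>\<close> at most 1/2, the range of the Bernstein bound.\<close>
  define s where "s = 1 / (2 * (\<beta> * sqrt (real N)))"
  have s: "0 < s" using \<beta> N by (simp add: s_def)
  have sN: "s * \<beta> = 1 / (2 * sqrt (real N))" using \<beta> by (simp add: s_def)
  have "1 \<le> sqrt (real N)" using N by simp
  then have half: "s * \<beta> \<le> 1 / 2" unfolding sN by (simp add: field_simps)
  have "real N * (s * \<beta>)\<^sup>2 = 1 / 4" unfolding sN using N by (simp add: power_divide power_mult_distrib)
  moreover have "exp (1 / 4) \<le> (2 :: real)" using exp_bound[of "1 / 4"] by (simp add: power2_eq_square)
  ultimately have e: "exp (real N * (s * \<beta>)\<^sup>2) \<le> 2" by (simp only:)
  have bd: "(\<integral>\<^sup>+x. ennreal (exp (t * (\<Sum>n<N. Y n x))) \<partial>M) \<le> ennreal 2" if "\<bar>t\<bar> = s" for t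
  proof -
    have "(t * \<beta>)\<^sup>2 = (s * \<beta>)\<^sup>2" using that by (metis power2_abs power_mult_distrib)
    moreover have "(\<integral>\<^sup>+x. ennreal (exp (t * (\<Sum>n<N. Y n x))) \<partial>M) \<le> ennreal (exp (real N * (t * \<beta>)\<^sup>2))"
      using indep int mean mom \<beta> half that by (intro exp_moment_sum_bound) auto
    ultimately show ?thesis using e by (metis ennreal_leI order_trans)
  qed
  have eq: "1 / s = 2 * (\<beta> * sqrt (real N))" by (simp add: s_def)
  define L where "L = (1 / s) powr r * K"
  have L: "0 < L" using s K by (simp add: L_def)
  have pt: "\<bar>S\<bar> powr r \<le> L * (exp (s * S) + exp (- s * S))" for S
  proof -
    have "\<bar>S\<bar> powr r = (1 / s) powr r * \<bar>s * S\<bar> powr r"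
      using s by (simp add: abs_mult powr_mult powr_divide)
    also have "\<dots> \<le> (1 / s) powr r * (K * (exp (s * S) + exp (- (s * S))))"
      by (intro mult_left_mono K) auto
    finally show ?thesis by (simp add: L_def mult.assoc)
  qed
  have "(\<integral>\<^sup>+x. ennreal (\<bar>\<Sum>n<N. Y n x\<bar> powr r) \<partial>M) \<le>
      (\<integral>\<^sup>+x. ennreal L * (ennreal (exp (s * (\<Sum>n<N. Y n x))) + ennreal (exp (- s * (\<Sum>n<N. Y n x)))) \<partial>M)"
    using L by (intro nn_integral_mono)
      (auto simp: ennreal_mult[symmetric] ennreal_plus[symmetric] simp del: ennreal_plus intro!: ennreal_leI pt[simplified])
  also have "\<dots> = ennreal L * ((\<integral>\<^sup>+x. ennreal (exp (s * (\<Sum>n<N. Y n x))) \<partial>M) +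
      (\<integral>\<^sup>+x. ennreal (exp (- s * (\<Sum>n<N. Y n x))) \<partial>M))"
    by (subst nn_integral_cmult, measurable) (subst nn_integral_add, auto)
  also have "\<dots> \<le> ennreal L * (ennreal 2 + ennreal 2)"
    using s by (intro mult_left_mono add_mono bd) auto
  also have "\<dots> = ennreal (L * 4)"
    using L by (simp add: ennreal_mult'' ennreal_plus[symmetric] del: ennreal_plus)
  also have "L * 4 = moment_constant r * (\<beta> * sqrt (real N)) powr r"
    unfolding L_def eq by (simp add: powr_mult moment_constant_def K_def mult_ac)
  finally show ?thesis .
qed

text \<open>The value space need not be separable, so that the inner product need not be measurable on the
  product \<open>\<sigma>\<close>-algebra; instead \<open>X\<close> is approximated by maps into a countable dense subset of \<open>U\<close>.\<close>

lemma borel_measurable_inner_continuous_on: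
  fixes G :: "'u::euclidean_space \<Rightarrow> 'v::real_inner"
  assumes G: "continuous_on U G"
    and X: "X \<in> N \<rightarrow>\<^sub>M restrict_space borel U" and Y: "Y \<in> borel_measurable N"
  shows "(\<lambda>\<omega>. Y \<omega> \<bullet> G (X \<omega>)) \<in> borel_measurable N"
proof (cases "U = {}")
  case True
  then have "space N = {}" using measurable_space[OF X] by (auto simp: space_restrict_space)
  then show ?thesis by (simp add: measurable_def)
next
  case False
  obtain T where T: "countable T" "T \<subseteq> U" "U \<subseteq> closure T" using separable by blast
  with False have "T \<noteq> {}" by auto
  define d where "d = from_nat_into T"
  have dT: "range d = T" unfolding d_def using \<open>T \<noteq> {}\<close> T(1) by (rule range_from_nat_into)
  have dU: "d n \<in> U" for n using dT T(2) by blast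
  have X_borel [measurable]: "X \<in> borel_measurable N" and XU: "\<omega> \<in> space N \<Longrightarrow> X \<omega> \<in> U" for \<omega>
    using X by (auto simp: measurable_restrict_space2_iff)
  \<comment> \<open>Taking the least admissible index makes the choice of a nearby dense point
    measurable, with countably many values; for each fixed value the map is \<open>Y\<close> paired
    with a constant vector.\<close>
  define idx where "idx k \<omega> = (LEAST n. dist (X \<omega>) (d n) < inverse (real (Suc k)))" for k \<omega>
  have idx: "dist (X \<omega>) (d (idx k \<omega>)) < inverse (real (Suc k))" if "\<omega> \<in> space N" for k \<omega>
  proof -
    have "X \<omega> \<in> closure T" using XU[OF that] T(3) by blast
    then obtain t where "t \<in> T" "dist t (X \<omega>) < inverse (real (Suc k))"
      unfolding closure_approachable by (metis inverse_positive_iff_positive of_nat_0_less_iff zero_less_Suc)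
    then obtain n where "dist (X \<omega>) (d n) < inverse (real (Suc k))"
      using dT by (metis dist_commute imageE)
    then show ?thesis unfolding idx_def by (rule LeastI)
  qed
  have [measurable]: "idx k \<in> N \<rightarrow>\<^sub>M count_space UNIV" for k
    unfolding idx_def by measurable
  show ?thesis
  proof (rule borel_measurable_LIMSEQ_real)
    show "(\<lambda>\<omega>. Y \<omega> \<bullet> G (d (idx k \<omega>))) \<in> borel_measurable N" for k
    proof (rule measurable_compose_countable[where g = "idx k"])
      show "(\<lambda>\<omega>. Y \<omega> \<bullet> G (d i)) \<in> borel_measurable N" for i
        by (rule measurable_compose[OF Y]) (intro borel_measurable_continuous_onI continuous_intros)
    qed measurable
    fix \<omega> assume \<omega>: "\<omega> \<in> space N"
    have "(\<lambda>k. dist (d (idx k \<omega>)) (X \<omega>)) \<longlonglongrightarrow> 0"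
    proof (rule Lim_null_comparison[OF always_eventually LIMSEQ_inverse_real_of_nat], rule allI)
      show "norm (dist (d (idx k \<omega>)) (X \<omega>)) \<le> inverse (real (Suc k))" for k
        using idx[OF \<omega>, of k] by (simp add: dist_commute)
    qed
    then have "(\<lambda>k. d (idx k \<omega>)) \<longlonglongrightarrow> X \<omega>" by (rule tendsto_dist_iff[THEN iffD2])
    then have "(\<lambda>k. G (d (idx k \<omega>))) \<longlonglongrightarrow> G (X \<omega>)"
      using XU[OF \<omega>] dU by (intro continuous_on_tendsto_compose[OF G]) auto
    then show "(\<lambda>k. Y \<omega> \<bullet> G (d (idx k \<omega>))) \<longlonglongrightarrow> Y \<omega> \<bullet> G (X \<omega>)"
      by (intro tendsto_intros)
  qed
qed

text \<open>Independence on rectangles identifies the joint law with the product of the laws, and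
  Tonelli does the rest. It allows the noise to be averaged while the sample points are
  frozen.\<close>

lemma (in prob_space) indep_sequences_nn_integral:
  assumes ind: "indep_sequences M S Y S' Y'"
    and Y [measurable]: "\<And>n. Y n \<in> M \<rightarrow>\<^sub>M S" and Y' [measurable]: "\<And>n. Y' n \<in> M \<rightarrow>\<^sub>M S'"
    and h [measurable]: "h \<in> borel_measurable (Pi\<^sub>M UNIV (\<lambda>_. S) \<Otimes>\<^sub>M Pi\<^sub>M UNIV (\<lambda>_. S'))"
  shows "(\<integral>\<^sup>+\<omega>. h (\<lambda>n. Y n \<omega>, \<lambda>n. Y' n \<omega>) \<partial>M) =
         (\<integral>\<^sup>+\<omega>. \<integral>\<^sup>+\<omega>'. h (\<lambda>n. Y n \<omega>, \<lambda>n. Y' n \<omega>') \<partial>M \<partial>M)"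
proof -
  let ?P = "Pi\<^sub>M UNIV (\<lambda>_. S)" and ?Q = "Pi\<^sub>M UNIV (\<lambda>_. S')"
  let ?Y = "\<lambda>\<omega> n. Y n \<omega>" and ?Y' = "\<lambda>\<omega> n. Y' n \<omega>"
  have m1 [measurable]: "?Y \<in> M \<rightarrow>\<^sub>M ?P" by (rule measurable_PiM_single') (auto simp: measurable_space[OF Y])
  have m2 [measurable]: "?Y' \<in> M \<rightarrow>\<^sub>M ?Q" by (rule measurable_PiM_single') (auto simp: measurable_space[OF Y'])
  interpret P: prob_space "distr M ?P ?Y" by (rule prob_space_distr) measurable
  interpret Q: prob_space "distr M ?Q ?Y'" by (rule prob_space_distr) measurable
  have eq: "distr M ?P ?Y \<Otimes>\<^sub>M distr M ?Q ?Y' = distr M (?P \<Otimes>\<^sub>M ?Q) (\<lambda>\<omega>. (?Y \<omega>, ?Y' \<omega>))"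
  proof (rule pair_measure_eqI)
    fix A B assume "A \<in> sets (distr M ?P ?Y)" "B \<in> sets (distr M ?Q ?Y')"
    then have [measurable]: "A \<in> sets ?P" "B \<in> sets ?Q" by auto
    have "prob ((?Y -` A \<inter> space M) \<inter> (?Y' -` B \<inter> space M)) =
        prob (?Y -` A \<inter> space M) * prob (?Y' -` B \<inter> space M)"
      using ind unfolding indep_sequences_def by (rule indep_setD) auto
    moreover have "(\<lambda>\<omega>. (?Y \<omega>, ?Y' \<omega>)) -` (A \<times> B) \<inter> space M =
        (?Y -` A \<inter> space M) \<inter> (?Y' -` B \<inter> space M)" by auto
    ultimately show "emeasure (distr M ?P ?Y) A * emeasure (distr M ?Q ?Y') B =
        emeasure (distr M (?P \<Otimes>\<^sub>M ?Q) (\<lambda>\<omega>. (?Y \<omega>, ?Y' \<omega>))) (A \<times> B)"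
      by (simp add: emeasure_distr emeasure_eq_measure ennreal_mult[symmetric])
  qed (auto intro: P.sigma_finite_measure_axioms Q.sigma_finite_measure_axioms)
  have "(\<integral>\<^sup>+\<omega>. h (?Y \<omega>, ?Y' \<omega>) \<partial>M) = (\<integral>\<^sup>+z. h z \<partial>distr M (?P \<Otimes>\<^sub>M ?Q) (\<lambda>\<omega>. (?Y \<omega>, ?Y' \<omega>)))"
    by (simp add: nn_integral_distr)
  also have "\<dots> = (\<integral>\<^sup>+x. \<integral>\<^sup>+y. h (x, y) \<partial>distr M ?Q ?Y' \<partial>distr M ?P ?Y)"
    unfolding eq[symmetric] by (rule Q.nn_integral_fst[symmetric]) simp
  also have "\<dots> = (\<integral>\<^sup>+x. \<integral>\<^sup>+\<omega>'. h (x, ?Y' \<omega>') \<partial>M \<partial>distr M ?P ?Y)"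
    by (intro nn_integral_cong, subst nn_integral_distr) auto
  also have "\<dots> = (\<integral>\<^sup>+\<omega>. \<integral>\<^sup>+\<omega>'. h (?Y \<omega>, ?Y' \<omega>') \<partial>M \<partial>M)"
    by (subst nn_integral_distr) auto
  finally show ?thesis .
qed

section \<open>Moments of the noise sums and of the sampling errors\<close>

lemma iid_with_lawD:
  assumes "prob_space M" "iid_with_law M S Y law"
  shows "Y n \<in> M \<rightarrow>\<^sub>M S" "distr M S (Y n) = law"
  using assms by (auto simp: iid_with_law_def prob_space.indep_vars_def2)

text \<open>With the design frozen, the vectors \<open>G (u n \<omega>)\<close> are deterministic of
  norm at most \<open>g\<close>, and the summands are independent and centred. The bound for frozen
  vectors is uniform, so averaging over the design costs nothing.\<close>

lemma (in prob_space) noise_moment_bound: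
  fixes u :: "nat \<Rightarrow> 'a \<Rightarrow> 'u::euclidean_space" and eps :: "nat \<Rightarrow> 'a \<Rightarrow> 'v::real_inner"
  assumes r: "0 \<le> r" and \<Sigma>\<^sub>0: "0 \<le> \<Sigma>\<^sub>0"
    and u: "iid_with_law M (restrict_space borel U) u \<mu>"
    and eps: "iid_with_law M borel eps \<nu>" and \<nu>: "noise_law \<nu> \<Sigma>\<^sub>0"
    and ind: "indep_sequences M (restrict_space borel U) u borel eps"
    and G: "continuous_on U G" "\<And>x. x \<in> U \<Longrightarrow> norm (G x) \<le> g" and g: "0 < g" and N: "0 < N"
  shows "(\<integral>\<^sup>+\<omega>. ennreal (\<bar>\<Sum>n<N. eps n \<omega> \<bullet> G (u n \<omega>)\<bar> powr r) \<partial>M) \<le>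
    ennreal (moment_constant r * (max 1 \<Sigma>\<^sub>0 * g * sqrt (real N)) powr r)"
proof -
  \<comment> \<open>The maximum with 1 absorbs the exponent gap:
    \<open>\<Sigma>\<^sub>0 ^ (l - 2)\<close> is at most \<open>b ^ l\<close>, the homogeneous form
    required by the moment bound.\<close>
  define b where "b = max 1 \<Sigma>\<^sub>0"
  have b: "1 \<le> b" "\<Sigma>\<^sub>0 \<le> b" by (auto simp: b_def)
  interpret V: prob_space \<nu> using \<nu> by (simp add: noise_law_def)
  have [measurable]: "u n \<in> M \<rightarrow>\<^sub>M restrict_space borel U" for n using iid_with_lawD[OF prob_space_axioms u] by simp
  have [measurable]: "eps n \<in> borel_measurable M" for n using iid_with_lawD[OF prob_space_axioms eps] by simp
  have law: "distr M borel (eps n) = \<nu>" for n using iid_with_lawD[OF prob_space_axioms eps] by simp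
  have inner_meas: "(\<lambda>x. x \<bullet> v) \<in> borel_measurable borel" for v :: 'v
    by (intro borel_measurable_continuous_onI continuous_intros)
  have mom_int: "integrable \<nu> (\<lambda>x. norm x ^ l)" and mom: "(\<integral>x. norm x ^ l \<partial>\<nu>) \<le> fact l / 2 * b ^ l"
    if l: "2 \<le> l" for l
  proof -
    show "integrable \<nu> (\<lambda>x. norm x ^ l)" using \<nu> l by (simp add: noise_law_def)
    have "(\<integral>x. norm x ^ l \<partial>\<nu>) \<le> fact l / 2 * \<Sigma>\<^sub>0 ^ (l - 2)"
      using \<nu> l by (auto simp: noise_law_def intro: less_imp_le)
    also have "\<dots> \<le> fact l / 2 * b ^ l"
      using b \<Sigma>\<^sub>0 power_mono[of \<Sigma>\<^sub>0 b "l - 2"] power_increasing[of "l - 2" l b]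
      by (intro mult_left_mono) auto
    finally show "(\<integral>x. norm x ^ l \<partial>\<nu>) \<le> fact l / 2 * b ^ l" .
  qed
  have sets_nu [measurable_cong]: "sets \<nu> = sets borel" using \<nu> by (simp add: noise_law_def)
  have fixed: "(\<integral>\<^sup>+\<omega>. ennreal (\<bar>\<Sum>n<N. eps n \<omega> \<bullet> v n\<bar> powr r) \<partial>M) \<le>
      ennreal (moment_constant r * (b * g * sqrt (real N)) powr r)" if v: "\<And>n. norm (v n) \<le> g" for v
  proof -
    have "(\<integral>\<^sup>+\<omega>. ennreal (\<bar>\<Sum>n<N. eps n \<omega> \<bullet> v n\<bar> powr r) \<partial>M) \<le>
        ennreal (moment_constant r * ((b * g) * sqrt (real N)) powr r)"
    proof (rule moment_sum_bound[OF r])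
      show "indep_vars (\<lambda>_. borel) (\<lambda>n \<omega>. eps n \<omega> \<bullet> v n) UNIV"
        using eps unfolding iid_with_law_def
        by (intro indep_vars_compose2[where Y = "\<lambda>n x. x \<bullet> v n" and M' = "\<lambda>_. borel"])
          (auto simp: inner_meas)
      \<comment> \<open>The noise condition starts at the second moment; first moments are dominated
        through \<open>norm x \<le> 1 + norm x ^ 2\<close>.\<close>
      have "integrable \<nu> (\<lambda>x. x \<bullet> v n)" for n
      proof (rule Bochner_Integration.integrable_bound)
        show "integrable \<nu> (\<lambda>x. (1 + norm x ^ 2) * g)" using mom_int[of 2] by simp
        show "AE x in \<nu>. norm (x \<bullet> v n) \<le> norm ((1 + norm x ^ 2) * g)"
        proof (rule AE_I2)
          fix x :: 'v
          have "0 \<le> (norm x - 1)\<^sup>2" by simp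
          then have "norm x \<le> 1 + norm x ^ 2" by (simp add: power2_diff) (smt (verit) norm_ge_zero)
          moreover have "\<bar>x \<bullet> v n\<bar> \<le> norm x * g"
            using Cauchy_Schwarz_ineq2[of x "v n"] mult_left_mono[OF v[of n], of "norm x"] by simp
          ultimately have "\<bar>x \<bullet> v n\<bar> \<le> (1 + norm x ^ 2) * g"
            using g by (meson less_eq_real_def mult_right_mono order_trans)
          then show "norm (x \<bullet> v n) \<le> norm ((1 + norm x ^ 2) * g)" using g by (simp add: abs_mult)
        qed
      qed (simp add: inner_meas measurable_cong_sets[OF sets_nu refl])
      then show "integrable M (\<lambda>\<omega>. eps n \<omega> \<bullet> v n)" for n
        unfolding law[of n, symmetric] by (subst (asm) integrable_distr_eq) (auto simp: inner_meas)
      have "(\<integral>x. x \<bullet> v n \<partial>\<nu>) = 0" for n using \<nu> by (simp add: noise_law_def)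
      then show "(\<integral>\<omega>. eps n \<omega> \<bullet> v n \<partial>M) = 0" for n
        unfolding law[of n, symmetric] by (subst (asm) integral_distr) (auto simp: inner_meas)
      fix n l :: nat assume l: "2 \<le> l"
      have "(\<integral>\<^sup>+\<omega>. ennreal (\<bar>eps n \<omega> \<bullet> v n\<bar> ^ l) \<partial>M) \<le> (\<integral>\<^sup>+\<omega>. ennreal (norm (eps n \<omega>) ^ l * g ^ l) \<partial>M)"
      proof (intro nn_integral_mono ennreal_leI)
        fix \<omega>
        have "\<bar>eps n \<omega> \<bullet> v n\<bar> \<le> norm (eps n \<omega>) * g"
          using Cauchy_Schwarz_ineq2[of "eps n \<omega>" "v n"] mult_left_mono[OF v[of n], of "norm (eps n \<omega>)"] by simp
        then show "\<bar>eps n \<omega> \<bullet> v n\<bar> ^ l \<le> norm (eps n \<omega>) ^ l * g ^ l"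
          by (metis abs_ge_zero power_mono power_mult_distrib)
      qed
      also have "\<dots> = (\<integral>\<^sup>+x. ennreal (norm x ^ l * g ^ l) \<partial>\<nu>)"
        unfolding law[of n, symmetric] by (subst nn_integral_distr) auto
      also have "\<dots> = ennreal ((\<integral>x. norm x ^ l \<partial>\<nu>) * g ^ l)"
        using mom_int[OF l] g by (subst nn_integral_eq_integral) auto
      also have "\<dots> \<le> ennreal (fact l / 2 * (b * g) ^ l)"
        using mult_right_mono[OF mom[OF l], of "g ^ l"] g by (intro ennreal_leI) (simp add: power_mult_distrib)
      finally show "(\<integral>\<^sup>+\<omega>. ennreal (\<bar>eps n \<omega> \<bullet> v n\<bar> ^ l) \<partial>M) \<le> ennreal (fact l / 2 * (b * g) ^ l)" .
    qed (use b g N in auto)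
    then show ?thesis by simp
  qed
  define h where "h = (\<lambda>(x, e). ennreal (\<bar>\<Sum>n<N. e n \<bullet> G (x n)\<bar> powr r))"
  have inn: "(\<lambda>z. snd z n \<bullet> G (fst z n)) \<in> borel_measurable
      (Pi\<^sub>M UNIV (\<lambda>_. restrict_space borel U) \<Otimes>\<^sub>M Pi\<^sub>M UNIV (\<lambda>_. borel))" for n
    by (rule borel_measurable_inner_continuous_on[OF G(1)]) measurable
  have h [measurable]: "h \<in> borel_measurable (Pi\<^sub>M UNIV (\<lambda>_. restrict_space borel U) \<Otimes>\<^sub>M Pi\<^sub>M UNIV (\<lambda>_. borel))"
    unfolding h_def case_prod_beta using inn by measurable
  have "(\<integral>\<^sup>+\<omega>. h (\<lambda>n. u n \<omega>, \<lambda>n. eps n \<omega>) \<partial>M) = (\<integral>\<^sup>+\<omega>. \<integral>\<^sup>+\<omega>'. h (\<lambda>n. u n \<omega>, \<lambda>n. eps n \<omega>') \<partial>M \<partial>M)"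
    using ind by (rule indep_sequences_nn_integral) measurable
  also have "\<dots> \<le> (\<integral>\<^sup>+\<omega>. ennreal (moment_constant r * (b * g * sqrt (real N)) powr r) \<partial>M)"
  proof (rule nn_integral_mono)
    fix \<omega> assume "\<omega> \<in> space M"
    then have "u n \<omega> \<in> U" for n
      using measurable_space[of "u n" M "restrict_space borel U" \<omega>] by (simp add: space_restrict_space)
    then show "(\<integral>\<^sup>+\<omega>'. h (\<lambda>n. u n \<omega>, \<lambda>n. eps n \<omega>') \<partial>M) \<le> ennreal (moment_constant r * (b * g * sqrt (real N)) powr r)"
      unfolding h_def prod.case by (intro fixed G(2))
  qed
  also have "\<dots> = ennreal (moment_constant r * (b * g * sqrt (real N)) powr r)" by (simp add: emeasure_space_1)
  finally show ?thesis by (simp add: h_def b_def)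
qed

text \<open>A centred variable bounded by \<open>2 * \<beta>\<close> satisfies the factorial moment
  condition automatically, since \<open>fact l / 2\<close> is at least 1 for
  \<open>l \<ge> 2\<close>.\<close>

lemma (in prob_space) sampling_moment_bound:
  assumes r: "0 \<le> r" and u: "iid_with_law M S u \<mu>" and F [measurable]: "F \<in> borel_measurable S"
    and bd: "\<And>x. x \<in> space S \<Longrightarrow> \<bar>F x\<bar> \<le> \<beta>" and \<beta>: "0 < \<beta>" and N: "0 < N"
  shows "(\<integral>\<^sup>+\<omega>. ennreal (\<bar>\<Sum>n<N. F (u n \<omega>) - (\<integral>x. F x \<partial>\<mu>)\<bar> powr r) \<partial>M) \<le>
    ennreal (moment_constant r * (2 * \<beta> * sqrt (real N)) powr r)"
proof -
  have um [measurable]: "u n \<in> M \<rightarrow>\<^sub>M S" for n using iid_with_lawD[OF prob_space_axioms u] by simp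
  have law: "distr M S (u n) = \<mu>" for n using iid_with_lawD[OF prob_space_axioms u] by simp
  define m where "m = (\<integral>x. F x \<partial>\<mu>)"
  have m_eq: "(\<integral>\<omega>. F (u n \<omega>) \<partial>M) = m" for n
    unfolding m_def law[of n, symmetric] by (subst integral_distr) auto
  have bdu: "\<bar>F (u n \<omega>)\<bar> \<le> \<beta>" if "\<omega> \<in> space M" for n \<omega>
    by (rule bd[OF measurable_space[OF um that]])
  have int: "integrable M (\<lambda>\<omega>. F (u n \<omega>))" for n
    using bdu by (intro integrable_const_bound[of _ \<beta>]) auto
  have "\<bar>m\<bar> \<le> (\<integral>\<omega>. \<bar>F (u 0 \<omega>)\<bar> \<partial>M)" unfolding m_eq[of 0, symmetric]
    by (rule integral_abs_bound)
  also have "\<dots> \<le> (\<integral>\<omega>. \<beta> \<partial>M)"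
    using bdu by (intro integral_mono integrable_abs int) auto
  finally have "\<bar>m\<bar> \<le> (\<integral>\<omega>. \<beta> \<partial>M)" .
  then have mb: "\<bar>m\<bar> \<le> \<beta>" by (simp add: prob_space)
  have "(\<integral>\<^sup>+\<omega>. ennreal (\<bar>\<Sum>n<N. F (u n \<omega>) - m\<bar> powr r) \<partial>M) \<le> ennreal (moment_constant r * ((2 * \<beta>) * sqrt (real N)) powr r)"
  proof (rule moment_sum_bound[OF r])
    show "indep_vars (\<lambda>_. borel) (\<lambda>n \<omega>. F (u n \<omega>) - m) UNIV"
      using u unfolding iid_with_law_def
      by (intro indep_vars_compose2[where Y = "\<lambda>n x. F x - m" and M' = "\<lambda>_. S"]) auto
    show "integrable M (\<lambda>\<omega>. F (u n \<omega>) - m)" for n using int by auto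
    show "(\<integral>\<omega>. F (u n \<omega>) - m \<partial>M) = 0" for n using int m_eq by (simp add: prob_space)
    fix n l :: nat assume l: "2 \<le> l"
    have "(\<integral>\<^sup>+\<omega>. ennreal (\<bar>F (u n \<omega>) - m\<bar> ^ l) \<partial>M) \<le> (\<integral>\<^sup>+\<omega>. ennreal (fact l / 2 * (2 * \<beta>) ^ l) \<partial>M)"
    proof (intro nn_integral_mono ennreal_leI)
      fix \<omega> assume "\<omega> \<in> space M"
      then have "\<bar>F (u n \<omega>) - m\<bar> \<le> 2 * \<beta>" using bdu[of \<omega> n] mb by linarith
      from power_mono[OF this abs_ge_zero, of l] have "\<bar>F (u n \<omega>) - m\<bar> ^ l \<le> 1 * (2 * \<beta>) ^ l" by simp
      also have "\<dots> \<le> fact l / 2 * (2 * \<beta>) ^ l"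
      proof (rule mult_right_mono)
        have "(fact 2 :: real) \<le> fact l" by (rule fact_mono[OF l])
        then show "1 \<le> fact l / (2 :: real)" by simp
      qed (use \<beta> in simp)
      finally show "\<bar>F (u n \<omega>) - m\<bar> ^ l \<le> fact l / 2 * (2 * \<beta>) ^ l" .
    qed
    then show "(\<integral>\<^sup>+\<omega>. ennreal (\<bar>F (u n \<omega>) - m\<bar> ^ l) \<partial>M) \<le> ennreal (fact l / 2 * (2 * \<beta>) ^ l)"
      by (simp add: emeasure_space_1)
  qed (use \<beta> N in auto)
  then show ?thesis by (simp add: m_def)
qed

section \<open>Weighted power penalties in coordinates\<close>

text \<open>Models the Besov space through its wavelet coefficients \<open>cf\<close> and weights
  \<open>c\<close>. The penalty is then a sum over separate coordinates, and so are its gradient and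
  Bregman distance.\<close>

locale weighted_coordinates =
  fixes X :: "'x::real_vector set" and cf :: "'x \<Rightarrow> nat \<Rightarrow> real" and c :: "nat \<Rightarrow> real" and p :: real
  assumes p: "1 < p" "p < 2"
    and lincomb_mem: "\<And>f g a b. f \<in> X \<Longrightarrow> g \<in> X \<Longrightarrow> a *\<^sub>R f + b *\<^sub>R g \<in> X"
    and cf_lincomb: "\<And>f g a b i. f \<in> X \<Longrightarrow> g \<in> X \<Longrightarrow> cf (a *\<^sub>R f + b *\<^sub>R g) i = a * cf f i + b * cf g i"
    and c_pos: "\<And>i. 0 < c i"
    and summable_powr: "\<And>f. f \<in> X \<Longrightarrow> summable (\<lambda>i. c i * \<bar>cf f i\<bar> powr p)"
begin

definition coord_norm :: "'x \<Rightarrow> real" where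
  "coord_norm f = (\<Sum>i. c i * \<bar>cf f i\<bar> powr p) powr (1 / p)"

definition penalty :: "'x \<Rightarrow> real" where
  "penalty f = (1 / p) * coord_norm f powr p"

lemma c_nonneg [simp]: "0 \<le> c i" using c_pos[of i] by simp

section \<open>Linear structure and convergence of the coordinate series\<close>

lemma diff_mem: "f \<in> X \<Longrightarrow> g \<in> X \<Longrightarrow> f - g \<in> X"
  using lincomb_mem[of f g 1 "-1"] by simp

lemma cf_diff: "f \<in> X \<Longrightarrow> g \<in> X \<Longrightarrow> cf (f - g) i = cf f i - cf g i"
  using cf_lincomb[of f g 1 "-1"] by simp

lemma line_mem: "f \<in> X \<Longrightarrow> h \<in> X \<Longrightarrow> f + t *\<^sub>R h \<in> X"
  using lincomb_mem[of f h 1 t] by simp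

lemma cf_line: "f \<in> X \<Longrightarrow> h \<in> X \<Longrightarrow> cf (f + t *\<^sub>R h) i = cf f i + t * cf h i"
  using cf_lincomb[of f h 1 t] by simp

lemma penalty_eq:
  assumes "f \<in> X"
  shows "penalty f = (\<Sum>i. c i * \<bar>cf f i\<bar> powr p / p)"
proof -
  have "0 \<le> (\<Sum>i. c i * \<bar>cf f i\<bar> powr p)"
    by (intro suminf_nonneg summable_powr assms) simp
  then show ?thesis
    using p by (simp add: penalty_def coord_norm_def powr_powr suminf_divide[OF summable_powr[OF assms]])
qed

lemma summable_sum_powr:
  assumes "f \<in> X" "h \<in> X"
  shows "summable (\<lambda>i. c i * (\<bar>cf f i\<bar> + \<bar>cf h i\<bar>) powr p)"
proof (rule summable_comparison_test')
  show "summable (\<lambda>i. 2 powr p * (c i * \<bar>cf f i\<bar> powr p + c i * \<bar>cf h i\<bar> powr p))"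
    by (intro summable_mult summable_add summable_powr assms)
  show "norm (c i * (\<bar>cf f i\<bar> + \<bar>cf h i\<bar>) powr p) \<le>
      2 powr p * (c i * \<bar>cf f i\<bar> powr p + c i * \<bar>cf h i\<bar> powr p)" for i
    using mult_left_mono[OF abs_add_powr_le[of p "\<bar>cf f i\<bar>" "\<bar>cf h i\<bar>"] c_nonneg[of i]] p
    by (simp add: abs_mult algebra_simps)
qed

lemma mult_powr_le:
  fixes a b :: real
  assumes "0 \<le> a" "0 \<le> b"
  shows "(a + b) powr (p - 1) * b \<le> (a + b) powr p"
proof (cases "a + b = 0")
  case False
  have "(a + b) powr (p - 1) * b \<le> (a + b) powr (p - 1) * (a + b)"
    using assms by (intro mult_left_mono) auto
  also have "\<dots> = (a + b) powr p"
    using powr_mult_base[of "a + b" "p - 1"] assms by (simp add: mult.commute)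
  finally show ?thesis .
qed (use assms in auto)

lemma summable_dual:
  assumes "f \<in> X" "h \<in> X"
  shows "summable (\<lambda>i. c i * (spow (p - 1) (cf f i) * cf h i))"
proof (rule summable_comparison_test')
  show "summable (\<lambda>i. c i * (\<bar>cf f i\<bar> + \<bar>cf h i\<bar>) powr p)" by (rule summable_sum_powr[OF assms])
  fix i
  have "\<bar>cf f i\<bar> powr (p - 1) * \<bar>cf h i\<bar> \<le> (\<bar>cf f i\<bar> + \<bar>cf h i\<bar>) powr (p - 1) * \<bar>cf h i\<bar>"
    using p by (intro mult_right_mono powr_mono2) auto
  also have "\<dots> \<le> (\<bar>cf f i\<bar> + \<bar>cf h i\<bar>) powr p" by (rule mult_powr_le) auto
  finally show "norm (c i * (spow (p - 1) (cf f i) * cf h i)) \<le> c i * (\<bar>cf f i\<bar> + \<bar>cf h i\<bar>) powr p"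
    by (simp add: abs_mult abs_spow mult_left_mono)
qed

text \<open>Termwise differentiation: for \<open>t\<close> in the open unit interval around 0, the
  i-th term is Lipschitz with constant
  \<open>c i * (\<bar>cf f i\<bar> + \<bar>cf h i\<bar>) powr p\<close>, and these constants are
  summable.\<close>

lemma DERIV_penalty:
  assumes f: "f \<in> X" and h: "h \<in> X"
  shows "((\<lambda>t. penalty (f + t *\<^sub>R h)) has_real_derivative (\<Sum>i. c i * (spow (p - 1) (cf f i) * cf h i))) (at 0)"
proof -
  let ?F = "\<lambda>t i. c i * \<bar>cf f i + t * cf h i\<bar> powr p / p"
  have "DERIV (\<lambda>t. suminf (?F t)) 0 :> (\<Sum>i. c i * (spow (p - 1) (cf f i + 0 * cf h i) * cf h i))"
  proof (rule DERIV_series'[where a = "-1" and b = 1 and f' = "\<lambda>t i. c i * (spow (p - 1) (cf f i + t * cf h i) * cf h i)"])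
    fix i
    have "((\<lambda>t. \<bar>cf f i + t * cf h i\<bar> powr p) has_real_derivative
        p * spow (p - 1) (cf f i + 0 * cf h i) * cf h i) (at 0)"
      by (rule DERIV_chain2[OF DERIV_abs_powr[OF p(1)]]) (auto intro!: derivative_eq_intros)
    then have "((\<lambda>t. c i / p * \<bar>cf f i + t * cf h i\<bar> powr p) has_real_derivative
        c i / p * (p * spow (p - 1) (cf f i + 0 * cf h i) * cf h i)) (at 0)"
      by (rule DERIV_cmult)
    then show "((\<lambda>t. ?F t i) has_real_derivative c i * (spow (p - 1) (cf f i + 0 * cf h i) * cf h i)) (at 0)"
      using p by (simp add: mult_ac)
  next
    fix t :: real
    show "summable (?F t)"
      using summable_divide[OF summable_powr[OF line_mem[OF f h, of t]], of p] by (simp add: cf_line f h)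
  next
    show "summable (\<lambda>i. c i * (\<bar>cf f i\<bar> + \<bar>cf h i\<bar>) powr p)" by (rule summable_sum_powr[OF f h])
  next
    fix i and s t :: real assume st: "s \<in> {-1<..<1}" "t \<in> {-1<..<1}"
    let ?M = "\<bar>cf f i\<bar> + \<bar>cf h i\<bar>"
    have b: "\<bar>cf f i + r * cf h i\<bar> \<le> ?M" if "r \<in> {-1<..<1}" for r
    proof -
      have "\<bar>r * cf h i\<bar> \<le> 1 * \<bar>cf h i\<bar>" unfolding abs_mult using that by (intro mult_right_mono) auto
      then show ?thesis by linarith
    qed
    have "\<bar>\<bar>cf f i + s * cf h i\<bar> powr p - \<bar>cf f i + t * cf h i\<bar> powr p\<bar> \<le>
        p * ?M powr (p - 1) * \<bar>(cf f i + s * cf h i) - (cf f i + t * cf h i)\<bar>"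
      by (rule abs_powr_Lipschitz[OF p(1) b[OF st(1)] b[OF st(2)]])
    also have "(cf f i + s * cf h i) - (cf f i + t * cf h i) = cf h i * (s - t)" by (simp add: algebra_simps)
    also have "p * ?M powr (p - 1) * \<bar>cf h i * (s - t)\<bar> = p * (?M powr (p - 1) * \<bar>cf h i\<bar>) * \<bar>s - t\<bar>"
      by (simp add: abs_mult)
    also have "\<dots> \<le> p * ?M powr p * \<bar>s - t\<bar>"
      using p by (intro mult_right_mono mult_left_mono mult_powr_le) auto
    finally have *: "\<bar>\<bar>cf f i + s * cf h i\<bar> powr p - \<bar>cf f i + t * cf h i\<bar> powr p\<bar> \<le> p * ?M powr p * \<bar>s - t\<bar>" .
    have "\<bar>?F s i - ?F t i\<bar> = c i / p * \<bar>\<bar>cf f i + s * cf h i\<bar> powr p - \<bar>cf f i + t * cf h i\<bar> powr p\<bar>"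
    proof -
      have "?F s i - ?F t i = c i / p * (\<bar>cf f i + s * cf h i\<bar> powr p - \<bar>cf f i + t * cf h i\<bar> powr p)"
        by (simp add: algebra_simps)
      then show ?thesis using p by (simp only: abs_mult) simp
    qed
    also have "\<dots> \<le> c i / p * (p * ?M powr p * \<bar>s - t\<bar>)"
      using * p by (intro mult_left_mono) auto
    finally show "\<bar>?F s i - ?F t i\<bar> \<le> c i * ?M powr p * \<bar>s - t\<bar>" using p by simp
  qed (use summable_dual[OF f h] in auto)
  moreover have "(\<lambda>t. penalty (f + t *\<^sub>R h)) = (\<lambda>t. suminf (?F t))"
    by (simp add: penalty_eq line_mem cf_line f h)
  ultimately show ?thesis by simp
qed

lemma grad_penalty:
  assumes "f \<in> X" "h \<in> X"
  shows "grad penalty f h = (\<Sum>i. c i * (spow (p - 1) (cf f i) * cf h i))"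
  unfolding grad_def by (rule DERIV_imp_deriv[OF DERIV_penalty[OF assms]])

lemma bregman_penalty_sums:
  assumes "f \<in> X" "g \<in> X"
  shows "(\<lambda>i. c i * ((spow (p - 1) (cf f i) - spow (p - 1) (cf g i)) * (cf f i - cf g i))) sums bregman penalty f g"
proof -
  have h: "f - g \<in> X" by (rule diff_mem[OF assms])
  show ?thesis
    using sums_diff[OF summable_sums[OF summable_dual[OF assms(1) h]] summable_sums[OF summable_dual[OF assms(2) h]]]
    by (simp add: bregman_def grad_penalty[OF _ h] assms cf_diff algebra_simps)
qed

text \<open>Subtracting a partial expansion from \<open>f\<close> leaves only the tail of its
  coefficients, so the norm of the rest is the tail of a convergent series and tends to 0;
  continuity of \<eta> transfers this to its values.\<close>

lemma coordinate_expansion: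
  assumes T: "\<And>i. T i \<in> X" "\<And>i j. cf (T i) j = (if i = j then 1 else 0)"
    and lin: "\<And>f g a b. f \<in> X \<Longrightarrow> g \<in> X \<Longrightarrow> \<eta> (a *\<^sub>R f + b *\<^sub>R g) = a * \<eta> f + b * \<eta> g"
    and bound: "\<And>f. f \<in> X \<Longrightarrow> \<bar>\<eta> f\<bar> \<le> K * coord_norm f" and f: "f \<in> X"
  shows "(\<lambda>i. cf f i * \<eta> (T i)) sums \<eta> f"
proof -
  define rest where "rest n = f - (\<Sum>i<n. cf f i *\<^sub>R T i)" for n
  have rest: "rest n \<in> X \<and> (\<forall>j. cf (rest n) j = (if j < n then 0 else cf f j)) \<and>
      \<eta> (rest n) = \<eta> f - (\<Sum>i<n. cf f i * \<eta> (T i))" for n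
  proof (induction n)
    case (Suc n)
    have "rest (Suc n) = 1 *\<^sub>R rest n + (- cf f n) *\<^sub>R T n" by (simp add: rest_def)
    then show ?case
      using Suc T(2) lincomb_mem[of "rest n" "T n" 1 "- cf f n"] cf_lincomb[of "rest n" "T n" 1 "- cf f n"]
        lin[of "rest n" "T n" 1 "- cf f n"] T(1)[of n] by (auto simp: less_Suc_eq)
  qed (simp add: rest_def f)
  have tail: "(\<Sum>i. c i * \<bar>cf (rest n) i\<bar> powr p) = (\<Sum>i. c (i + n) * \<bar>cf f (i + n)\<bar> powr p)" for n
  proof -
    have "(\<Sum>i. c i * \<bar>cf (rest n) i\<bar> powr p) =
        (\<Sum>i. c (i + n) * \<bar>cf (rest n) (i + n)\<bar> powr p) + (\<Sum>i<n. c i * \<bar>cf (rest n) i\<bar> powr p)"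
      using rest by (intro suminf_split_initial_segment summable_powr) auto
    then show ?thesis using rest[of n] by simp
  qed
  have "(\<lambda>n. \<Sum>i. c (i + n) * \<bar>cf f (i + n)\<bar> powr p) \<longlonglongrightarrow> 0"
    by (rule suminf_exist_split2[OF summable_powr[OF f]])
  then have "(\<lambda>n. coord_norm (rest n)) \<longlonglongrightarrow> 0 powr (1 / p)"
    unfolding coord_norm_def tail using p
    by (intro tendsto_powr' tendsto_const)
      (auto intro!: always_eventually suminf_nonneg summable_ignore_initial_segment summable_powr f)
  then have "(\<lambda>n. K * coord_norm (rest n)) \<longlonglongrightarrow> K * (0 powr (1 / p))" by (intro tendsto_intros)
  then have "(\<lambda>n. K * coord_norm (rest n)) \<longlonglongrightarrow> 0" by simp
  moreover have "norm (\<eta> (rest n)) \<le> K * coord_norm (rest n)" for n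
    using bound[of "rest n"] rest[of n] by simp
  ultimately have "(\<lambda>n. \<eta> (rest n)) \<longlonglongrightarrow> 0"
    by (intro Lim_null_comparison[of "\<lambda>n. \<eta> (rest n)" "\<lambda>n. K * coord_norm (rest n)"] always_eventually allI)
  then have "(\<lambda>n. \<eta> f - \<eta> (rest n)) \<longlonglongrightarrow> \<eta> f - 0" by (intro tendsto_intros)
  then show ?thesis using rest by (simp add: sums_def)
qed

text \<open>Minimality is tested only on the segment from \<open>f\<close> to \<open>g\<close>, so
  the derivative is one-sided and an inequality results. This is how the sign constraint is
  accommodated: the segment stays in the convex set of non-negative elements.\<close>

lemma first_order_condition:
  fixes A :: "'x \<Rightarrow> nat \<Rightarrow> 'v::real_inner"
  assumes f: "f \<in> X" and g: "g \<in> X"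
    and lin: "\<And>f g a b n. f \<in> X \<Longrightarrow> g \<in> X \<Longrightarrow> A (a *\<^sub>R f + b *\<^sub>R g) n = a *\<^sub>R A f n + b *\<^sub>R A g n"
    and min: "\<And>t. 0 < t \<Longrightarrow> t < 1 \<Longrightarrow>
      1 / 2 * (VN_norm N (\<lambda>n. A f n - y n))\<^sup>2 + \<alpha> * penalty f \<le>
      1 / 2 * (VN_norm N (\<lambda>n. A (f + t *\<^sub>R (g - f)) n - y n))\<^sup>2 + \<alpha> * penalty (f + t *\<^sub>R (g - f))"
  shows "\<alpha> * grad penalty f (f - g) \<le> - VN_inner N (\<lambda>n. A f n - y n) (A (f - g))"
proof -
  have gf: "g - f \<in> X" and fg: "f - g \<in> X" by (rule diff_mem; fact)+
  define v where "v n = A f n - y n" for n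
  define z where "z n = A (g - f) n" for n
  have sq: "(VN_norm N a)\<^sup>2 = VN_inner N a a" for a :: "nat \<Rightarrow> 'v"
    by (simp add: VN_norm_def VN_inner_def sum_nonneg)
  have line: "A (f + t *\<^sub>R (g - f)) n - y n = v n + t *\<^sub>R z n" for t n
    using lin[OF f gf, of 1 t n] by (simp add: v_def z_def)
  have exp: "VN_inner N (\<lambda>n. v n + t *\<^sub>R z n) (\<lambda>n. v n + t *\<^sub>R z n) =
      VN_inner N v v + t * (2 * VN_inner N v z) + t\<^sup>2 * VN_inner N z z" for t
    unfolding VN_inner_def
    by (simp add: inner_add_left inner_add_right sum.distrib sum_distrib_left add_divide_distrib
        power2_eq_square inner_commute mult_ac)
  define \<phi> where "\<phi> t = 1 / 2 * (VN_inner N v v + t * (2 * VN_inner N v z) + t\<^sup>2 * VN_inner N z z) +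
      \<alpha> * penalty (f + t *\<^sub>R (g - f))" for t
  have "(\<phi> has_real_derivative VN_inner N v z + \<alpha> * grad penalty f (g - f)) (at 0)"
    unfolding \<phi>_def grad_penalty[OF f gf]
    by (rule derivative_eq_intros DERIV_penalty[OF f gf] refl)+ simp
  moreover have "\<phi> 0 \<le> \<phi> t" if "0 < t" "t < 1" for t
    using min[OF that] line[of t] line[of 0] unfolding \<phi>_def sq by (simp add: exp v_def[symmetric])
  ultimately have "0 \<le> VN_inner N v z + \<alpha> * grad penalty f (g - f)"
  proof (rule_tac ccontr)
    assume d: "(\<phi> has_real_derivative VN_inner N v z + \<alpha> * grad penalty f (g - f)) (at 0)"
      and le: "\<And>t. 0 < t \<Longrightarrow> t < 1 \<Longrightarrow> \<phi> 0 \<le> \<phi> t"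
      and "\<not> 0 \<le> VN_inner N v z + \<alpha> * grad penalty f (g - f)"
    then obtain \<epsilon> where "0 < \<epsilon>" "\<And>h. 0 < h \<Longrightarrow> h < \<epsilon> \<Longrightarrow> \<phi> (0 + h) < \<phi> 0"
      using DERIV_neg_dec_right[OF d] by auto
    moreover have "0 < min \<epsilon> 1 / 2" "min \<epsilon> 1 / 2 < \<epsilon>" "min \<epsilon> 1 / 2 < 1"
      using \<open>0 < \<epsilon>\<close> by (auto simp: min_def)
    ultimately show False using le[of "min \<epsilon> 1 / 2"] by fastforce
  qed
  moreover have "grad penalty f (g - f) = - grad penalty f (f - g)"
    using suminf_minus[OF summable_dual[OF f fg]]
    by (simp add: grad_penalty f g gf fg cf_diff algebra_simps)
  moreover have "z n = - A (f - g) n" for n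
    using lin[OF f g, of 1 "-1" n] lin[OF g f, of 1 "-1" n] by (simp add: z_def)
  then have "VN_inner N v z = - VN_inner N v (A (f - g))"
    by (simp add: VN_inner_def sum_negf)
  moreover have "v = (\<lambda>n. A f n - y n)" by (simp add: fun_eq_iff v_def)
  ultimately show ?thesis by simp
qed

text \<open>The quadratic data term lives in the empirical inner product, so the source element must
  be paired empirically for the square to be completed. The gap between
  \<open>grad penalty g\<close> and this empirical pairing remains and becomes the sampling
  error.\<close>

lemma bregman_le_residual:
  fixes A :: "'x \<Rightarrow> nat \<Rightarrow> 'v::real_inner"
  assumes f: "f \<in> X" and g: "g \<in> X" and \<alpha>: "0 < \<alpha>" and N: "0 < N"
    and lin: "\<And>f g a b n. f \<in> X \<Longrightarrow> g \<in> X \<Longrightarrow> A (a *\<^sub>R f + b *\<^sub>R g) n = a *\<^sub>R A f n + b *\<^sub>R A g n"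
    and min: "\<And>t. 0 < t \<Longrightarrow> t < 1 \<Longrightarrow>
      1 / 2 * (VN_norm N (\<lambda>n. A f n - (A g n + d *\<^sub>R e n)))\<^sup>2 + \<alpha> * penalty f \<le>
      1 / 2 * (VN_norm N (\<lambda>n. A (f + t *\<^sub>R (g - f)) n - (A g n + d *\<^sub>R e n)))\<^sup>2 +
        \<alpha> * penalty (f + t *\<^sub>R (g - f))"
    and W: "\<And>n. norm (w n) \<le> W"
  shows "\<alpha> * bregman penalty f g \<le> \<alpha>\<^sup>2 * W\<^sup>2 / 4 + (d * VN_inner N e (A (f - g)) -
    \<alpha> * (grad penalty g (f - g) - VN_inner N w (A (f - g))))"
proof -
  define z where "z n = A (f - g) n" for n
  have z: "A f n - (A g n + d *\<^sub>R e n) = z n - d *\<^sub>R e n" for n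
    using lin[OF f g, of 1 "-1" n] by (simp add: z_def)
  have "\<alpha> * grad penalty f (f - g) \<le> - VN_inner N (\<lambda>n. z n - d *\<^sub>R e n) z"
    using first_order_condition[OF f g lin min] unfolding z by (simp add: z_def[abs_def])
  also have "\<dots> = - VN_inner N z z + d * VN_inner N e z"
    by (simp add: VN_inner_def inner_diff_left sum_subtractf sum_distrib_left diff_divide_distrib)
  finally have 1: "\<alpha> * grad penalty f (f - g) \<le> - VN_inner N z z + d * VN_inner N e z" .
  have "- (z n \<bullet> z n) - \<alpha> * (w n \<bullet> z n) \<le> \<alpha>\<^sup>2 * W\<^sup>2 / 4" for n
  proof -
    have "0 \<le> (z n + (\<alpha> / 2) *\<^sub>R w n) \<bullet> (z n + (\<alpha> / 2) *\<^sub>R w n)" by simp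
    also have "\<dots> = z n \<bullet> z n + \<alpha> * (w n \<bullet> z n) + \<alpha>\<^sup>2 / 4 * (w n \<bullet> w n)"
      by (simp add: inner_add_left inner_add_right inner_commute power2_eq_square)
    also have "w n \<bullet> w n \<le> W\<^sup>2"
      using power_mono[OF W[of n] norm_ge_zero, of 2] by (simp add: power2_norm_eq_inner)
    then have "\<alpha>\<^sup>2 / 4 * (w n \<bullet> w n) \<le> \<alpha>\<^sup>2 / 4 * W\<^sup>2" by (intro mult_left_mono) auto
    finally show ?thesis by simp
  qed
  then have "(\<Sum>n<N. - (z n \<bullet> z n) - \<alpha> * (w n \<bullet> z n)) / real N \<le> (\<Sum>n<N. \<alpha>\<^sup>2 * W\<^sup>2 / 4) / real N"
    by (intro divide_right_mono sum_mono) auto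
  then have 2: "- VN_inner N z z - \<alpha> * VN_inner N w z \<le> \<alpha>\<^sup>2 * W\<^sup>2 / 4"
    using N by (simp add: VN_inner_def sum_subtractf sum_negf sum_distrib_left diff_divide_distrib)
  have "\<alpha> * bregman penalty f g = \<alpha> * grad penalty f (f - g) - \<alpha> * grad penalty g (f - g)"
    by (simp add: bregman_def algebra_simps)
  with 1 2 show ?thesis by (simp add: z_def[abs_def] algebra_simps)
qed

text \<open>Scaling the functional by \<alpha> makes the coordinatewise inequality consume exactly
  half of \<open>\<alpha> * bregman penalty f g\<close>; moving that half to the left doubles the
  remaining terms.\<close>

lemma bregman_le_dual_series:
  fixes q C :: real
  assumes f: "f \<in> X" and g: "g \<in> X" and \<alpha>: "0 < \<alpha>" and C: "0 < C"
    "\<And>a b y k. 0 < k \<Longrightarrow> \<bar>(a - b) * y\<bar> \<le>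
       k / 2 * ((spow (p - 1) a - spow (p - 1) b) * (a - b)) +
       C * (k powr (- (q / p)) * \<bar>y\<bar> powr q + y\<^sup>2 * \<bar>b\<bar> powr (2 - p) / k)"
    and E: "(\<lambda>i. (cf f i - cf g i) * (\<alpha> * y i)) sums E"
    and le: "\<alpha> * bregman penalty f g \<le> \<alpha>\<^sup>2 * W\<^sup>2 / 4 + E"
  shows "ennreal (bregman penalty f g) \<le> ennreal (\<alpha> * W\<^sup>2 / 2) +
    ennreal (2 * C) * (\<Sum>i. ennreal (c i powr (- (q / p)) * \<bar>y i\<bar> powr q + (y i)\<^sup>2 * \<bar>cf g i\<bar> powr (2 - p) / c i))"
proof -
  define b where "b i = c i powr (- (q / p)) * \<bar>y i\<bar> powr q + (y i)\<^sup>2 * \<bar>cf g i\<bar> powr (2 - p) / c i" for i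
  define \<theta> where "\<theta> i = c i * ((spow (p - 1) (cf f i) - spow (p - 1) (cf g i)) * (cf f i - cf g i))" for i
  define D where "D = bregman penalty f g"
  have b: "0 \<le> b i" for i by (simp add: b_def)
  have \<theta>: "0 \<le> \<theta> i" for i
  proof -
    have "0 \<le> (spow (p - 1) (cf f i) - spow (p - 1) (cf g i)) * (cf f i - cf g i)"
      using p
      by (intro order_trans[OF _ spow_strongly_monotone[OF p, of "cf f i" "max \<bar>cf f i\<bar> \<bar>cf g i\<bar>" "cf g i"]]) auto
    then show ?thesis by (simp add: \<theta>_def)
  qed
  have \<theta>_sums: "\<theta> sums D" unfolding \<theta>_def D_def by (rule bregman_penalty_sums[OF f g])
  show ?thesis
  proof (cases "(\<Sum>i. ennreal (b i)) = \<top>")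
    \<comment> \<open>A divergent remainder series makes the right side infinite. Thus the estimate
      holds for every outcome, without an exceptional set.\<close>
    case True
    then show ?thesis using C(1) by (simp add: b_def[symmetric] ennreal_mult_top)
  next
    case False
    have sb: "summable b" using False b by (intro summable_suminf_not_top) auto
    have "E \<le> \<alpha> * (D / 2 + C * suminf b)"
    proof (rule LIMSEQ_le_const2)
      show "(\<lambda>n. \<Sum>i<n. (cf f i - cf g i) * (\<alpha> * y i)) \<longlonglongrightarrow> E" using E by (simp add: sums_def)
      show "\<exists>M. \<forall>n\<ge>M. (\<Sum>i<n. (cf f i - cf g i) * (\<alpha> * y i)) \<le> \<alpha> * (D / 2 + C * suminf b)"
      proof (intro exI allI impI)
        fix n :: nat
        have "(cf f i - cf g i) * (\<alpha> * y i) \<le> \<alpha> * (\<theta> i / 2 + C * b i)" for i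
        proof -
          have "(cf f i - cf g i) * y i \<le> \<theta> i / 2 + C * b i"
            using C(2)[OF c_pos[of i], of "cf f i" "cf g i" "y i"] by (simp add: \<theta>_def b_def)
          from mult_left_mono[OF this, of \<alpha>] \<alpha> show ?thesis by (simp add: mult_ac)
        qed
        then have "(\<Sum>i<n. (cf f i - cf g i) * (\<alpha> * y i)) \<le> (\<Sum>i<n. \<alpha> * (\<theta> i / 2 + C * b i))"
          by (intro sum_mono)
        also have "\<dots> = \<alpha> * ((\<Sum>i<n. \<theta> i) / 2 + C * (\<Sum>i<n. b i))"
          by (simp add: sum_distrib_left sum.distrib sum_divide_distrib distrib_left mult_ac)
        also have "\<dots> \<le> \<alpha> * (D / 2 + C * suminf b)"
          using \<alpha> C(1) sum_le_suminf[OF sb, of "{..<n}"] sum_le_suminf[OF sums_summable[OF \<theta>_sums], of "{..<n}"] b \<theta>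
          by (intro mult_left_mono add_mono divide_right_mono) (auto simp: sums_unique[OF \<theta>_sums])
        finally show "(\<Sum>i<n. (cf f i - cf g i) * (\<alpha> * y i)) \<le> \<alpha> * (D / 2 + C * suminf b)" .
      qed
    qed
    with le have "\<alpha> * D \<le> \<alpha> * (\<alpha> * W\<^sup>2 / 4 + D / 2 + C * suminf b)"
      by (simp add: D_def power2_eq_square algebra_simps)
    then have "D \<le> \<alpha> * W\<^sup>2 / 2 + 2 * C * suminf b" using \<alpha> by simp
    then have "ennreal D \<le> ennreal (\<alpha> * W\<^sup>2 / 2 + 2 * C * suminf b)" by (rule ennreal_leI)
    also have "\<dots> = ennreal (\<alpha> * W\<^sup>2 / 2) + ennreal (2 * C) * (\<Sum>i. ennreal (b i))"
      using \<alpha> C(1) sb b suminf_nonneg[OF sb b] by (simp add: suminf_ennreal2 ennreal_mult ennreal_plus)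
    finally show ?thesis by (simp add: D_def b_def)
  qed
qed

end

section \<open>Besov spaces and non-negative distributions\<close>

lemma dist_apply_lincomb:
  "dist_apply (a *\<^sub>R S + b *\<^sub>R T) \<phi> = a * dist_apply S \<phi> + b * dist_apply T \<phi>"
  by (simp add: plus_tempered_dist.rep_eq scaleR_tempered_dist.rep_eq)

lemma besov_space_lincomb:
  assumes "0 \<le> p" "S \<in> besov_space \<Phi> s p" "T \<in> besov_space \<Phi> s p"
  shows "a *\<^sub>R S + b *\<^sub>R T \<in> besov_space \<Phi> s p"
proof -
  let ?B = "\<lambda>T j x. lp_block \<Phi> j T x"
  let ?R = "a *\<^sub>R S + b *\<^sub>R T"
  define K where "K = 2 powr p"
  have K: "0 < K" by (simp add: K_def)
  have lin: "?B ?R j x = a * ?B S j x + b * ?B T j x" for j x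
    by (simp add: lp_block_def dist_apply_lincomb)
  have meas [measurable]: "lp_block \<Phi> j S \<in> borel_measurable lborel" "lp_block \<Phi> j T \<in> borel_measurable lborel" for j
    using assms by (auto simp: besov_space_def)
  have int [simp]: "integrable lborel (\<lambda>x. \<bar>?B S j x\<bar> powr p)" "integrable lborel (\<lambda>x. \<bar>?B T j x\<bar> powr p)" for j
    using assms by (auto simp: besov_space_def)
  have bd: "\<bar>?B ?R j x\<bar> powr p \<le> K * (\<bar>a\<bar> powr p * \<bar>?B S j x\<bar> powr p + \<bar>b\<bar> powr p * \<bar>?B T j x\<bar> powr p)" for j x
    using abs_add_powr_le[OF assms(1), of "a * ?B S j x" "b * ?B T j x"]
    by (simp add: lin abs_mult powr_mult K_def)
  have measR: "lp_block \<Phi> j ?R \<in> borel_measurable lborel" for j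
  proof -
    have "lp_block \<Phi> j ?R = (\<lambda>x. a * ?B S j x + b * ?B T j x)" by (rule ext) (rule lin)
    then show ?thesis by simp
  qed
  have intR: "integrable lborel (\<lambda>x. \<bar>?B ?R j x\<bar> powr p)" for j
  proof (rule Bochner_Integration.integrable_bound)
    show "integrable lborel (\<lambda>x. K * (\<bar>a\<bar> powr p * \<bar>?B S j x\<bar> powr p + \<bar>b\<bar> powr p * \<bar>?B T j x\<bar> powr p))"
      by (intro integrable_mult_right integrable_add) simp_all
    show "AE x in lborel. norm (\<bar>?B ?R j x\<bar> powr p) \<le>
        norm (K * (\<bar>a\<bar> powr p * \<bar>?B S j x\<bar> powr p + \<bar>b\<bar> powr p * \<bar>?B T j x\<bar> powr p))"
    proof (rule AE_I2)
      show "norm (\<bar>?B ?R j x\<bar> powr p) \<le>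
          norm (K * (\<bar>a\<bar> powr p * \<bar>?B S j x\<bar> powr p + \<bar>b\<bar> powr p * \<bar>?B T j x\<bar> powr p))" for x
        using order_trans[OF bd[of j x] abs_ge_self] by simp
    qed
  qed (use measR in measurable)
  have "summable (\<lambda>j. 2 powr (real j * s * p) * (\<integral>x. \<bar>?B ?R j x\<bar> powr p \<partial>lborel))"
  proof (rule summable_comparison_test')
    show "summable (\<lambda>j. K * (\<bar>a\<bar> powr p * (2 powr (real j * s * p) * (\<integral>x. \<bar>?B S j x\<bar> powr p \<partial>lborel)) +
        \<bar>b\<bar> powr p * (2 powr (real j * s * p) * (\<integral>x. \<bar>?B T j x\<bar> powr p \<partial>lborel))))"
      using assms by (intro summable_mult summable_add) (auto simp: besov_space_def)
    fix j
    have "(\<integral>x. \<bar>?B ?R j x\<bar> powr p \<partial>lborel) \<le>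
        (\<integral>x. K * (\<bar>a\<bar> powr p * \<bar>?B S j x\<bar> powr p + \<bar>b\<bar> powr p * \<bar>?B T j x\<bar> powr p) \<partial>lborel)"
      by (intro integral_mono intR bd integrable_mult_right integrable_add) simp_all
    also have "\<dots> = K * (\<bar>a\<bar> powr p * (\<integral>x. \<bar>?B S j x\<bar> powr p \<partial>lborel) + \<bar>b\<bar> powr p * (\<integral>x. \<bar>?B T j x\<bar> powr p \<partial>lborel))"
      by simp
    finally have "2 powr (real j * s * p) * (\<integral>x. \<bar>?B ?R j x\<bar> powr p \<partial>lborel) \<le> 2 powr (real j * s * p) *
        (K * (\<bar>a\<bar> powr p * (\<integral>x. \<bar>?B S j x\<bar> powr p \<partial>lborel) + \<bar>b\<bar> powr p * (\<integral>x. \<bar>?B T j x\<bar> powr p \<partial>lborel)))"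
      by (intro mult_left_mono) auto
    then show "norm (2 powr (real j * s * p) * (\<integral>x. \<bar>?B ?R j x\<bar> powr p \<partial>lborel)) \<le>
        K * (\<bar>a\<bar> powr p * (2 powr (real j * s * p) * (\<integral>x. \<bar>?B S j x\<bar> powr p \<partial>lborel)) +
        \<bar>b\<bar> powr p * (2 powr (real j * s * p) * (\<integral>x. \<bar>?B T j x\<bar> powr p \<partial>lborel)))"
      by (simp add: algebra_simps)
  qed
  then show ?thesis using measR intR by (simp add: besov_space_def)
qed

lemma nonneg_ae_convex:
  assumes "nonneg_ae S" "nonneg_ae T" "0 \<le> a" "0 \<le> b"
  shows "nonneg_ae (a *\<^sub>R S + b *\<^sub>R T)"
proof -
  obtain h k where h: "represents S h" "AE x in lborel. 0 \<le> h x"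
    and k: "represents T k" "AE x in lborel. 0 \<le> k x"
    using assms(1,2) by (auto simp: nonneg_ae_def)
  have [measurable]: "h \<in> borel_measurable lborel" "k \<in> borel_measurable lborel"
    using h(1) k(1) by (auto simp: represents_def)
  have "represents (a *\<^sub>R S + b *\<^sub>R T) (\<lambda>x. a * h x + b * k x)"
    unfolding represents_def
  proof (intro conjI allI impI)
    show "(\<lambda>x. a * h x + b * k x) \<in> borel_measurable lborel" by measurable
    fix \<phi> :: "'a \<Rightarrow> real" assume "schwartz \<phi>"
    then have int: "integrable lborel (\<lambda>x. h x * \<phi> x)" "integrable lborel (\<lambda>x. k x * \<phi> x)"
      and eq: "dist_apply S \<phi> = (\<integral>x. h x * \<phi> x \<partial>lborel)" "dist_apply T \<phi> = (\<integral>x. k x * \<phi> x \<partial>lborel)"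
      using h(1) k(1) by (auto simp: represents_def)
    have *: "(a * h x + b * k x) * \<phi> x = a * (h x * \<phi> x) + b * (k x * \<phi> x)" for x
      by (simp add: algebra_simps)
    show "integrable lborel (\<lambda>x. (a * h x + b * k x) * \<phi> x)"
      unfolding * using int by simp
    show "dist_apply (a *\<^sub>R S + b *\<^sub>R T) \<phi> = (\<integral>x. (a * h x + b * k x) * \<phi> x \<partial>lborel)"
      unfolding * dist_apply_lincomb eq using int by simp
  qed
  moreover have "AE x in lborel. 0 \<le> a * h x + b * k x"
    using h(2) k(2) by eventually_elim (use assms in auto)
  ultimately show ?thesis by (auto simp: nonneg_ae_def)
qed

text \<open>Two distributions representing one function agree on Schwartz functions by definition,
  and elsewhere through the dummy value 0.\<close>

lemma dist_of_eq:
  assumes "represents T h"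
  shows "dist_of h = T"
  unfolding dist_of_def
proof (rule the_equality)
  fix S assume S: "represents S h"
  have "dist_apply S \<phi> = dist_apply T \<phi>" for \<phi>
  proof (cases "schwartz \<phi>")
    case True
    then show ?thesis using S assms by (simp add: represents_def)
  next
    case False
    moreover have "tempered (dist_apply S)" "tempered (dist_apply T)" using dist_apply by auto
    ultimately show ?thesis by (simp add: tempered_def)
  qed
  then show "S = T" by (auto simp flip: dist_apply_inject)
qed (rule assms)

text \<open>From \<open>q / p = q - 1\<close> the exponents coincide. The weights in (B2) are
  therefore the dual weights that Young's inequality produces.\<close>

lemma besov_weight_conjugate:
  assumes "1 < p" "p < 2" "1 / p + 1 / q = 1" "0 < d"
  shows "besov_weight j q (- s) d = besov_weight j p s d powr (- (q / p))"
proof -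
  have q: "2 < q" by (rule conjugate_exponent_gt_two) fact+
  have "q / p = q * (1 - 1 / q)" using assms(3) by (metis add_diff_cancel_right' mult.right_neutral times_divide_eq_right)
  then have qp: "q / p = q - 1" using q by (simp add: right_diff_distrib)
  have "(p * x - 1) * (- (q / p)) = - (q * x) + q / p" for x
    using assms(1) by (simp add: field_simps)
  then have "(p * (s / d + 1 / 2) - 1) * (- (q / p)) = - (q * (s / d + 1 / 2)) + q / p" .
  also have "\<dots> = q * (- s / d + 1 / 2) - 1"
    unfolding qp by (simp add: algebra_simps)
  finally have "real_of_int j * d * (p * (s / d + 1 / 2) - 1) * (- (q / p)) =
      real_of_int j * d * (q * (- s / d + 1 / 2) - 1)" by (simp only: mult.assoc)
  then show ?thesis by (simp add: besov_weight_def powr_powr)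
qed

text \<open>The feasible competitor \<open>g\<close> has a finite objective, so the minimiser is
  itself non-negative. On the segment between them the constraint term vanishes by convexity, and
  the extended real comparison becomes a real one.\<close>

lemma tikhonov_minimiser:
  fixes Au :: "'a::euclidean_space tempered_dist \<Rightarrow> nat \<Rightarrow> 'v::real_inner"
  assumes min: "is_arg_min (tikhonov R N Au y \<alpha>) (\<lambda>f. f \<in> X) f"
    and g: "g \<in> X" "nonneg_ae g"
    and X: "\<And>f g a b. f \<in> X \<Longrightarrow> g \<in> X \<Longrightarrow> a *\<^sub>R f + b *\<^sub>R g \<in> X"
  shows "f \<in> X"
    and "\<And>t. 0 < t \<Longrightarrow> t < 1 \<Longrightarrow> 1 / 2 * (VN_norm N (\<lambda>n. Au f n - y n))\<^sup>2 + \<alpha> * R f \<le>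
      1 / 2 * (VN_norm N (\<lambda>n. Au (f + t *\<^sub>R (g - f)) n - y n))\<^sup>2 + \<alpha> * R (f + t *\<^sub>R (g - f))"
proof -
  show f: "f \<in> X" using min by (simp add: is_arg_min_def)
  have le: "tikhonov R N Au y \<alpha> f \<le> tikhonov R N Au y \<alpha> h" if "h \<in> X" for h
    using min that by (auto simp: is_arg_min_def not_less)
  have "tikhonov R N Au y \<alpha> g < \<infinity>" using g by (simp add: tikhonov_def iota_plus_def)
  then have "tikhonov R N Au y \<alpha> f < \<infinity>" using le[OF g(1)] by (rule le_less_trans[rotated])
  then have nf: "nonneg_ae f" by (auto simp: tikhonov_def iota_plus_def split: if_splits)
  fix t :: real assume t: "0 < t" "t < 1"
  have eq: "f + t *\<^sub>R (g - f) = (1 - t) *\<^sub>R f + t *\<^sub>R g" by (simp add: algebra_simps)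
  have "f + t *\<^sub>R (g - f) \<in> X" unfolding eq by (intro X f g)
  moreover have "nonneg_ae (f + t *\<^sub>R (g - f))" unfolding eq using t by (intro nonneg_ae_convex nf g) auto
  ultimately show "1 / 2 * (VN_norm N (\<lambda>n. Au f n - y n))\<^sup>2 + \<alpha> * R f \<le>
      1 / 2 * (VN_norm N (\<lambda>n. Au (f + t *\<^sub>R (g - f)) n - y n))\<^sup>2 + \<alpha> * R (f + t *\<^sub>R (g - f))"
    using le[of "f + t *\<^sub>R (g - f)"] nf by (simp add: tikhonov_def iota_plus_def)
qed

section \<open>Convergence rates\<close>

text \<open>With \<open>k = \<delta> / \<alpha>\<close>, the variable \<open>y\<close> is the value at a wavelet of the random functional \<open>\<eta> / \<alpha>\<close>, and
  \<open>G\<close> is the image of that wavelet under the forward operator.\<close>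

lemma (in prob_space) residual_moment_bound:
  fixes u :: "nat \<Rightarrow> 'a \<Rightarrow> 'u::euclidean_space" and eps :: "nat \<Rightarrow> 'a \<Rightarrow> 'v::real_inner"
  assumes r: "0 \<le> r" and \<Sigma>\<^sub>0: "0 \<le> \<Sigma>\<^sub>0"
    and u: "iid_with_law M (restrict_space borel U) u \<mu>"
    and eps: "iid_with_law M borel eps \<nu>" and \<nu>: "noise_law \<nu> \<Sigma>\<^sub>0"
    and ind: "indep_sequences M (restrict_space borel U) u borel eps"
    and G: "continuous_on U G" "\<And>x. x \<in> U \<Longrightarrow> norm (G x) \<le> g" and g: "0 \<le> g"
    and w: "continuous_on U w" "\<And>x. x \<in> U \<Longrightarrow> norm (w x) \<le> W" and W: "0 < W"
    and N: "0 < N" and k: "0 \<le> k"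
  defines "y \<equiv> \<lambda>\<omega>. k * ((\<Sum>n<N. eps n \<omega> \<bullet> G (u n \<omega>)) / real N) +
    (\<Sum>n<N. G (u n \<omega>) \<bullet> w (u n \<omega>) - (\<integral>x. G x \<bullet> w x \<partial>\<mu>)) / real N"
  shows "y \<in> borel_measurable M"
    and "(\<integral>\<^sup>+\<omega>. ennreal (\<bar>y \<omega>\<bar> powr r) \<partial>M) \<le>
      ennreal (2 * 2 powr r * moment_constant r * (max 1 \<Sigma>\<^sub>0 + 2 * W) powr r * (g * ((k + 1) / sqrt (real N))) powr r)"
proof -
  have um [measurable]: "u n \<in> M \<rightarrow>\<^sub>M restrict_space borel U" for n
    using iid_with_lawD[OF prob_space_axioms u] by simp
  have em: "eps n \<in> borel_measurable M" for n using iid_with_lawD[OF prob_space_axioms eps] by simp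
  have uU: "u n \<omega> \<in> U" if "\<omega> \<in> space M" for n \<omega>
    using measurable_space[OF um that] by (simp add: space_restrict_space)
  define S1 where "S1 \<omega> = (\<Sum>n<N. eps n \<omega> \<bullet> G (u n \<omega>))" for \<omega>
  define F where "F x = G x \<bullet> w x" for x
  define S2 where "S2 \<omega> = (\<Sum>n<N. F (u n \<omega>) - (\<integral>x. F x \<partial>\<mu>))" for \<omega>
  have y: "y \<omega> = k / real N * S1 \<omega> + 1 / real N * S2 \<omega>" for \<omega>
    by (simp add: y_def S1_def S2_def F_def)
  have F [measurable]: "F \<in> borel_measurable (restrict_space borel U)"
    unfolding F_def by (intro borel_measurable_continuous_on_restrict continuous_intros G w)
  have [measurable]: "S1 \<in> borel_measurable M"
    unfolding S1_def by (intro borel_measurable_sum borel_measurable_inner_continuous_on[OF G(1) um em])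
  have [measurable]: "S2 \<in> borel_measurable M" unfolding S2_def by measurable
  show "y \<in> borel_measurable M" unfolding y[abs_def] by measurable
  define m where "m = moment_constant r"
  define b where "b = max 1 \<Sigma>\<^sub>0"
  define B where "B = b + 2 * W"
  define \<tau> where "\<tau> = (k + 1) / sqrt (real N)"
  have b: "1 \<le> b" by (simp add: b_def)
  have m: "0 < m" by (simp add: m_def moment_constant_pos)
  have sN: "sqrt (real N) / real N = 1 / sqrt (real N)" using N by (simp add: frac_eq_eq)
  show "(\<integral>\<^sup>+\<omega>. ennreal (\<bar>y \<omega>\<bar> powr r) \<partial>M) \<le>
      ennreal (2 * 2 powr r * moment_constant r * (max 1 \<Sigma>\<^sub>0 + 2 * W) powr r * (g * ((k + 1) / sqrt (real N))) powr r)"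
  \<comment> \<open>The moment bounds need a positive scale. If \<open>g = 0\<close>, then
    \<open>G\<close> vanishes on \<open>U\<close>, where both the sample points and the law \<mu>
    live, so all sums are 0.\<close>
  proof (cases "g = 0")
    case True
    then have "G x = 0" if "x \<in> U" for x using G(2)[OF that] by simp
    moreover have "space \<mu> = U"
      using iid_with_lawD(2)[OF prob_space_axioms u, of 0, symmetric] by (simp add: space_restrict_space)
    ultimately have "S1 \<omega> = 0" "S2 \<omega> = 0" if "\<omega> \<in> space M" for \<omega>
      using uU[OF that] by (auto simp: S1_def S2_def F_def cong: Bochner_Integration.integral_cong)
    then have "(\<integral>\<^sup>+\<omega>. ennreal (\<bar>y \<omega>\<bar> powr r) \<partial>M) = (\<integral>\<^sup>+\<omega>. 0 \<partial>M)"
      by (intro nn_integral_cong) (simp add: y)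
    then show ?thesis by simp
  next
    case False
    with g have g: "0 < g" by simp
    have E1: "(\<integral>\<^sup>+\<omega>. ennreal (\<bar>S1 \<omega>\<bar> powr r) \<partial>M) \<le> ennreal (m * (b * g * sqrt (real N)) powr r)"
      unfolding S1_def m_def b_def by (rule noise_moment_bound[OF r \<Sigma>\<^sub>0 u eps \<nu> ind G g N])
    have Fb: "\<bar>F x\<bar> \<le> g * W" if "x \<in> space (restrict_space borel U)" for x
    proof -
      have "x \<in> U" using that by (simp add: space_restrict_space)
      then have "norm (G x) * norm (w x) \<le> g * W" using G w g by (intro mult_mono) auto
      then show ?thesis using Cauchy_Schwarz_ineq2[of "G x" "w x"] by (simp add: F_def)
    qed
    have E2: "(\<integral>\<^sup>+\<omega>. ennreal (\<bar>S2 \<omega>\<bar> powr r) \<partial>M) \<le> ennreal (m * (2 * (g * W) * sqrt (real N)) powr r)"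
      unfolding S2_def m_def using g W by (intro sampling_moment_bound[OF r u F Fb _ N]) auto
    have pt: "\<bar>y \<omega>\<bar> powr r \<le> 2 powr r * ((k / real N) powr r * \<bar>S1 \<omega>\<bar> powr r + (1 / real N) powr r * \<bar>S2 \<omega>\<bar> powr r)" for \<omega>
      using abs_add_powr_le[OF r, of "k / real N * S1 \<omega>" "1 / real N * S2 \<omega>"] k
      unfolding y by (simp add: abs_mult powr_mult powr_divide)
    have "(\<integral>\<^sup>+\<omega>. ennreal (\<bar>y \<omega>\<bar> powr r) \<partial>M) \<le> (\<integral>\<^sup>+\<omega>. ennreal (2 powr r) *
        (ennreal ((k / real N) powr r) * ennreal (\<bar>S1 \<omega>\<bar> powr r) + ennreal ((1 / real N) powr r) * ennreal (\<bar>S2 \<omega>\<bar> powr r)) \<partial>M)"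
    proof (rule nn_integral_mono)
      show "ennreal (\<bar>y \<omega>\<bar> powr r) \<le> ennreal (2 powr r) *
        (ennreal ((k / real N) powr r) * ennreal (\<bar>S1 \<omega>\<bar> powr r) + ennreal ((1 / real N) powr r) * ennreal (\<bar>S2 \<omega>\<bar> powr r))" for \<omega>
        using ennreal_leI[OF pt[of \<omega>]] by (simp add: ennreal_mult ennreal_plus)
    qed
    also have "\<dots> = ennreal (2 powr r) * (ennreal ((k / real N) powr r) * (\<integral>\<^sup>+\<omega>. ennreal (\<bar>S1 \<omega>\<bar> powr r) \<partial>M) +
        ennreal ((1 / real N) powr r) * (\<integral>\<^sup>+\<omega>. ennreal (\<bar>S2 \<omega>\<bar> powr r) \<partial>M))"
      by (simp add: nn_integral_cmult nn_integral_add)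
    also have "\<dots> \<le> ennreal (2 powr r) * (ennreal ((k / real N) powr r) * ennreal (m * (b * g * sqrt (real N)) powr r) +
        ennreal ((1 / real N) powr r) * ennreal (m * (2 * (g * W) * sqrt (real N)) powr r))"
      by (intro mult_left_mono add_mono E1 E2) auto
    also have "\<dots> = ennreal (2 powr r * (m * (k / real N * (b * g * sqrt (real N))) powr r +
        m * (1 / real N * (2 * (g * W) * sqrt (real N))) powr r))"
      unfolding powr_mult[of "k / real N"] powr_mult[of "1 / real N"]
      using m by (simp add: ennreal_mult[symmetric] ennreal_plus[symmetric] mult_ac del: ennreal_plus)
    \<comment> \<open>Averaging turns \<open>sqrt (real N)\<close> into its inverse; the noise
      factor \<open>b * k\<close> and the sampling factor \<open>2 * W\<close> are both at most
      \<open>B * (k + 1)\<close>.\<close>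
    also have "\<dots> \<le> ennreal (2 powr r * (m * (B * (g * \<tau>)) powr r + m * (B * (g * \<tau>)) powr r))"
    proof (intro ennreal_leI mult_left_mono add_mono powr_mono2 r)
      have "k / real N * (b * g * sqrt (real N)) = b * (g * (k * (sqrt (real N) / real N)))" by simp
      also have "\<dots> \<le> B * (g * \<tau>)"
        unfolding sN using b W g k N
        by (intro mult_mono mult_nonneg_nonneg) (auto simp: B_def \<tau>_def divide_right_mono)
      finally show "k / real N * (b * g * sqrt (real N)) \<le> B * (g * \<tau>)" .
      have "1 / real N * (2 * (g * W) * sqrt (real N)) = 2 * W * (g * (sqrt (real N) / real N))" by simp
      also have "\<dots> \<le> B * (g * \<tau>)"
        unfolding sN using b W g k N
        by (intro mult_mono mult_nonneg_nonneg) (auto simp: B_def \<tau>_def divide_right_mono)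
      finally show "1 / real N * (2 * (g * W) * sqrt (real N)) \<le> B * (g * \<tau>)" .
    qed (use b m g k W in auto)
    also have "2 powr r * (m * (B * (g * \<tau>)) powr r + m * (B * (g * \<tau>)) powr r) =
        2 * 2 powr r * m * B powr r * (g * \<tau>) powr r"
      by (simp add: powr_mult)
    finally show ?thesis by (simp add: m_def B_def b_def \<tau>_def)
  qed
qed

text \<open>Since \<open>t ^ 3\<close> is \<open>\<delta>\<^sup>2 / real N\<close>, the noise level
  satisfies \<open>\<delta> / sqrt (real N) = t * sqrt t\<close>, and division by \<alpha> of order
  \<open>t\<close> leaves \<open>sqrt t\<close>. The lower bound on \<open>\<delta> * real N\<close>
  gives \<open>1 / real N \<le> t\<close>, which controls the sampling part.\<close>

lemma rate_large_noise:
  fixes \<delta> \<alpha> c :: real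
  assumes N: "0 < N" and \<delta>: "0 < \<delta>" "1 \<le> \<delta> * real N" and c: "0 < c"
    and t: "t = (\<delta>\<^sup>2 / real N) powr (1 / 3)" and \<alpha>: "c * t \<le> \<alpha>"
  shows "(\<delta> / \<alpha> + 1) / sqrt (real N) \<le> (1 / c + 1) * sqrt t"
proof -
  have t0: "0 < t" unfolding t using N \<delta> by simp
  have t3: "t ^ 3 = \<delta>\<^sup>2 / real N" unfolding t using N \<delta> by (simp flip: powr_numeral add: powr_powr)
  have "\<delta> / sqrt (real N) = sqrt (t ^ 3)" unfolding t3 using \<delta> by (simp add: real_sqrt_divide)
  also have "\<dots> = t * sqrt t" using t0 by (simp add: power3_eq_cube real_sqrt_mult)
  finally have \<delta>N: "\<delta> / sqrt (real N) = t * sqrt t" .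
  have \<alpha>0: "0 < \<alpha>" using mult_pos_pos[OF c t0] \<alpha> by linarith
  have "\<delta> / \<alpha> / sqrt (real N) = \<delta> / sqrt (real N) / \<alpha>" by (simp add: mult.commute)
  also have "\<dots> = t * sqrt t / \<alpha>" unfolding \<delta>N ..
  also have "\<dots> \<le> t * sqrt t / (c * t)" using t0 c \<alpha> \<alpha>0 by (intro divide_left_mono) auto
  also have "\<dots> = 1 / c * sqrt t" using t0 by simp
  finally have 1: "\<delta> / \<alpha> / sqrt (real N) \<le> 1 / c * sqrt t" .
  have "(1 / real N) ^ 3 * (\<delta> * real N)\<^sup>2 = \<delta>\<^sup>2 / real N" using N by (simp add: power2_eq_square power3_eq_cube)
  moreover have "(1 / real N) ^ 3 * 1 \<le> (1 / real N) ^ 3 * (\<delta> * real N)\<^sup>2"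
    using \<delta>(2) by (intro mult_left_mono) auto
  ultimately have "(1 / real N) ^ 3 \<le> t ^ 3" unfolding t3 by simp
  then have "1 / real N \<le> t" using t0 by (subst (asm) power_mono_iff) auto
  from real_sqrt_le_mono[OF this] have "1 / sqrt (real N) \<le> sqrt t" by (simp add: real_sqrt_divide)
  with 1 show ?thesis by (simp add: add_divide_distrib distrib_right)
qed

text \<open>Here \<open>\<delta> / \<alpha>\<close> is at most \<open>\<delta> * real N / c\<close>,
  hence bounded, and only the factor \<open>1 / sqrt (real N)\<close> remains.\<close>

lemma rate_small_noise:
  fixes \<delta> \<alpha> c B :: real
  assumes N: "0 < N" and \<delta>: "0 < \<delta>" "\<delta> * real N \<le> B" and c: "0 < c" and \<alpha>: "c / real N \<le> \<alpha>"
  shows "(\<delta> / \<alpha> + 1) / sqrt (real N) \<le> (\<bar>B\<bar> / c + 1) * sqrt (1 / real N)"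
proof -
  have "0 < c / real N" using c N by simp
  then have "0 < \<alpha>" using \<alpha> by linarith
  have "\<delta> / \<alpha> \<le> \<delta> / (c / real N)"
    using \<delta> \<alpha> \<open>0 < \<alpha>\<close> \<open>0 < c / real N\<close> by (intro divide_left_mono mult_pos_pos) auto
  also have "\<dots> \<le> \<bar>B\<bar> / c" using \<delta> c by (simp add: divide_right_mono)
  finally have "\<delta> / \<alpha> + 1 \<le> \<bar>B\<bar> / c + 1" by simp
  then have "(\<delta> / \<alpha> + 1) / sqrt (real N) \<le> (\<bar>B\<bar> / c + 1) / sqrt (real N)" by (intro divide_right_mono) auto
  then show ?thesis by (simp add: real_sqrt_divide)
qed

text \<open>The constant is obtained before \<open>N\<close>, \<open>d\<close>,
  \<open>\<alpha>\<close> and the selection \<open>fm\<close>, so it is uniform in all of them. The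
  function \<open>fm\<close> enters only through a bound valid for each outcome, whose right side is
  measurable in terms of the sample.\<close>

lemma (in weighted_coordinates) expected_bregman_bound:
  fixes L :: "'x \<Rightarrow> 'u::euclidean_space \<Rightarrow> 'v::real_inner" and u :: "nat \<Rightarrow> 'w \<Rightarrow> 'u" and q \<Sigma>\<^sub>0 W :: real
  assumes q: "1 / p + 1 / q = 1" and M: "prob_space M" and \<Sigma>\<^sub>0: "0 \<le> \<Sigma>\<^sub>0"
    and u: "iid_with_law M (restrict_space borel U) u \<mu>"
    and eps: "iid_with_law M borel eps \<nu>" and \<nu>: "noise_law \<nu> \<Sigma>\<^sub>0"
    and ind: "indep_sequences M (restrict_space borel U) u borel eps"
    and lin: "\<And>f g a b x. f \<in> X \<Longrightarrow> g \<in> X \<Longrightarrow> x \<in> U \<Longrightarrow> L (a *\<^sub>R f + b *\<^sub>R g) x = a *\<^sub>R L f x + b *\<^sub>R L g x"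
    and cont: "\<And>f. f \<in> X \<Longrightarrow> continuous_on U (L f)"
    and bound: "\<And>f x. f \<in> X \<Longrightarrow> x \<in> U \<Longrightarrow> norm (L f x) \<le> coord_norm f"
    and w: "continuous_on U w" "\<And>x. x \<in> U \<Longrightarrow> norm (w x) \<le> W" and W: "0 < W"
    and g: "g \<in> X" and source: "\<And>h. h \<in> X \<Longrightarrow> grad penalty g h = (\<integral>x. L h x \<bullet> w x \<partial>\<mu>)"
    and T: "\<And>i. T i \<in> X" "\<And>i j. cf (T i) j = (if i = j then 1 else 0)"
    and G: "\<And>i. 0 \<le> G i" "\<And>i x. x \<in> U \<Longrightarrow> norm (L (T i) x) \<le> G i"
    and summable_G: "summable (\<lambda>i. c i powr (- (q / p)) * G i powr q)"
  obtains C where "0 < C"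
    "\<And>N d \<alpha> fm. 0 < N \<Longrightarrow> 0 < d \<Longrightarrow> 0 < \<alpha> \<Longrightarrow>
      (\<And>\<omega>. \<omega> \<in> space M \<Longrightarrow> fm \<omega> \<in> X) \<Longrightarrow>
      (\<And>\<omega> t. \<omega> \<in> space M \<Longrightarrow> 0 < t \<Longrightarrow> t < 1 \<Longrightarrow>
        1 / 2 * (VN_norm N (\<lambda>n. L (fm \<omega>) (u n \<omega>) - (L g (u n \<omega>) + d *\<^sub>R eps n \<omega>)))\<^sup>2 + \<alpha> * penalty (fm \<omega>) \<le>
        1 / 2 * (VN_norm N (\<lambda>n. L (fm \<omega> + t *\<^sub>R (g - fm \<omega>)) (u n \<omega>) - (L g (u n \<omega>) + d *\<^sub>R eps n \<omega>)))\<^sup>2 +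
          \<alpha> * penalty (fm \<omega> + t *\<^sub>R (g - fm \<omega>))) \<Longrightarrow>
      (\<integral>\<^sup>+\<omega>. ennreal (bregman penalty (fm \<omega>) g) \<partial>M) \<le>
        ennreal (C * (\<alpha> + ((d / \<alpha> + 1) / sqrt (real N)) powr q + ((d / \<alpha> + 1) / sqrt (real N))\<^sup>2))"
proof -
  interpret M: prob_space M by fact
  have q2: "2 < q" by (rule conjugate_exponent_gt_two[OF p q])
  have law: "distr M (restrict_space borel U) (u n) = \<mu>" for n using iid_with_lawD[OF M u] by simp
  have um: "u n \<in> M \<rightarrow>\<^sub>M restrict_space borel U" for n using iid_with_lawD[OF M u] by simp
  have uU: "u n \<omega> \<in> U" if "\<omega> \<in> space M" for n \<omega>
    using measurable_space[OF um that] by (simp add: space_restrict_space)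
  interpret \<mu>: prob_space \<mu> using M.prob_space_distr[OF um[of 0]] by (simp add: law)
  have sets_\<mu> [measurable_cong]: "sets \<mu> = sets (restrict_space borel U)" unfolding law[of 0, symmetric] by simp
  have space_\<mu>: "space \<mu> = U" unfolding law[of 0, symmetric] by (simp add: space_restrict_space)
  have Lw_bound: "\<bar>L f x \<bullet> w x\<bar> \<le> coord_norm f * W" if "f \<in> X" "x \<in> U" for f x
  proof -
    have "norm (L f x) * norm (w x) \<le> coord_norm f * W"
      using that bound w W order_trans[OF norm_ge_zero bound[OF that]] by (intro mult_mono) auto
    then show ?thesis using Cauchy_Schwarz_ineq2[of "L f x" "w x"] by simp
  qed
  have Lw_int: "integrable \<mu> (\<lambda>x. L f x \<bullet> w x)" if "f \<in> X" for f
  proof (rule \<mu>.integrable_const_bound)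
    show "AE x in \<mu>. norm (L f x \<bullet> w x) \<le> coord_norm f * W"
      using Lw_bound[OF that] by (intro AE_I2) (simp add: space_\<mu>)
    have "(\<lambda>x. L f x \<bullet> w x) \<in> borel_measurable (restrict_space borel U)"
      by (intro borel_measurable_continuous_on_restrict continuous_intros cont that w)
    then show "(\<lambda>x. L f x \<bullet> w x) \<in> borel_measurable \<mu>" by (simp add: measurable_cong_sets[OF sets_\<mu> refl])
  qed
  have Lw_int_bound: "\<bar>\<integral>x. L f x \<bullet> w x \<partial>\<mu>\<bar> \<le> coord_norm f * W" if "f \<in> X" for f
  proof -
    have "\<bar>\<integral>x. L f x \<bullet> w x \<partial>\<mu>\<bar> \<le> (\<integral>x. \<bar>L f x \<bullet> w x\<bar> \<partial>\<mu>)" by (rule integral_abs_bound)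
    also have "\<dots> \<le> (\<integral>x. coord_norm f * W \<partial>\<mu>)"
      using Lw_bound[OF that] by (intro integral_mono integrable_abs Lw_int that) (auto simp: space_\<mu>)
    finally show ?thesis by (simp add: \<mu>.prob_space)
  qed
  obtain C\<^sub>0 where C\<^sub>0: "0 < C\<^sub>0"
    "\<And>a b y k. 0 < k \<Longrightarrow> \<bar>(a - b) * y\<bar> \<le> k / 2 * ((spow (p - 1) a - spow (p - 1) b) * (a - b)) +
       C\<^sub>0 * (k powr (- (q / p)) * \<bar>y\<bar> powr q + y\<^sup>2 * \<bar>b\<bar> powr (2 - p) / k)"
    using spow_duality_bound[OF p q] by blast
  define k where "k i = c i powr (- (q / p))" for i
  define m where "m i = \<bar>cf g i\<bar> powr (2 - p) / c i" for i
  define K where "K r = 2 * 2 powr r * moment_constant r * (max 1 \<Sigma>\<^sub>0 + 2 * W) powr r" for r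
  have K: "0 < K r" for r using W by (simp add: K_def moment_constant_pos)
  have km: "0 \<le> k i" "0 \<le> m i" for i by (simp_all add: k_def m_def)
  \<comment> \<open>A summable majorant for both \<open>k i * G i powr q\<close> and
    \<open>m i * (G i)\<^sup>2\<close>, the latter by \<open>weighted_product_bound\<close>; it
    depends only on the operator and on the truth.\<close>
  define s where "s i = 2 * (k i * G i powr q) + c i * \<bar>cf g i\<bar> powr p" for i
  have s: "0 \<le> s i" for i by (simp add: s_def km)
  have ss: "summable s"
    unfolding s_def using summable_G by (intro summable_add summable_mult summable_powr g) (simp add: k_def)
  have ms: "m i * (G i)\<^sup>2 \<le> s i - k i * G i powr q" for i
    using weighted_product_bound[OF p q c_pos G(1), of i "cf g i" i] by (simp add: m_def s_def k_def mult_ac)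
  have ks: "k i * G i powr q \<le> s i" for i using km[of i] by (simp add: s_def add_increasing2)
  define C where "C = W\<^sup>2 / 2 + 2 * C\<^sub>0 * ((K q + K 2) * suminf s) + 1"
  have S0: "0 \<le> suminf s" by (rule suminf_nonneg[OF ss s])
  show thesis
  proof (rule that[of C])
    show "0 < C" using C\<^sub>0(1) K[of q] K[of 2] S0 by (auto simp: C_def intro!: add_nonneg_pos)
    fix N :: nat and d \<alpha> :: real and fm
    assume N: "0 < N" and d: "0 < d" and \<alpha>: "0 < \<alpha>" and fm: "\<And>\<omega>. \<omega> \<in> space M \<Longrightarrow> fm \<omega> \<in> X"
      and min: "\<And>\<omega> t. \<omega> \<in> space M \<Longrightarrow> 0 < t \<Longrightarrow> t < 1 \<Longrightarrow>
        1 / 2 * (VN_norm N (\<lambda>n. L (fm \<omega>) (u n \<omega>) - (L g (u n \<omega>) + d *\<^sub>R eps n \<omega>)))\<^sup>2 + \<alpha> * penalty (fm \<omega>) \<le>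
        1 / 2 * (VN_norm N (\<lambda>n. L (fm \<omega> + t *\<^sub>R (g - fm \<omega>)) (u n \<omega>) - (L g (u n \<omega>) + d *\<^sub>R eps n \<omega>)))\<^sup>2 +
          \<alpha> * penalty (fm \<omega> + t *\<^sub>R (g - fm \<omega>))"
    define \<tau> where "\<tau> = (d / \<alpha> + 1) / sqrt (real N)"
    have \<tau>: "0 < \<tau>" using d \<alpha> N by (simp add: \<tau>_def add_pos_pos)
    define Y where "Y i \<omega> = d / \<alpha> * ((\<Sum>n<N. eps n \<omega> \<bullet> L (T i) (u n \<omega>)) / real N) +
      (\<Sum>n<N. L (T i) (u n \<omega>) \<bullet> w (u n \<omega>) - (\<integral>x. L (T i) x \<bullet> w x \<partial>\<mu>)) / real N" for i \<omega>
    have pathwise: "ennreal (bregman penalty (fm \<omega>) g) \<le> ennreal (\<alpha> * W\<^sup>2 / 2) +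
        ennreal (2 * C\<^sub>0) * (\<Sum>i. ennreal (k i * \<bar>Y i \<omega>\<bar> powr q + m i * (Y i \<omega>)\<^sup>2))" if \<omega>: "\<omega> \<in> space M" for \<omega>
    proof -
      define A where "A f n = L f (u n \<omega>)" for f n
      have A_lin: "A (a *\<^sub>R f + b *\<^sub>R h) n = a *\<^sub>R A f n + b *\<^sub>R A h n" if "f \<in> X" "h \<in> X" for f h a b n
        unfolding A_def by (rule lin[OF that uU[OF \<omega>]])
      define e where "e n = eps n \<omega>" for n
      define v where "v n = w (u n \<omega>)" for n
      have v: "norm (v n) \<le> W" for n unfolding v_def by (rule w(2)[OF uU[OF \<omega>]])
      \<comment> \<open>Noise minus \<alpha> times the gap between the population and the empirical
        pairing with the source element; the population pairing is the gradient at \<open>g\<close>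
        by the source condition.\<close>
      define \<eta> where "\<eta> h = d * VN_inner N e (A h) - \<alpha> * ((\<integral>x. L h x \<bullet> w x \<partial>\<mu>) - VN_inner N v (A h))" for h
      have VN_lin: "VN_inner N a (A (r *\<^sub>R f + t *\<^sub>R h)) = r * VN_inner N a (A f) + t * VN_inner N a (A h)"
        if "f \<in> X" "h \<in> X" for a r t f h
        using A_lin[OF that]
        by (simp add: VN_inner_def inner_add_right sum.distrib sum_distrib_left add_divide_distrib)
      have int_lin: "(\<integral>x. L (r *\<^sub>R f + t *\<^sub>R h) x \<bullet> w x \<partial>\<mu>) = r * (\<integral>x. L f x \<bullet> w x \<partial>\<mu>) + t * (\<integral>x. L h x \<bullet> w x \<partial>\<mu>)"
        if "f \<in> X" "h \<in> X" for r t f h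
      proof -
        have "(\<integral>x. L (r *\<^sub>R f + t *\<^sub>R h) x \<bullet> w x \<partial>\<mu>) = (\<integral>x. r * (L f x \<bullet> w x) + t * (L h x \<bullet> w x) \<partial>\<mu>)"
          using that by (intro Bochner_Integration.integral_cong) (auto simp: space_\<mu> lin inner_add_left)
        then show ?thesis using Lw_int that by simp
      qed
      have VN_bound: "\<bar>VN_inner N a (A f)\<bar> \<le> (\<Sum>n<N. norm (a n)) / real N * coord_norm f" if "f \<in> X" for a f
      proof -
        have "\<bar>\<Sum>n<N. a n \<bullet> A f n\<bar> \<le> (\<Sum>n<N. \<bar>a n \<bullet> A f n\<bar>)" by (rule sum_abs)
        also have "\<dots> \<le> (\<Sum>n<N. norm (a n) * coord_norm f)"
        proof (rule sum_mono)
          fix n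
          have "norm (A f n) \<le> coord_norm f" unfolding A_def by (rule bound[OF that uU[OF \<omega>]])
          from mult_left_mono[OF this norm_ge_zero[of "a n"]] Cauchy_Schwarz_ineq2[of "a n" "A f n"]
          show "\<bar>a n \<bullet> A f n\<bar> \<le> norm (a n) * coord_norm f" by linarith
        qed
        finally have "\<bar>\<Sum>n<N. a n \<bullet> A f n\<bar> / real N \<le> (\<Sum>n<N. norm (a n) * coord_norm f) / real N"
          by (rule divide_right_mono) simp
        then show ?thesis by (simp add: VN_inner_def sum_distrib_right)
      qed
      \<comment> \<open>This constant depends on the outcome and on \<open>N\<close>. It serves only
        the convergence of the expansion for the fixed outcome and does not enter the final
        bound.\<close>
      define K' where "K' = d * ((\<Sum>n<N. norm (e n)) / real N) + \<alpha> * (W + (\<Sum>n<N. norm (v n)) / real N)"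
      have \<eta>_bound: "\<bar>\<eta> f\<bar> \<le> K' * coord_norm f" if "f \<in> X" for f
      proof -
        have "\<bar>\<eta> f\<bar> \<le> d * \<bar>VN_inner N e (A f)\<bar> + \<alpha> * (\<bar>\<integral>x. L f x \<bullet> w x \<partial>\<mu>\<bar> + \<bar>VN_inner N v (A f)\<bar>)"
        proof -
          have "\<bar>x - \<alpha> * (y - z)\<bar> \<le> \<bar>x\<bar> + \<alpha> * (\<bar>y\<bar> + \<bar>z\<bar>)" for x y z :: real
          proof -
            have "\<alpha> * \<bar>y - z\<bar> \<le> \<alpha> * (\<bar>y\<bar> + \<bar>z\<bar>)" using \<alpha> by (intro mult_left_mono abs_triangle_ineq4) auto
            moreover have "\<bar>\<alpha> * (y - z)\<bar> = \<alpha> * \<bar>y - z\<bar>" using \<alpha> by (simp add: abs_mult)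
            ultimately show ?thesis using abs_triangle_ineq4[of x "\<alpha> * (y - z)"] by linarith
          qed
          from this[of "d * VN_inner N e (A f)"] show ?thesis
            unfolding \<eta>_def using d by (simp add: abs_mult)
        qed
        also have "\<dots> \<le> d * ((\<Sum>n<N. norm (e n)) / real N * coord_norm f) +
            \<alpha> * (coord_norm f * W + (\<Sum>n<N. norm (v n)) / real N * coord_norm f)"
          using d \<alpha> by (intro add_mono mult_left_mono VN_bound Lw_int_bound that) auto
        also have "\<dots> = K' * coord_norm f" by (simp add: K'_def algebra_simps)
        finally show ?thesis .
      qed
      have "(\<lambda>i. cf (fm \<omega> - g) i * \<eta> (T i)) sums \<eta> (fm \<omega> - g)"
      proof (rule coordinate_expansion[OF T _ \<eta>_bound diff_mem[OF fm[OF \<omega>] g]])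
        show "\<eta> (a *\<^sub>R f + b *\<^sub>R h) = a * \<eta> f + b * \<eta> h" if "f \<in> X" "h \<in> X" for f h a b
          using that by (simp add: \<eta>_def VN_lin int_lin algebra_simps)
      qed
      moreover have "\<eta> (T i) = \<alpha> * Y i \<omega>" for i
        using \<alpha> N by (simp add: \<eta>_def Y_def VN_inner_def A_def e_def v_def sum_subtractf inner_commute
            diff_divide_distrib algebra_simps)
      ultimately have "(\<lambda>i. (cf (fm \<omega>) i - cf g i) * (\<alpha> * Y i \<omega>)) sums \<eta> (fm \<omega> - g)"
        by (simp add: cf_diff fm[OF \<omega>] g)
      moreover have "\<alpha> * bregman penalty (fm \<omega>) g \<le> \<alpha>\<^sup>2 * W\<^sup>2 / 4 + \<eta> (fm \<omega> - g)"
        using bregman_le_residual[OF fm[OF \<omega>] g \<alpha> N A_lin min[OF \<omega>, folded A_def e_def] v]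
        unfolding \<eta>_def source[OF diff_mem[OF fm[OF \<omega>] g]] .
      ultimately show ?thesis
        using bregman_le_dual_series[OF fm[OF \<omega>] g \<alpha> C\<^sub>0] by (simp add: k_def m_def mult_ac)
    qed
    have k0: "0 \<le> d / \<alpha>" using d \<alpha> by simp
    have Y_meas [measurable]: "Y i \<in> borel_measurable M" for i
      unfolding Y_def[abs_def]
      by (rule M.residual_moment_bound(1)[OF order_refl \<Sigma>\<^sub>0 u eps \<nu> ind cont[OF T(1)] G(2) G(1) w W N k0])
    have Y_bound: "(\<integral>\<^sup>+\<omega>. ennreal (\<bar>Y i \<omega>\<bar> powr r) \<partial>M) \<le> ennreal (K r * (G i * \<tau>) powr r)" if "0 \<le> r" for i r
      unfolding K_def \<tau>_def Y_def
      by (rule M.residual_moment_bound(2)[OF that \<Sigma>\<^sub>0 u eps \<nu> ind cont[OF T(1)] G(2) G(1) w W N k0])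
    have coordinate: "(\<integral>\<^sup>+\<omega>. ennreal (k i * \<bar>Y i \<omega>\<bar> powr q + m i * (Y i \<omega>)\<^sup>2) \<partial>M) \<le>
        ennreal ((K q + K 2) * (\<tau> powr q + \<tau>\<^sup>2) * s i)" for i
    proof -
      have "(\<integral>\<^sup>+\<omega>. ennreal (k i * \<bar>Y i \<omega>\<bar> powr q + m i * (Y i \<omega>)\<^sup>2) \<partial>M) =
          (\<integral>\<^sup>+\<omega>. ennreal (k i) * ennreal (\<bar>Y i \<omega>\<bar> powr q) + ennreal (m i) * ennreal (\<bar>Y i \<omega>\<bar> powr 2) \<partial>M)"
        using km by (simp add: ennreal_mult ennreal_plus)
      also have "\<dots> = ennreal (k i) * (\<integral>\<^sup>+\<omega>. ennreal (\<bar>Y i \<omega>\<bar> powr q) \<partial>M) +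
          ennreal (m i) * (\<integral>\<^sup>+\<omega>. ennreal (\<bar>Y i \<omega>\<bar> powr 2) \<partial>M)"
        by (subst nn_integral_add) (simp_all add: nn_integral_cmult)
      also have "\<dots> \<le> ennreal (k i) * ennreal (K q * (G i * \<tau>) powr q) + ennreal (m i) * ennreal (K 2 * (G i * \<tau>) powr 2)"
        using q2 by (intro add_mono mult_left_mono Y_bound) auto
      also have "\<dots> = ennreal (K q * \<tau> powr q * (k i * G i powr q) + K 2 * \<tau>\<^sup>2 * (m i * (G i)\<^sup>2))"
        using km K[of q, THEN less_imp_le] K[of 2, THEN less_imp_le] \<tau> G(1)[of i]
        by (simp add: ennreal_mult[symmetric] ennreal_plus[symmetric] powr_mult mult_ac del: ennreal_plus)
      also have "\<dots> \<le> ennreal ((K q + K 2) * (\<tau> powr q + \<tau>\<^sup>2) * s i)"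
      proof (rule ennreal_leI)
        have "K q * \<tau> powr q * (k i * G i powr q) \<le> K q * \<tau> powr q * s i"
          using ks[of i] K[of q] by (intro mult_left_mono) auto
        moreover have "m i * (G i)\<^sup>2 \<le> s i" using ms[of i] km[of i] by (smt (verit) mult_nonneg_nonneg powr_ge_zero)
        then have "K 2 * \<tau>\<^sup>2 * (m i * (G i)\<^sup>2) \<le> K 2 * \<tau>\<^sup>2 * s i"
          using K[of 2] by (intro mult_left_mono) auto
        moreover have "0 \<le> K q * \<tau>\<^sup>2 * s i" "0 \<le> K 2 * \<tau> powr q * s i"
          using K[of q] K[of 2] s[of i] by simp_all
        ultimately show "K q * \<tau> powr q * (k i * G i powr q) + K 2 * \<tau>\<^sup>2 * (m i * (G i)\<^sup>2) \<le>
            (K q + K 2) * (\<tau> powr q + \<tau>\<^sup>2) * s i" by (simp add: algebra_simps)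
      qed
      finally show ?thesis .
    qed
    \<comment> \<open>Monotonicity of the upper estimate asks for no measurability of
      \<open>fm\<close>; the exchange of sum and integral that follows concerns only the measurable
      \<open>Y i\<close>.\<close>
    have "(\<integral>\<^sup>+\<omega>. ennreal (bregman penalty (fm \<omega>) g) \<partial>M) \<le> (\<integral>\<^sup>+\<omega>. ennreal (\<alpha> * W\<^sup>2 / 2) +
        ennreal (2 * C\<^sub>0) * (\<Sum>i. ennreal (k i * \<bar>Y i \<omega>\<bar> powr q + m i * (Y i \<omega>)\<^sup>2)) \<partial>M)"
      by (rule nn_integral_mono) (rule pathwise)
    also have "\<dots> = ennreal (\<alpha> * W\<^sup>2 / 2) +
        ennreal (2 * C\<^sub>0) * (\<Sum>i. \<integral>\<^sup>+\<omega>. ennreal (k i * \<bar>Y i \<omega>\<bar> powr q + m i * (Y i \<omega>)\<^sup>2) \<partial>M)"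
      by (subst nn_integral_add) (simp_all add: nn_integral_cmult nn_integral_suminf M.emeasure_space_1)
    also have "\<dots> \<le> ennreal (\<alpha> * W\<^sup>2 / 2) + ennreal (2 * C\<^sub>0) * (\<Sum>i. ennreal ((K q + K 2) * (\<tau> powr q + \<tau>\<^sup>2) * s i))"
      by (intro add_left_mono mult_left_mono suminf_le coordinate) auto
    also have "(\<Sum>i. ennreal ((K q + K 2) * (\<tau> powr q + \<tau>\<^sup>2) * s i)) = ennreal ((K q + K 2) * (\<tau> powr q + \<tau>\<^sup>2) * suminf s)"
      using K[of q, THEN less_imp_le] K[of 2, THEN less_imp_le] s ss
      by (subst suminf_ennreal2) (auto intro!: summable_mult simp: suminf_mult)
    also have "ennreal (\<alpha> * W\<^sup>2 / 2) + ennreal (2 * C\<^sub>0) * \<dots> =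
        ennreal (\<alpha> * W\<^sup>2 / 2 + 2 * C\<^sub>0 * ((K q + K 2) * (\<tau> powr q + \<tau>\<^sup>2) * suminf s))"
      using K[of q, THEN less_imp_le] K[of 2, THEN less_imp_le] C\<^sub>0(1) S0 \<alpha>
      by (simp add: ennreal_mult[symmetric] ennreal_plus[symmetric] del: ennreal_plus)
    also have "\<dots> \<le> ennreal (C * (\<alpha> + \<tau> powr q + \<tau>\<^sup>2))"
    proof (rule ennreal_leI)
      define a where "a = W\<^sup>2 / 2"
      define b where "b = 2 * C\<^sub>0 * ((K q + K 2) * suminf s)"
      have ab: "0 \<le> a" "0 \<le> b" using C\<^sub>0(1) K[of q] K[of 2] S0 by (simp_all add: a_def b_def)
      have "\<alpha> * W\<^sup>2 / 2 + 2 * C\<^sub>0 * ((K q + K 2) * (\<tau> powr q + \<tau>\<^sup>2) * suminf s) = a * \<alpha> + b * (\<tau> powr q + \<tau>\<^sup>2)"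
        by (simp add: a_def b_def)
      also have "\<dots> \<le> C * \<alpha> + C * (\<tau> powr q + \<tau>\<^sup>2)"
        using ab \<alpha> by (intro add_mono mult_right_mono) (auto simp: C_def a_def[symmetric] b_def[symmetric])
      finally show "\<alpha> * W\<^sup>2 / 2 + 2 * C\<^sub>0 * ((K q + K 2) * (\<tau> powr q + \<tau>\<^sup>2) * suminf s) \<le> C * (\<alpha> + \<tau> powr q + \<tau>\<^sup>2)"
        by (simp add: algebra_simps)
    qed
    finally show "(\<integral>\<^sup>+\<omega>. ennreal (bregman penalty (fm \<omega>) g) \<partial>M) \<le>
        ennreal (C * (\<alpha> + ((d / \<alpha> + 1) / sqrt (real N)) powr q + ((d / \<alpha> + 1) / sqrt (real N))\<^sup>2))"
      by (simp add: \<tau>_def)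
  qed
qed

text \<open>For \<open>t \<le> 1\<close> and \<open>q > 2\<close>, the power
  \<open>(sqrt t) powr q\<close> is at most \<open>t\<close>, so the moment of order
  \<open>q\<close> costs no more than the second moment.\<close>

lemma rate_bound:
  fixes q t l :: real
  assumes "2 < q" "0 < t" "t \<le> 1" "\<alpha> \<le> c * t" "0 \<le> \<tau>" "\<tau> \<le> l * sqrt t" "0 \<le> l"
  shows "\<alpha> + \<tau> powr q + \<tau>\<^sup>2 \<le> (c + l powr q + l\<^sup>2) * t"
proof -
  have "\<tau> powr q \<le> (l * sqrt t) powr q" using assms by (intro powr_mono2) auto
  also have "\<dots> = l powr q * (sqrt t) powr q" by (rule powr_mult)
  also have "(sqrt t) powr q \<le> (sqrt t) powr 2" using assms by (intro powr_mono') auto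
  also have "(sqrt t) powr 2 = t" using assms by simp
  finally have "\<tau> powr q \<le> l powr q * t" by (simp add: mult_left_mono)
  moreover have "\<tau>\<^sup>2 \<le> l\<^sup>2 * t"
    using power_mono[OF assms(6,5), of 2] assms by (simp add: power_mult_distrib)
  ultimately show ?thesis using assms(4) by (simp add: algebra_simps)
qed

theorem theorem3p3:
  fixes p q s :: real
    and \<Phi> :: "real ^ 'd \<Rightarrow> real"
    and \<psi> :: "nat \<Rightarrow> real ^ 'd \<Rightarrow> real"
    and level :: "nat \<Rightarrow> int"
    and pair :: "(real ^ 'd) tempered_dist \<Rightarrow> nat \<Rightarrow> real"
    and X :: "(real ^ 'd) tempered_dist set"
    and normX R :: "(real ^ 'd) tempered_dist \<Rightarrow> real"
    and U :: "(real ^ 'e) set"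
    and emb :: "'z::banach \<Rightarrow> real ^ 'e \<Rightarrow> 'v::{real_inner,banach}"
    and A :: "(real ^ 'd) tempered_dist \<Rightarrow> 'z"
    and \<mu> :: "(real ^ 'e) measure"
    and M :: "'w measure"
    and u :: "nat \<Rightarrow> 'w \<Rightarrow> real ^ 'e"
    and eps :: "nat \<Rightarrow> 'w \<Rightarrow> 'v"
    and \<nu> :: "'v measure"
    and \<Sigma>\<^sub>0 :: real
    and f\<^sub>0 :: "(real ^ 'd) tempered_dist"
    and F\<^sub>\<delta> :: "nat \<Rightarrow> 'w \<Rightarrow> real \<Rightarrow> real \<Rightarrow> (real ^ 'd) tempered_dist \<Rightarrow> ereal"
  assumes p: "1 < p" "p < 2"
    and q: "1 / p + 1 / q = 1"
    and X: "X = besov_space \<Phi> s p"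
    and normX: "normX = wavelet_norm level pair s p"
    and R: "R = (\<lambda>f. (1 / p) * normX f powr p)"
    and Phi: "littlewood_paley \<Phi>"
    and wavelets: "wavelet_basis \<psi> level"
    and pairing: "wavelet_pairing \<Phi> s p \<psi> pair"
    and equivalent: "wavelet_norm_equivalent \<Phi> s p \<psi> level pair"
    and U: "U \<in> sets lebesgue"
    and Z: "function_space_embedding U emb"
    and A: "forward_operator X normX U emb A"
    and A1: "\<exists>\<kappa>\<le>1. \<forall>x\<in>U. \<forall>f\<in>X. norm (emb (A f) x) \<le> \<kappa> * normX f"
    and A2: "\<forall>f\<in>X. emb (A f) \<in> borel_measurable (restrict_space borel U)"
    and mu: "prob_space \<mu>" "sets \<mu> = sets (restrict_space borel U)"
    and M: "prob_space M"
    and u: "iid_with_law M (restrict_space borel U) u \<mu>"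
    and Sigma: "\<Sigma>\<^sub>0 > 0"
    and nu: "noise_law \<nu> \<Sigma>\<^sub>0"
    and eps: "iid_with_law M borel eps \<nu>"
    and indep: "indep_sequences M (restrict_space borel U) u borel eps"
    and truth: "f\<^sub>0 \<in> X" "nonneg_ae f\<^sub>0"
    and B1: "\<exists>w. \<forall>h\<in>X. grad R f\<^sub>0 h = adjoint_on \<mu> (\<lambda>f. emb (A f)) (emb w) h"
    and B2: "summable (\<lambda>i. besov_weight (level i) q (- s) CARD('d) *
                (sup_norm_on U (emb (A (dist_of (\<psi> i))))) powr q)"
    and functional: "\<And>N \<omega> d a. F\<^sub>\<delta> N \<omega> d a =
           tikhonov R N (\<lambda>f n. emb (A f) (u n \<omega>))
             (\<lambda>n. emb (A f\<^sub>0) (u n \<omega>) + d *\<^sub>R eps n \<omega>) a"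
  shows "(\<forall>c\<^sub>1>0. \<forall>c\<^sub>2>0. \<exists>C>0. \<forall>(\<delta> :: nat \<Rightarrow> real) (\<alpha> :: nat \<Rightarrow> real) fmin.
            (\<forall>N. \<delta> N > 0) \<longrightarrow>
            filterlim (\<lambda>N. \<delta> N * real N) at_top sequentially \<longrightarrow>
            (\<lambda>N. (\<delta> N)\<^sup>2 / real N) \<longlonglongrightarrow> 0 \<longrightarrow>
            (\<forall>\<^sub>F N in sequentially.
               c\<^sub>1 * ((\<delta> N)\<^sup>2 / real N) powr (1 / 3) \<le> \<alpha> N \<and>
               \<alpha> N \<le> c\<^sub>2 * ((\<delta> N)\<^sup>2 / real N) powr (1 / 3)) \<longrightarrow>
            (\<forall>\<^sub>F N in sequentially. \<forall>\<omega>\<in>space M.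
               is_arg_min (F\<^sub>\<delta> N \<omega> (\<delta> N) (\<alpha> N)) (\<lambda>f. f \<in> X) (fmin N \<omega>)) \<longrightarrow>
            (\<forall>\<^sub>F N in sequentially.
               (\<integral>\<^sup>+ \<omega>. ennreal (bregman R (fmin N \<omega>) f\<^sub>0) \<partial>M)
                 \<le> ennreal (C * ((\<delta> N)\<^sup>2 / real N) powr (1 / 3)))) \<and>
         (\<forall>c\<^sub>1>0. \<forall>c\<^sub>2>0. \<forall>B. \<exists>C>0. \<forall>(\<delta> :: nat \<Rightarrow> real) (\<alpha> :: nat \<Rightarrow> real) fmin.
            (\<forall>N. \<delta> N > 0) \<longrightarrow>
            (\<forall>N. \<delta> N * real N \<le> B) \<longrightarrow>
            (\<forall>\<^sub>F N in sequentially. c\<^sub>1 / real N \<le> \<alpha> N \<and> \<alpha> N \<le> c\<^sub>2 / real N) \<longrightarrow>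
            (\<forall>\<^sub>F N in sequentially. \<forall>\<omega>\<in>space M.
               is_arg_min (F\<^sub>\<delta> N \<omega> (\<delta> N) (\<alpha> N)) (\<lambda>f. f \<in> X) (fmin N \<omega>)) \<longrightarrow>
            (\<forall>\<^sub>F N in sequentially.
               (\<integral>\<^sup>+ \<omega>. ennreal (bregman R (fmin N \<omega>) f\<^sub>0) \<partial>M) \<le> ennreal (C / real N)))"
proof -
  interpret wc: weighted_coordinates X pair "\<lambda>i. besov_weight (level i) p s CARD('d)" p
  proof
    show "1 < p" "p < 2" by fact+
    show "a *\<^sub>R f + b *\<^sub>R g \<in> X" if "f \<in> X" "g \<in> X" for f g a b
      using that p unfolding X by (intro besov_space_lincomb) auto
    show "pair (a *\<^sub>R f + b *\<^sub>R g) i = a * pair f i + b * pair g i" if "f \<in> X" "g \<in> X" for f g a b i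
      using that pairing unfolding X wavelet_pairing_def by blast
    show "0 < besov_weight (level i) p s CARD('d)" for i by (simp add: besov_weight_def)
    show "summable (\<lambda>i. besov_weight (level i) p s CARD('d) * \<bar>pair f i\<bar> powr p)" if "f \<in> X" for f
      using that equivalent unfolding X wavelet_norm_equivalent_def by simp
  qed
  have normX_eq: "normX = wc.coord_norm"
    unfolding normX by (intro ext) (simp add: wavelet_norm_def wc.coord_norm_def)
  have R_eq: "R = wc.penalty"
    unfolding R normX_eq by (intro ext) (simp add: wc.penalty_def)
  have space_\<mu>: "space \<mu> = U" using sets_eq_imp_space_eq[OF mu(2)] by (simp add: space_restrict_space)
  then have U_ne: "U \<noteq> {}" using prob_space.not_empty[OF mu(1)] by simp
  have A_lin: "A (a *\<^sub>R f + b *\<^sub>R g) = a *\<^sub>R A f + b *\<^sub>R A g" if "f \<in> X" "g \<in> X" for f g a b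
    using A[unfolded forward_operator_def, THEN conjunct1, rule_format, OF that] .
  note emb = Z[unfolded function_space_embedding_def]
  have emb_lin: "emb (a *\<^sub>R y + b *\<^sub>R z) x = a *\<^sub>R emb y x + b *\<^sub>R emb z x" if "x \<in> U" for y z a b x
    using emb[THEN conjunct1, rule_format, OF that] .
  have emb_cont: "continuous_on U (emb z)" for z
    using emb[THEN conjunct2, THEN conjunct2, THEN conjunct1, rule_format] .
  define L where "L f = emb (A f)" for f
  have L_lin: "L (a *\<^sub>R f + b *\<^sub>R g) x = a *\<^sub>R L f x + b *\<^sub>R L g x" if "f \<in> X" "g \<in> X" "x \<in> U" for f g a b x
    using that by (simp add: L_def A_lin emb_lin)
  have L_cont: "continuous_on U (L f)" for f
    unfolding L_def by (rule emb_cont)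
  have L_bound: "norm (L f x) \<le> wc.coord_norm f" if "f \<in> X" "x \<in> U" for f x
  proof -
    obtain \<kappa> where \<kappa>: "\<kappa> \<le> 1" "norm (emb (A f) x) \<le> \<kappa> * normX f" using A1 \<open>f \<in> X\<close> \<open>x \<in> U\<close> by blast
    have "0 \<le> normX f" by (simp add: normX wavelet_norm_def)
    then have "\<kappa> * normX f \<le> 1 * normX f" by (intro mult_right_mono \<kappa>)
    with \<kappa>(2) show ?thesis by (simp add: L_def normX_eq)
  qed
  obtain w where w: "\<And>h. h \<in> X \<Longrightarrow> grad R f\<^sub>0 h = adjoint_on \<mu> (\<lambda>f. emb (A f)) (emb w) h" using B1 by blast
  obtain C where C: "\<And>x. x \<in> U \<Longrightarrow> norm (emb w x) \<le> C * norm w"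
    using emb[THEN conjunct2, THEN conjunct2, THEN conjunct2, THEN conjunct2] by auto
  \<comment> \<open>Adding 1 keeps \<open>W\<close> positive even for a vanishing source element, as
    the moment bounds require.\<close>
  define W where "W = \<bar>C * norm w\<bar> + 1"
  have "norm (emb w x) \<le> W" if "x \<in> U" for x using C[OF that] unfolding W_def by linarith
  moreover have "0 < W" unfolding W_def by linarith
  ultimately have W: "0 < W" "\<And>x. x \<in> U \<Longrightarrow> norm (emb w x) \<le> W" by blast+
  define T where "T i = dist_of (\<psi> i)" for i
  \<comment> \<open>The wavelets themselves, viewed as distributions, serve as coordinate vectors;
    the norm equivalence includes their membership in the space.\<close>
  have T: "T i \<in> X" "represents (T i) (\<psi> i)" for i
  proof -
    obtain S where "S \<in> besov_space \<Phi> s p" "represents S (\<psi> i)"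
      using equivalent unfolding wavelet_norm_equivalent_def by blast
    moreover from this have "T i = S" unfolding T_def by (intro dist_of_eq)
    ultimately show "T i \<in> X" "represents (T i) (\<psi> i)" by (simp_all add: X)
  qed
  have basis: "orthonormal_L2_basis \<psi>" using wavelets by (simp add: wavelet_basis_def)
  \<comment> \<open>On square integrable elements the extended pairing is the L2 inner product, so
    orthonormality of the wavelets gives the Kronecker delta.\<close>
  have T_pair: "pair (T i) j = (if i = j then 1 else 0)" for i j
  proof -
    have "square_integrable (\<psi> i)" using basis by (simp add: orthonormal_L2_basis_def)
    then have "pair (T i) j = (\<integral>x. \<psi> i x * \<psi> j x \<partial>lborel)"
      using pairing T[of i] unfolding wavelet_pairing_def X by blast
    then show ?thesis using basis by (simp add: orthonormal_L2_basis_def)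
  qed
  define G where "G i = sup_norm_on U (L (T i))" for i
  have G: "norm (L (T i) x) \<le> G i" if "x \<in> U" for i x
    unfolding G_def sup_norm_on_def using that L_bound[OF T(1)[of i]]
    by (intro cSUP_upper bdd_aboveI2[of U _ "wc.coord_norm (T i)"])
  have G0: "0 \<le> G i" for i
    using U_ne G[of _ i] by (meson all_not_in_conv norm_ge_zero order_trans)
  have conj: "besov_weight (level i) q (- s) CARD('d) = besov_weight (level i) p s CARD('d) powr (- (q / p))" for i
    by (rule besov_weight_conjugate[OF p q]) simp
  have "summable (\<lambda>i. besov_weight (level i) p s CARD('d) powr (- (q / p)) * G i powr q)"
    using B2 unfolding conj G_def L_def T_def .
  note summable_G = this
  have source: "grad wc.penalty f\<^sub>0 h = (\<integral>x. L h x \<bullet> emb w x \<partial>\<mu>)" if "h \<in> X" for h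
    using w[OF that] by (simp add: R_eq adjoint_on_def L_def)
  show ?thesis
  proof (rule wc.expected_bregman_bound[OF q M less_imp_le[OF Sigma] u eps nu indep L_lin L_cont L_bound emb_cont W(2,1)
        truth(1) source T(1) T_pair G0 G summable_G])
    fix K :: real
    assume K: "0 < K" "\<And>N d \<alpha> fm. 0 < N \<Longrightarrow> 0 < d \<Longrightarrow> 0 < \<alpha> \<Longrightarrow>
      (\<And>\<omega>. \<omega> \<in> space M \<Longrightarrow> fm \<omega> \<in> X) \<Longrightarrow>
      (\<And>\<omega> t. \<omega> \<in> space M \<Longrightarrow> 0 < t \<Longrightarrow> t < 1 \<Longrightarrow>
        1 / 2 * (VN_norm N (\<lambda>n. L (fm \<omega>) (u n \<omega>) - (L f\<^sub>0 (u n \<omega>) + d *\<^sub>R eps n \<omega>)))\<^sup>2 + \<alpha> * wc.penalty (fm \<omega>) \<le>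
        1 / 2 * (VN_norm N (\<lambda>n. L (fm \<omega> + t *\<^sub>R (f\<^sub>0 - fm \<omega>)) (u n \<omega>) - (L f\<^sub>0 (u n \<omega>) + d *\<^sub>R eps n \<omega>)))\<^sup>2 +
          \<alpha> * wc.penalty (fm \<omega> + t *\<^sub>R (f\<^sub>0 - fm \<omega>))) \<Longrightarrow>
      (\<integral>\<^sup>+\<omega>. ennreal (bregman wc.penalty (fm \<omega>) f\<^sub>0) \<partial>M) \<le>
        ennreal (K * (\<alpha> + ((d / \<alpha> + 1) / sqrt (real N)) powr q + ((d / \<alpha> + 1) / sqrt (real N))\<^sup>2))"
  have q2: "2 < q" by (rule conjugate_exponent_gt_two[OF p q])
  have rate: "(\<integral>\<^sup>+\<omega>. ennreal (bregman R (fm \<omega>) f\<^sub>0) \<partial>M) \<le> ennreal (K * (c + l powr q + l\<^sup>2) * t)"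
    if N: "0 < N" and d: "0 < d" and \<alpha>: "0 < \<alpha>" "\<alpha> \<le> c * t" and t: "0 < t" "t \<le> 1"
      and l: "0 \<le> l" "(d / \<alpha> + 1) / sqrt (real N) \<le> l * sqrt t"
      and fm: "\<And>\<omega>. \<omega> \<in> space M \<Longrightarrow> is_arg_min (F\<^sub>\<delta> N \<omega> d \<alpha>) (\<lambda>f. f \<in> X) (fm \<omega>)"
    for N d \<alpha> c t l fm
  proof -
    have arg: "is_arg_min (tikhonov R N (\<lambda>f n. L f (u n \<omega>)) (\<lambda>n. L f\<^sub>0 (u n \<omega>) + d *\<^sub>R eps n \<omega>) \<alpha>) (\<lambda>f. f \<in> X) (fm \<omega>)"
      if "\<omega> \<in> space M" for \<omega>
      using fm[OF that] unfolding functional L_def .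
    note minimiser = tikhonov_minimiser[OF arg truth wc.lincomb_mem, unfolded R_eq]
    have "(\<integral>\<^sup>+\<omega>. ennreal (bregman R (fm \<omega>) f\<^sub>0) \<partial>M) \<le>
        ennreal (K * (\<alpha> + ((d / \<alpha> + 1) / sqrt (real N)) powr q + ((d / \<alpha> + 1) / sqrt (real N))\<^sup>2))"
      unfolding R_eq by (rule K(2)[OF N d \<alpha>(1) minimiser])
    also have "\<dots> \<le> ennreal (K * ((c + l powr q + l\<^sup>2) * t))"
      using d \<alpha>(1) l by (intro ennreal_leI mult_left_mono rate_bound[OF q2 t \<alpha>(2)] less_imp_le[OF K(1)]) auto
    finally show ?thesis by (simp add: mult.assoc)
  qed
  show ?thesis
  proof (intro conjI allI impI, goal_cases)
    case (1 c\<^sub>1 c\<^sub>2)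
    define l where "l = 1 / c\<^sub>1 + 1"
    have l: "0 \<le> l" using 1 by (simp add: l_def)
    show ?case
    proof (intro exI[of _ "K * (c\<^sub>2 + l powr q + l\<^sup>2)"] conjI allI impI)
      show "0 < K * (c\<^sub>2 + l powr q + l\<^sup>2)" using K(1) 1 by (simp add: add_pos_nonneg)
      fix \<delta> \<alpha> :: "nat \<Rightarrow> real" and fmin
      assume \<delta>: "\<forall>N. 0 < \<delta> N" and inf: "LIM N sequentially. \<delta> N * real N :> at_top"
        and zero: "(\<lambda>N. (\<delta> N)\<^sup>2 / real N) \<longlonglongrightarrow> 0"
        and \<alpha>: "\<forall>\<^sub>F N in sequentially. c\<^sub>1 * ((\<delta> N)\<^sup>2 / real N) powr (1 / 3) \<le> \<alpha> N \<and>
               \<alpha> N \<le> c\<^sub>2 * ((\<delta> N)\<^sup>2 / real N) powr (1 / 3)"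
        and fmin: "\<forall>\<^sub>F N in sequentially. \<forall>\<omega>\<in>space M. is_arg_min (F\<^sub>\<delta> N \<omega> (\<delta> N) (\<alpha> N)) (\<lambda>f. f \<in> X) (fmin N \<omega>)"
      \<comment> \<open>Divergence of \<open>\<delta> N * real N\<close> enters through this bound,
        which puts \<open>1 / real N\<close> below the rate; convergence of
        \<open>(\<delta> N)\<^sup>2 / real N\<close> to 0 puts the rate below 1.\<close>
      have "\<forall>\<^sub>F N in sequentially. 1 \<le> \<delta> N * real N" using inf by (simp add: filterlim_at_top)
      moreover have "\<forall>\<^sub>F N in sequentially. (\<delta> N)\<^sup>2 / real N < 1" using zero by (rule order_tendstoD) simp
      ultimately show "\<forall>\<^sub>F N in sequentially. (\<integral>\<^sup>+\<omega>. ennreal (bregman R (fmin N \<omega>) f\<^sub>0) \<partial>M) \<le>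
          ennreal (K * (c\<^sub>2 + l powr q + l\<^sup>2) * ((\<delta> N)\<^sup>2 / real N) powr (1 / 3))"
        using \<alpha> fmin eventually_gt_at_top[of "0::nat"]
      proof eventually_elim
        case (elim N)
        have d: "0 < \<delta> N" using \<delta> by simp
        have t: "0 < ((\<delta> N)\<^sup>2 / real N) powr (1 / 3)" using d elim by simp
        have t1: "((\<delta> N)\<^sup>2 / real N) powr (1 / 3) \<le> 1" using elim by (intro powr_le1) auto
        have "0 < \<alpha> N" using mult_pos_pos[OF 1(1) t] elim by linarith
        then show ?case
          using elim d t t1 l rate_large_noise[of N "\<delta> N" c\<^sub>1 _ "\<alpha> N"] 1
          by (intro rate) (auto simp: l_def)
      qed
    qed
  next
    case (2 c\<^sub>1 c\<^sub>2 B)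
    \<comment> \<open>\<open>B\<close> is fixed before \<delta>, when its sign is not yet known; the
      absolute value keeps the constant non-negative.\<close>
    define l where "l = \<bar>B\<bar> / c\<^sub>1 + 1"
    have l: "0 \<le> l" using 2 by (simp add: l_def)
    show ?case
    proof (intro exI[of _ "K * (c\<^sub>2 + l powr q + l\<^sup>2)"] conjI allI impI)
      show "0 < K * (c\<^sub>2 + l powr q + l\<^sup>2)" using K(1) 2 by (simp add: add_pos_nonneg)
      fix \<delta> \<alpha> :: "nat \<Rightarrow> real" and fmin
      assume \<delta>: "\<forall>N. 0 < \<delta> N" and B: "\<forall>N. \<delta> N * real N \<le> B"
        and \<alpha>: "\<forall>\<^sub>F N in sequentially. c\<^sub>1 / real N \<le> \<alpha> N \<and> \<alpha> N \<le> c\<^sub>2 / real N"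
        and fmin: "\<forall>\<^sub>F N in sequentially. \<forall>\<omega>\<in>space M. is_arg_min (F\<^sub>\<delta> N \<omega> (\<delta> N) (\<alpha> N)) (\<lambda>f. f \<in> X) (fmin N \<omega>)"
      show "\<forall>\<^sub>F N in sequentially. (\<integral>\<^sup>+\<omega>. ennreal (bregman R (fmin N \<omega>) f\<^sub>0) \<partial>M) \<le>
          ennreal (K * (c\<^sub>2 + l powr q + l\<^sup>2) / real N)"
        using \<alpha> fmin eventually_gt_at_top[of "0::nat"]
      proof eventually_elim
        case (elim N)
        have d: "0 < \<delta> N" using \<delta> by simp
        have "0 < c\<^sub>1 / real N" using 2 elim by simp
        then have "0 < \<alpha> N" using elim by linarith
        moreover have "(\<delta> N / \<alpha> N + 1) / sqrt (real N) \<le> l * sqrt (1 / real N)"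
          unfolding l_def using elim d B 2 by (intro rate_small_noise) auto
        ultimately have "(\<integral>\<^sup>+\<omega>. ennreal (bregman R (fmin N \<omega>) f\<^sub>0) \<partial>M) \<le>
            ennreal (K * (c\<^sub>2 + l powr q + l\<^sup>2) * (1 / real N))"
          using elim d l by (intro rate) auto
        then show ?case by simp
      qed
    qed
  qed
  qed
qed

end
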